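(* Let $G$ be a (topologically) characteristically simple topological group which is not amenable. Then $G$ acts effectively on its universal minimal strongly proximal flow $\Pi_s(G)$; that is, if $t\in G$ satisfies $tx=x$ for all $x\in\Pi_s(G)$, then $t=e$.
   Context: A topological group is a group with a Hausdorff topology such that $(x,y)\mapsto xy^{-1}$ is continuous; $e$ is its neutral element. A flow $(G,X)$ consists of a topological group $G$ and a (nonempty) compact Hausdorff space $X$ with a jointly continuous action $G\times X\to X$, $(t,x)\mapsto tx$. A flow is minimal if every orbit is dense; proximal if for all $x,y\in X$ there is a net $\{t_n\}$ in $G$ with $\lim t_nx=\lim t_ny$. $\mathcal M(X)$ is the compact convex set of (quasi-)regular Borel probability measures on $X$ with the weak-* topology; $G$ acts on it by push-forward. The flow $(G,X)$ is strongly proximal if $(G,\mathcal M(X))$ is proximal. The universal minimal strongly proximal flow $(G,\Pi_s(G))$ is the minimal strongly proximal flow, unique up to isomorphism, such that every minimal strongly proximal flow $(G,Y)$ is the image of $\Pi_s(G)$ under a continuous surjective $G$-equivariant map (existence and uniqueness are known). A topological group $G$ is amenable if every flow $(G,X)$ admits an invariant measure in $\mathcal M(X)$; it is known that this holds if and only if $\Pi_s(G)$ is a single point. $\mathrm{Aut}(G)$ is the group of topological automorphisms of $G$ and $\mathrm{Aut}(G)t=\{a(t)\mid a\in\mathrm{Aut}(G)\}$. $G$ is (topologically) characteristically simple if for every $t\in G$ with $t\ne e$ the subgroup $\langle\mathrm{Aut}(G)t\rangle$ algebraically generated by $\mathrm{Aut}(G)t$ is dense in $G$. *)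

theory Defs
  imports "HOL-Probability.Probability" "HOL-Algebra.Group_Action" "HOL-Algebra.Generated_Groups"
begin

no_notation eq_closure_of (\<open>closure'_of\<index>\<close>)

section \<open>Topological groups and flows\<close>

locale topological_group = group G for G (structure) +
  fixes T :: "'g topology"
  assumes topspace_group: "topspace T = carrier G"
    and Hausdorff_group: "Hausdorff_space T"
    and continuous_mult_inv: "continuous_map (prod_topology T T) T (\<lambda>(x, y). x \<otimes> inv y)"

definition topological_auto :: "('g, 'm) monoid_scheme \<Rightarrow> 'g topology \<Rightarrow> ('g \<Rightarrow> 'g) set" where
  "topological_auto G T = {a \<in> auto G. homeomorphic_map T T a}"

definition characteristically_simple :: "('g, 'm) monoid_scheme \<Rightarrow> 'g topology \<Rightarrow> bool" where
  "characteristically_simple G T \<longleftrightarrow>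
     (\<forall>t\<in>carrier G. t \<noteq> \<one>\<^bsub>G\<^esub> \<longrightarrow>
        T closure_of generate G {a t | a. a \<in> topological_auto G T} = topspace T)"

locale flow = topological_group G T + group_action G "topspace X" \<phi>
  for G (structure) and T :: "'g topology" and X :: "'x topology" and \<phi> :: "'g \<Rightarrow> 'x \<Rightarrow> 'x" +
  assumes compact_phase: "compact_space X"
    and Hausdorff_phase: "Hausdorff_space X"
    and nonempty_phase: "topspace X \<noteq> {}"
    and continuous_action: "continuous_map (prod_topology T X) X (\<lambda>(t, x). \<phi> t x)"

definition minimal_flow ::
    "('g, 'm) monoid_scheme \<Rightarrow> 'g topology \<Rightarrow> 'x topology \<Rightarrow> ('g \<Rightarrow> 'x \<Rightarrow> 'x) \<Rightarrow> bool" where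
  "minimal_flow G T X \<phi> \<longleftrightarrow>
     flow G T X \<phi> \<and> (\<forall>x\<in>topspace X. X closure_of orbit G \<phi> x = topspace X)"

text \<open>Nets in \<open>G\<close> are rendered, as usual, by proper filters concentrated on \<open>carrier G\<close>.\<close>

definition proximal :: "('g, 'm) monoid_scheme \<Rightarrow> 'x topology \<Rightarrow> ('g \<Rightarrow> 'x \<Rightarrow> 'x) \<Rightarrow> bool" where
  "proximal G X \<phi> \<longleftrightarrow>
     (\<forall>x\<in>topspace X. \<forall>y\<in>topspace X. \<exists>F z.
        F \<noteq> bot \<and> (\<forall>\<^sub>F t in F. t \<in> carrier G) \<and>
        limitin X (\<lambda>t. \<phi> t x) z F \<and> limitin X (\<lambda>t. \<phi> t y) z F)"


section \<open>Regular Borel probability measures\<close>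

definition borel_of :: "'x topology \<Rightarrow> 'x measure" where
  "borel_of X = sigma (topspace X) {U. openin X U}"

definition regular_probs :: "'x topology \<Rightarrow> 'x measure set" where
  "regular_probs X =
     {\<mu>. prob_space \<mu> \<and> sets \<mu> = sets (borel_of X) \<and>
         (\<forall>A\<in>sets \<mu>.
            emeasure \<mu> A = (INF U\<in>{U. openin X U \<and> A \<subseteq> U}. emeasure \<mu> U) \<and>
            emeasure \<mu> A = (SUP K\<in>{K. compactin X K \<and> K \<subseteq> A}. emeasure \<mu> K))}"

text \<open>The coarsest topology on the regular probability measures making
  \<open>\<mu> \<mapsto> \<integral> f d\<mu>\<close> continuous for every continuous real function \<open>f\<close>.\<close>

definition weak_star :: "'x topology \<Rightarrow> 'x measure topology" where
  "weak_star X = topology_generated_by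
     {{\<mu> \<in> regular_probs X. (\<integral>x. f x \<partial>\<mu>) \<in> U} | f U.
        continuous_map X euclideanreal f \<and> open U}"

definition push_action :: "'x topology \<Rightarrow> ('g \<Rightarrow> 'x \<Rightarrow> 'x) \<Rightarrow> 'g \<Rightarrow> 'x measure \<Rightarrow> 'x measure" where
  "push_action X \<phi> t = (\<lambda>\<mu>\<in>regular_probs X. distr \<mu> (borel_of X) (\<phi> t))"

definition strongly_proximal ::
    "('g, 'm) monoid_scheme \<Rightarrow> 'x topology \<Rightarrow> ('g \<Rightarrow> 'x \<Rightarrow> 'x) \<Rightarrow> bool" where
  "strongly_proximal G X \<phi> \<longleftrightarrow> proximal G (weak_star X) (push_action X \<phi>)"


section \<open>Amenability and the universal minimal strongly proximal flow\<close>

text \<open>HOL cannot quantify over all types inside a definition, so the two definitions below let the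
  test flows range over all topological spaces with points in \<open>'g set set\<close>. This is no
  restriction: a space with a dense orbit has at most \<open>2^(2^|G|)\<close> points. The lemmas
  \<open>amenable_any_type\<close> and \<open>universal_any_type\<close> at the end of this theory
  prove that both properties hold for flows on arbitrary types.\<close>

definition amenable :: "('g, 'm) monoid_scheme \<Rightarrow> 'g topology \<Rightarrow> bool" where
  "amenable G T \<longleftrightarrow>
     (\<forall>(X :: 'g set set topology) \<phi>. flow G T X \<phi> \<longrightarrow>
        (\<exists>\<mu>\<in>regular_probs X. \<forall>t\<in>carrier G. push_action X \<phi> t \<mu> = \<mu>))"

definition universal_msp_flow ::
    "('g, 'm) monoid_scheme \<Rightarrow> 'g topology \<Rightarrow> 'x topology \<Rightarrow> ('g \<Rightarrow> 'x \<Rightarrow> 'x) \<Rightarrow> bool" where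
  "universal_msp_flow G T X \<phi> \<longleftrightarrow>
     minimal_flow G T X \<phi> \<and> strongly_proximal G X \<phi> \<and>
     (\<forall>(Y :: 'g set set topology) \<psi>. minimal_flow G T Y \<psi> \<and> strongly_proximal G Y \<psi> \<longrightarrow>
        (\<exists>p. continuous_map X Y p \<and> p ` topspace X = topspace Y \<and>
             (\<forall>t\<in>carrier G. \<forall>x\<in>topspace X. p (\<phi> t x) = \<psi> t (p x))))"


section \<open>Independence of the type of the test flows\<close>

lemma space_borel_of [simp]: "space (borel_of X) = topspace X"
  by (simp add: borel_of_def space_measure_of_conv)

lemma sets_borel_of: "sets (borel_of X) = sigma_sets (topspace X) {U. openin X U}"
  unfolding borel_of_def by (rule sets_measure_of) (auto dest: openin_subset)

lemma openin_borel_of: "openin X U \<Longrightarrow> U \<in> sets (borel_of X)"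
  by (simp add: sets_borel_of sigma_sets.Basic)

lemma closedin_borel_of: "closedin X C \<Longrightarrow> C \<in> sets (borel_of X)"
  by (metis closedin_def openin_borel_of sets.compl_sets space_borel_of double_diff order_refl)

lemma continuous_map_measurable:
  assumes "continuous_map X Y f" shows "f \<in> measurable (borel_of X) (borel_of Y)"
  unfolding borel_of_def[of Y]
proof (rule measurable_measure_of)
  show "{U. openin Y U} \<subseteq> Pow (topspace Y)" by (auto dest: openin_subset)
  show "f \<in> space (borel_of X) \<rightarrow> topspace Y"
    using assms by (auto simp: continuous_map_def)
  fix U assume "U \<in> {U. openin Y U}"
  then have "openin X {x \<in> topspace X. f x \<in> U}"
    using assms by (simp add: continuous_map_def)
  moreover have "f -` U \<inter> space (borel_of X) = {x \<in> topspace X. f x \<in> U}" by auto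
  ultimately show "f -` U \<inter> space (borel_of X) \<in> sets (borel_of X)"
    by (simp add: openin_borel_of)
qed

lemma regular_probsD:
  assumes "\<mu> \<in> regular_probs X"
  shows "prob_space \<mu>" "sets \<mu> = sets (borel_of X)" "space \<mu> = topspace X"
    "measurable \<mu> N = measurable (borel_of X) N"
  using assms sets_eq_imp_space_eq[of \<mu> "borel_of X"]
  by (auto simp: regular_probs_def intro!: measurable_cong_sets)

lemma regular_probsI:
  assumes H: "Hausdorff_space X" and p: "prob_space \<mu>" and s: "sets \<mu> = sets (borel_of X)"
    and inner: "\<And>A. A \<in> sets \<mu> \<Longrightarrow>
      emeasure \<mu> A \<le> (SUP K\<in>{K. compactin X K \<and> K \<subseteq> A}. emeasure \<mu> K)"
  shows "\<mu> \<in> regular_probs X"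
proof -
  interpret prob_space \<mu> by fact
  have sp: "space \<mu> = topspace X" using sets_eq_imp_space_eq[OF s] by simp
  have ms: "K \<in> sets \<mu>" if "compactin X K" for K
    using that compactin_imp_closedin[OF H] s by (simp add: closedin_borel_of)
  have in1: "emeasure \<mu> A = (SUP K\<in>{K. compactin X K \<and> K \<subseteq> A}. emeasure \<mu> K)" if "A \<in> sets \<mu>" for A
    using that by (intro antisym inner SUP_least emeasure_mono) auto
  have out1: "(INF U\<in>{U. openin X U \<and> A \<subseteq> U}. emeasure \<mu> U) \<le> emeasure \<mu> A" if A: "A \<in> sets \<mu>" for A
  proof (rule ennreal_le_epsilon)
    fix e :: real assume e: "0 < e"
    define B where "B = space \<mu> - A"
    have B: "B \<in> sets \<mu>" using A by (simp add: B_def)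
    obtain K where K: "compactin X K" "K \<subseteq> B" "measure \<mu> B - e < measure \<mu> K"
    proof (cases "measure \<mu> B - e < 0")
      case True
      then show ?thesis using that[of "{}"] by simp
    next
      case False
      then have "ennreal (measure \<mu> B - e) < emeasure \<mu> B"
        using e by (simp add: emeasure_eq_measure ennreal_less_iff)
      then have "\<exists>K\<in>{K. compactin X K \<and> K \<subseteq> B}. ennreal (measure \<mu> B - e) < emeasure \<mu> K"
        unfolding in1[OF B] less_SUP_iff .
      then obtain K where "compactin X K" "K \<subseteq> B" "ennreal (measure \<mu> B - e) < emeasure \<mu> K"
        by auto
      then show ?thesis using that[of K] False by (simp add: emeasure_eq_measure ennreal_less_iff)
    qed
    have U: "openin X (topspace X - K)" "A \<subseteq> topspace X - K"
      using K compactin_imp_closedin[OF H] sets.sets_into_space[OF A] sp by (auto simp: B_def)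
    have "(INF U\<in>{U. openin X U \<and> A \<subseteq> U}. emeasure \<mu> U) \<le> emeasure \<mu> (topspace X - K)"
      using U by (intro INF_lower) auto
    also have "\<dots> = ennreal (1 - measure \<mu> K)"
      using prob_compl[OF ms[OF K(1)]] sp by (simp add: emeasure_eq_measure)
    also have "\<dots> \<le> ennreal (measure \<mu> A + e)"
      using K(3) prob_compl[OF A] by (intro ennreal_leI) (simp add: B_def)
    also have "\<dots> = emeasure \<mu> A + ennreal e"
      using e by (simp add: emeasure_eq_measure ennreal_plus)
    finally show "(INF U\<in>{U. openin X U \<and> A \<subseteq> U}. emeasure \<mu> U) \<le> emeasure \<mu> A + ennreal e" .
  qed
  have "emeasure \<mu> A = (INF U\<in>{U. openin X U \<and> A \<subseteq> U}. emeasure \<mu> U)" if A: "A \<in> sets \<mu>" for A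
    using s by (intro antisym out1[OF A] INF_greatest emeasure_mono) (auto simp: openin_borel_of)
  then show ?thesis using p s in1 unfolding regular_probs_def by blast
qed

lemma regular_probs_distr:
  assumes c: "continuous_map X Y f" and H: "Hausdorff_space X" "Hausdorff_space Y"
    and mu: "\<mu> \<in> regular_probs X"
  shows "distr \<mu> (borel_of Y) f \<in> regular_probs Y"
proof (rule regular_probsI[OF H(2)])
  interpret prob_space \<mu> using regular_probsD(1)[OF mu] .
  have f: "f \<in> measurable \<mu> (borel_of Y)"
    using continuous_map_measurable[OF c] by (simp add: regular_probsD(4)[OF mu])
  show "prob_space (distr \<mu> (borel_of Y) f)" by (rule prob_space_distr[OF f])
  fix A assume "A \<in> sets (distr \<mu> (borel_of Y) f)"
  then have A: "A \<in> sets (borel_of Y)" by simp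
  have "emeasure (distr \<mu> (borel_of Y) f) A = emeasure \<mu> (f -` A \<inter> space \<mu>)"
    by (rule emeasure_distr[OF f A])
  also have "\<dots> = (SUP K\<in>{K. compactin X K \<and> K \<subseteq> f -` A \<inter> space \<mu>}. emeasure \<mu> K)"
    using mu measurable_sets[OF f A] unfolding regular_probs_def by blast
  also have "\<dots> \<le> (SUP K\<in>{K. compactin Y K \<and> K \<subseteq> A}. emeasure (distr \<mu> (borel_of Y) f) K)"
  proof (rule SUP_least)
    fix K assume "K \<in> {K. compactin X K \<and> K \<subseteq> f -` A \<inter> space \<mu>}"
    then have K: "compactin X K" "K \<subseteq> f -` A \<inter> space \<mu>" by auto
    have C: "compactin Y (f ` K)" by (rule image_compactin[OF K(1) c])
    have fK: "f ` K \<in> sets (borel_of Y)"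
      using C compactin_imp_closedin[OF H(2)] by (simp add: closedin_borel_of)
    have "emeasure \<mu> K \<le> emeasure \<mu> (f -` (f ` K) \<inter> space \<mu>)"
      using K by (intro emeasure_mono measurable_sets[OF f fK]) auto
    also have "\<dots> = emeasure (distr \<mu> (borel_of Y) f) (f ` K)"
      by (rule emeasure_distr[OF f fK, symmetric])
    also have "\<dots> \<le> (SUP K\<in>{K. compactin Y K \<and> K \<subseteq> A}. emeasure (distr \<mu> (borel_of Y) f) K)"
      using C K by (intro SUP_upper) auto
    finally show "emeasure \<mu> K \<le> \<dots>" .
  qed
  finally show "emeasure (distr \<mu> (borel_of Y) f) A \<le> \<dots>" .
qed simp

lemma topspace_weak_star [simp]: "topspace (weak_star X) = regular_probs X"
proof -
  have "regular_probs X = {\<mu> \<in> regular_probs X. (\<integral>x. 0 \<partial>\<mu>) \<in> (UNIV :: real set)}" by simp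
  moreover have "\<dots> \<in> {{\<mu> \<in> regular_probs X. (\<integral>x. f x \<partial>\<mu>) \<in> U} | f U.
      continuous_map X euclideanreal f \<and> open U}"
    by (rule CollectI, rule exI[of _ "\<lambda>_. 0"], rule exI[of _ UNIV]) simp
  ultimately show ?thesis
    unfolding weak_star_def topology_generated_by_topspace by blast
qed

lemma continuous_map_integral:
  assumes "continuous_map X euclideanreal f" and mu: "\<mu> \<in> regular_probs X"
  shows "f \<in> borel_measurable \<mu>"
proof -
  have "borel_of euclideanreal = (borel :: real measure)"
    by (simp add: borel_of_def borel_def)
  then show ?thesis
    using continuous_map_measurable[OF assms(1)] by (simp add: regular_probsD(4)[OF mu])
qed

lemma continuous_map_push:
  assumes c: "continuous_map X Y f" and H: "Hausdorff_space X" "Hausdorff_space Y"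
  shows "continuous_map (weak_star X) (weak_star Y) (\<lambda>\<mu>. distr \<mu> (borel_of Y) f)"
  unfolding weak_star_def[of Y] continuous_on_generated_topo_iff
proof (intro conjI allI impI)
  fix V
  assume "V \<in> {{\<mu> \<in> regular_probs Y. (\<integral>x. g x \<partial>\<mu>) \<in> U} | g U.
      continuous_map Y euclideanreal g \<and> open U}"
  then obtain g and U :: "real set" where V: "V = {\<mu> \<in> regular_probs Y. (\<integral>x. g x \<partial>\<mu>) \<in> U}"
    and g: "continuous_map Y euclideanreal g" and U: "open U" by blast
  have gf: "continuous_map X euclideanreal (\<lambda>x. g (f x))"
    using continuous_map_compose[OF c g] by (simp add: o_def)
  have eq: "(\<integral>y. g y \<partial>distr \<mu> (borel_of Y) f) = (\<integral>x. g (f x) \<partial>\<mu>)" if "\<mu> \<in> regular_probs X" for \<mu>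
  proof (rule integral_distr)
    show "f \<in> measurable \<mu> (borel_of Y)"
      using continuous_map_measurable[OF c] by (simp add: regular_probsD(4)[OF that])
    show "g \<in> borel_measurable (borel_of Y)"
      using continuous_map_measurable[OF g] by (simp add: borel_of_def[of euclideanreal] borel_def)
  qed
  have "(\<lambda>\<mu>. distr \<mu> (borel_of Y) f) -` V \<inter> topspace (weak_star X)
      = {\<mu> \<in> regular_probs X. (\<integral>x. g (f x) \<partial>\<mu>) \<in> U}"
    using regular_probs_distr[OF c H] by (auto simp: V eq)
  also have "openin (weak_star X) \<dots>"
    unfolding weak_star_def using gf U by (intro topology_generated_by_Basis) blast
  finally show "openin (weak_star X) ((\<lambda>\<mu>. distr \<mu> (borel_of Y) f) -` V \<inter> topspace (weak_star X))" .
next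
  show "(\<lambda>\<mu>. distr \<mu> (borel_of Y) f) ` topspace (weak_star X) \<subseteq>
      \<Union> {{\<mu> \<in> regular_probs Y. (\<integral>x. g x \<partial>\<mu>) \<in> U} | g U.
        continuous_map Y euclideanreal g \<and> open U}"
    using regular_probs_distr[OF c H] topspace_weak_star[of Y]
    unfolding weak_star_def[of Y] topology_generated_by_topspace by auto
qed

lemma (in flow) action_closed: "t \<in> carrier G \<Longrightarrow> x \<in> topspace X \<Longrightarrow> \<phi> t x \<in> topspace X"
  by (rule element_image) auto

lemma (in flow) continuous_translate:
  assumes "t \<in> carrier G" shows "continuous_map X X (\<phi> t)"
proof -
  have "continuous_map X (prod_topology T X) (\<lambda>x. (t, x))"
    using assms by (simp add: continuous_map_pairedI topspace_group)
  from continuous_map_compose[OF this continuous_action] show ?thesis by (simp add: o_def)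
qed

text \<open>A point \<open>x\<close> is coded by the family of those \<open>A \<subseteq> G\<close> with \<open>x\<close> in the closure of \<open>A x0\<close>.\<close>

lemma (in flow) dense_orbit_injection:
  "\<exists>h :: 'x \<Rightarrow> 'g set set. inj_on h (X closure_of orbit G \<phi> x0)"
proof (intro exI inj_onI)
  let ?h = "\<lambda>x. {A. A \<subseteq> carrier G \<and> x \<in> X closure_of ((\<lambda>t. \<phi> t x0) ` A)}"
  fix x y assume cl: "x \<in> X closure_of orbit G \<phi> x0" "y \<in> X closure_of orbit G \<phi> x0"
    and eq: "?h x = ?h y"
  then have xy: "x \<in> topspace X" "y \<in> topspace X" by (simp_all add: in_closure_of)
  show "x = y"
  proof (rule ccontr)
    assume "x \<noteq> y"
    then obtain U V where UV: "openin X U" "openin X V" "x \<in> U" "y \<in> V" "disjnt U V"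
      using Hausdorff_phase xy unfolding Hausdorff_space_def by blast
    define A where "A = {t \<in> carrier G. \<phi> t x0 \<in> U}"
    have "x \<in> X closure_of ((\<lambda>t. \<phi> t x0) ` A)"
      unfolding in_closure_of
    proof (intro conjI allI impI xy)
      fix W assume W: "x \<in> W \<and> openin X W"
      then have "x \<in> U \<inter> W" "openin X (U \<inter> W)" using UV by auto
      then obtain z where "z \<in> orbit G \<phi> x0" "z \<in> U \<inter> W"
        using cl unfolding in_closure_of by blast
      then show "\<exists>y. y \<in> (\<lambda>t. \<phi> t x0) ` A \<and> y \<in> W"
        by (auto simp: orbit_def A_def)
    qed
    then have "A \<in> ?h x" by (auto simp: A_def)
    then have "y \<in> X closure_of ((\<lambda>t. \<phi> t x0) ` A)" using eq by blast
    then obtain z where "z \<in> (\<lambda>t. \<phi> t x0) ` A" "z \<in> V"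
      using UV unfolding in_closure_of by blast
    then show False using UV by (auto simp: A_def disjnt_def)
  qed
qed

text \<open>A flow pulled back along a closed embedding \<open>g\<close> onto an invariant set is a flow.\<close>

lemma (in flow) transport_flow:
  assumes Z: "compact_space Z" "Hausdorff_space Z" "topspace Z \<noteq> {}"
    and g: "continuous_map Z X g"
    and h: "continuous_map (subtopology X (g ` topspace Z)) Z h"
    and hg: "\<And>z. z \<in> topspace Z \<Longrightarrow> h (g z) = z"
    and inv: "\<And>t z. t \<in> carrier G \<Longrightarrow> z \<in> topspace Z \<Longrightarrow> \<phi> t (g z) \<in> g ` topspace Z"
  defines "\<psi> \<equiv> \<lambda>t. \<lambda>z\<in>topspace Z. h (\<phi> t (g z))"
  shows "flow G T Z \<psi>"
    and "\<And>t z. t \<in> carrier G \<Longrightarrow> z \<in> topspace Z \<Longrightarrow> g (\<psi> t z) = \<phi> t (g z)"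
proof -
  have gX: "g z \<in> topspace X" if "z \<in> topspace Z" for z
    using that g by (auto simp: continuous_map_def)
  show eqv: "g (\<psi> t z) = \<phi> t (g z)" if "t \<in> carrier G" "z \<in> topspace Z" for t z
    using inv[OF that] that hg by (auto simp: \<psi>_def)
  have cl: "\<psi> t z \<in> topspace Z" if "t \<in> carrier G" "z \<in> topspace Z" for t z
    using inv[OF that] that hg by (auto simp: \<psi>_def)
  have inj: "z = z'" if "z \<in> topspace Z" "z' \<in> topspace Z" "g z = g z'" for z z'
    using that hg by metis
  have one: "\<psi> \<one> z = z" if z: "z \<in> topspace Z" for z
    using z hg gX[OF z] by (simp add: \<psi>_def id_eq_one[symmetric])
  have mul: "\<psi> (s \<otimes> t) z = \<psi> s (\<psi> t z)"
    if "s \<in> carrier G" "t \<in> carrier G" "z \<in> topspace Z" for s t z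
  proof (rule inj)
    have "g (\<psi> s (\<psi> t z)) = \<phi> s (\<phi> t (g z))" using that cl by (simp add: eqv)
    also have "\<dots> = \<phi> (s \<otimes> t) (g z)"
      using composition_rule[OF gX[OF that(3)] that(1,2)] by simp
    also have "\<dots> = g (\<psi> (s \<otimes> t) z)" using that by (simp add: eqv)
    finally show "g (\<psi> (s \<otimes> t) z) = g (\<psi> s (\<psi> t z))" by simp
  qed (use that cl in auto)
  have bij: "\<psi> t \<in> Bij (topspace Z)" if t: "t \<in> carrier G" for t
  proof -
    have "bij_betw (\<psi> t) (topspace Z) (topspace Z)"
      by (rule bij_betw_byWitness[of _ "\<psi> (inv t)"])
        (use t cl one in \<open>auto simp: mul[symmetric]\<close>)
    then show ?thesis by (simp add: Bij_def \<psi>_def)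
  qed
  have hom: "\<psi> \<in> hom G (BijGroup (topspace Z))"
  proof (rule homI)
    fix t assume "t \<in> carrier G" then show "\<psi> t \<in> carrier (BijGroup (topspace Z))"
      by (simp add: BijGroup_def bij)
  next
    fix s t assume st: "s \<in> carrier G" "t \<in> carrier G"
    have "\<psi> (s \<otimes> t) = compose (topspace Z) (\<psi> s) (\<psi> t)"
    proof
      fix z show "\<psi> (s \<otimes> t) z = compose (topspace Z) (\<psi> s) (\<psi> t) z"
      proof (cases "z \<in> topspace Z")
        case True then show ?thesis using st by (simp add: compose_def mul)
      next
        case False then show ?thesis by (simp add: compose_def \<psi>_def)
      qed
    qed
    then show "\<psi> (s \<otimes> t) = \<psi> s \<otimes>\<^bsub>BijGroup (topspace Z)\<^esub> \<psi> t"
      using st by (simp add: BijGroup_def bij)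
  qed
  have "continuous_map (prod_topology T Z) (prod_topology T X) (\<lambda>(t, z). (t, g z))"
    using continuous_map_fst continuous_map_compose[OF continuous_map_snd g]
    by (auto simp: continuous_map_pairwise o_def case_prod_unfold)
  from continuous_map_compose[OF this continuous_action]
  have "continuous_map (prod_topology T Z) X (\<lambda>(t, z). \<phi> t (g z))"
    by (simp add: o_def case_prod_unfold)
  then have "continuous_map (prod_topology T Z) (subtopology X (g ` topspace Z)) (\<lambda>(t, z). \<phi> t (g z))"
    by (auto simp: continuous_map_in_subtopology topspace_group inv)
  from continuous_map_compose[OF this h]
  have c: "continuous_map (prod_topology T Z) Z (\<lambda>(t, z). h (\<phi> t (g z)))"
    by (simp add: o_def case_prod_unfold)
  have "continuous_map (prod_topology T Z) Z (\<lambda>(t, z). \<psi> t z)"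
    by (rule continuous_map_eq[OF c]) (auto simp: \<psi>_def)
  then show "flow G T Z \<psi>"
    using Z hom
    by (intro flow.intro flow_axioms.intro topological_group_axioms group_action.intro
        group_hom.intro group_hom_axioms.intro group_BijGroup is_group) auto
qed

text \<open>Any closed subspace that injects into a type is homeomorphic to a space on that type.\<close>

lemma (in flow) transport_space:
  assumes Y: "closedin X Y" "Y \<noteq> {}" and j: "inj_on j Y"
  obtains Z g where "compact_space Z" "Hausdorff_space Z" "topspace Z \<noteq> {}" "topspace Z = j ` Y"
    "continuous_map Z X g" "g ` topspace Z = Y" "continuous_map (subtopology X Y) Z j"
    "\<And>z. z \<in> topspace Z \<Longrightarrow> j (g z) = z" "\<And>y. y \<in> Y \<Longrightarrow> g (j y) = y"
proof -
  define g where "g = inv_into Y j"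
  define Z where "Z = pullback_topology (j ` Y) g (subtopology X Y)"
  have YX: "Y \<subseteq> topspace X" using Y closedin_subset by blast
  have gj: "g (j y) = y" if "y \<in> Y" for y using that j by (simp add: g_def)
  have tZ: "topspace Z = j ` Y" using YX gj by (auto simp: Z_def topspace_pullback_topology)
  have cg: "continuous_map Z (subtopology X Y) g"
    unfolding Z_def using continuous_map_pullback[OF continuous_map_id] by (simp add: o_def)
  have cj: "continuous_map (subtopology X Y) Z j"
    unfolding Z_def
  proof (rule continuous_map_pullback')
    show "continuous_map (subtopology X Y) (subtopology X Y) (g \<circ> j)"
      by (rule continuous_map_eq[OF continuous_map_id]) (use gj in auto)
  qed (use YX in auto)
  have "homeomorphic_maps (subtopology X Y) Z j g"
    unfolding homeomorphic_maps_def using cg cj gj tZ by auto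
  then have hs: "(subtopology X Y) homeomorphic_space Z"
    unfolding homeomorphic_space_def by blast
  show ?thesis
  proof
    show "compact_space Z"
      using hs compact_phase Y closedin_compact_space compact_space_subtopology
      by (metis homeomorphic_compact_space)
    show "Hausdorff_space Z"
      using hs Hausdorff_phase Hausdorff_space_subtopology homeomorphic_Hausdorff_space by blast
    show "continuous_map Z X g" using cg by (simp add: continuous_map_in_subtopology)
    show "g ` topspace Z = Y" "topspace Z \<noteq> {}" using tZ gj Y by (auto simp: image_image)
  qed (use tZ cj gj in auto)
qed

lemma (in flow) orbit_closure_invariant:
  assumes x: "x \<in> topspace X" and t: "t \<in> carrier G" and y: "y \<in> X closure_of orbit G \<phi> x"
  shows "\<phi> t y \<in> X closure_of orbit G \<phi> x"
proof -
  have "\<phi> t ` (X closure_of orbit G \<phi> x) \<subseteq> X closure_of (\<phi> t ` orbit G \<phi> x)"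
    using continuous_translate[OF t] by (simp add: continuous_map_image_closure_subset)
  moreover have "\<phi> t ` orbit G \<phi> x \<subseteq> orbit G \<phi> x"
  proof -
    have "\<phi> t (\<phi> s x) = \<phi> (t \<otimes> s) x" if "s \<in> carrier G" for s
      using composition_rule[OF x t that] by simp
    then show ?thesis using t by (auto simp: orbit_def)
  qed
  ultimately show ?thesis using y closure_of_mono by blast
qed

lemma (in flow) orbit_subset: "x \<in> topspace X \<Longrightarrow> orbit G \<phi> x \<subseteq> topspace X"
  using action_closed by (auto simp: orbit_def)

lemma distr_distr_borel:
  assumes "continuous_map X Y f" "continuous_map Y Z g" "\<mu> \<in> regular_probs X"
  shows "distr (distr \<mu> (borel_of Y) f) (borel_of Z) g = distr \<mu> (borel_of Z) (\<lambda>x. g (f x))"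
proof -
  have "f \<in> measurable \<mu> (borel_of Y)"
    using continuous_map_measurable[OF assms(1)] by (simp add: regular_probsD(4)[OF assms(3)])
  from distr_distr[OF continuous_map_measurable[OF assms(2)] this] show ?thesis
    by (simp add: o_def)
qed

lemma distr_cong_borel:
  assumes "\<mu> \<in> regular_probs X" "\<And>x. x \<in> topspace X \<Longrightarrow> f x = f' x"
  shows "distr \<mu> N f = distr \<mu> N f'"
  by (rule distr_cong) (use assms regular_probsD(3) in auto)

theorem amenable_any_type:
  fixes X :: "'x topology"
  assumes am: "amenable G T" and fl: "flow G T X \<phi>"
  shows "\<exists>\<mu>\<in>regular_probs X. \<forall>t\<in>carrier G. push_action X \<phi> t \<mu> = \<mu>"
proof -
  interpret flow G T X \<phi> by fact
  obtain x0 where x0: "x0 \<in> topspace X" using nonempty_phase by blast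
  define Y where "Y = X closure_of orbit G \<phi> x0"
  obtain j :: "'x \<Rightarrow> 'a set set" where j: "inj_on j Y"
    using dense_orbit_injection unfolding Y_def by blast
  have "closedin X Y" by (simp add: Y_def)
  moreover have "Y \<noteq> {}"
    using closure_of_subset[OF orbit_subset[OF x0]] one_closed by (auto simp: Y_def orbit_def)
  ultimately obtain Z g where Z: "compact_space Z" "Hausdorff_space Z" "topspace Z \<noteq> {}"
    and g: "continuous_map Z X g" "g ` topspace Z = Y"
    and jc: "continuous_map (subtopology X Y) Z j"
    and jg: "\<And>z. z \<in> topspace Z \<Longrightarrow> j (g z) = z"
    using transport_space[OF _ _ j] by metis
  define \<psi> where "\<psi> = (\<lambda>t. \<lambda>z\<in>topspace Z. j (\<phi> t (g z)))"
  have inv: "\<phi> t (g z) \<in> g ` topspace Z" if "t \<in> carrier G" "z \<in> topspace Z" for t z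
    using orbit_closure_invariant[OF x0 that(1)] that g(2) unfolding Y_def by blast
  have \<psi>: "flow G T Z \<psi>" and eqv: "\<And>t z. t \<in> carrier G \<Longrightarrow> z \<in> topspace Z \<Longrightarrow> g (\<psi> t z) = \<phi> t (g z)"
    using transport_flow[OF Z g(1) _ jg inv] jc g(2) unfolding \<psi>_def by auto
  interpret Z: flow G T Z \<psi> by fact
  obtain \<nu> where \<nu>: "\<nu> \<in> regular_probs Z" "\<And>t. t \<in> carrier G \<Longrightarrow> push_action Z \<psi> t \<nu> = \<nu>"
    using am[unfolded amenable_def, THEN spec, of Z, THEN spec, of \<psi>, THEN mp, OF \<psi>]
    by (elim bexE) simp
  define \<mu> where "\<mu> = distr \<nu> (borel_of X) g"
  have \<mu>: "\<mu> \<in> regular_probs X"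
    unfolding \<mu>_def by (rule regular_probs_distr[OF g(1) Z(2) Hausdorff_phase \<nu>(1)])
  have "push_action X \<phi> t \<mu> = \<mu>" if t: "t \<in> carrier G" for t
  proof -
    have "push_action X \<phi> t \<mu> = distr \<nu> (borel_of X) (\<lambda>z. \<phi> t (g z))"
      using \<mu> distr_distr_borel[OF g(1) continuous_translate[OF t] \<nu>(1)]
      by (simp add: push_action_def \<mu>_def)
    also have "\<dots> = distr \<nu> (borel_of X) (\<lambda>z. g (\<psi> t z))"
      by (rule distr_cong_borel[OF \<nu>(1)]) (simp add: eqv t)
    also have "\<dots> = distr (push_action Z \<psi> t \<nu>) (borel_of X) g"
      using \<nu>(1) distr_distr_borel[OF Z.continuous_translate[OF t] g(1) \<nu>(1)]
      by (simp add: push_action_def)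
    finally show ?thesis using \<nu>(2)[OF t] by (simp add: \<mu>_def)
  qed
  then show ?thesis using \<mu> by blast
qed

theorem universal_any_type:
  fixes X :: "'x topology" and Y :: "'y topology"
  assumes un: "universal_msp_flow G T X \<phi>"
    and Y: "minimal_flow G T Y \<psi>" "strongly_proximal G Y \<psi>"
  shows "\<exists>p. continuous_map X Y p \<and> p ` topspace X = topspace Y \<and>
             (\<forall>t\<in>carrier G. \<forall>x\<in>topspace X. p (\<phi> t x) = \<psi> t (p x))"
proof -
  interpret flow G T Y \<psi> using Y(1) by (simp add: minimal_flow_def)
  have mini: "Y closure_of orbit G \<psi> y = topspace Y" if "y \<in> topspace Y" for y
    using Y(1) that by (simp add: minimal_flow_def)
  obtain y0 where y0: "y0 \<in> topspace Y" using nonempty_phase by blast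
  obtain j :: "'y \<Rightarrow> 'a set set" where j: "inj_on j (topspace Y)"
    using dense_orbit_injection[of y0] mini[OF y0] by auto
  obtain Z g where Z: "compact_space Z" "Hausdorff_space Z" "topspace Z \<noteq> {}"
    "topspace Z = j ` topspace Y"
    and g: "continuous_map Z Y g" "g ` topspace Z = topspace Y"
    and jc: "continuous_map (subtopology Y (topspace Y)) Z j"
    and jg: "\<And>z. z \<in> topspace Z \<Longrightarrow> j (g z) = z" and gj: "\<And>y. y \<in> topspace Y \<Longrightarrow> g (j y) = y"
    using transport_space[OF closedin_topspace nonempty_phase j] by metis
  have jc': "continuous_map Y Z j" using jc by simp
  have gY: "g z \<in> topspace Y" if "z \<in> topspace Z" for z using that g(2) by blast
  define \<theta> where "\<theta> = (\<lambda>t. \<lambda>z\<in>topspace Z. j (\<psi> t (g z)))"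
  have inv: "\<psi> t (g z) \<in> g ` topspace Z" if "t \<in> carrier G" "z \<in> topspace Z" for t z
    using action_closed[OF that(1) gY[OF that(2)]] g(2) by simp
  have \<theta>: "flow G T Z \<theta>" and eqv: "\<And>t z. t \<in> carrier G \<Longrightarrow> z \<in> topspace Z \<Longrightarrow> g (\<theta> t z) = \<psi> t (g z)"
    using transport_flow[OF Z(1-3) g(1) _ jg inv] jc g(2) unfolding \<theta>_def by auto
  have "Z closure_of orbit G \<theta> z = topspace Z" if z: "z \<in> topspace Z" for z
  proof
    have "topspace Z = j ` (Y closure_of orbit G \<psi> (g z))"
      using mini[OF gY[OF z]] Z(4) by simp
    also have "\<dots> \<subseteq> Z closure_of (j ` orbit G \<psi> (g z))"
      by (rule continuous_map_image_closure_subset[OF jc'])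
    also have "j ` orbit G \<psi> (g z) = orbit G \<theta> z"
      using z by (auto simp: orbit_def \<theta>_def)
    finally show "topspace Z \<subseteq> Z closure_of orbit G \<theta> z" .
  qed (rule closure_of_subset_topspace)
  then have min: "minimal_flow G T Z \<theta>" using \<theta> by (simp add: minimal_flow_def)
  have "strongly_proximal G Z \<theta>"
    unfolding strongly_proximal_def proximal_def topspace_weak_star
  proof (intro ballI)
    fix \<mu> \<nu> assume mn: "\<mu> \<in> regular_probs Z" "\<nu> \<in> regular_probs Z"
    note reg = regular_probs_distr[OF g(1) Z(2) Hausdorff_phase]
    obtain F \<rho> where F: "F \<noteq> bot" "\<forall>\<^sub>F t in F. t \<in> carrier G"
      and lim: "limitin (weak_star Y) (\<lambda>t. push_action Y \<psi> t (distr \<mu> (borel_of Y) g)) \<rho> F"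
        "limitin (weak_star Y) (\<lambda>t. push_action Y \<psi> t (distr \<nu> (borel_of Y) g)) \<rho> F"
      using Y(2) reg[OF mn(1)] reg[OF mn(2)]
      unfolding strongly_proximal_def proximal_def topspace_weak_star by meson
    have eq: "distr (push_action Y \<psi> t (distr \<kappa> (borel_of Y) g)) (borel_of Z) j = push_action Z \<theta> t \<kappa>"
      if t: "t \<in> carrier G" and k: "\<kappa> \<in> regular_probs Z" for t \<kappa>
    proof -
      have c: "continuous_map Z Y (\<lambda>z. \<psi> t (g z))"
        using continuous_map_compose[OF g(1) continuous_translate[OF t]] by (simp add: o_def)
      have "distr (push_action Y \<psi> t (distr \<kappa> (borel_of Y) g)) (borel_of Z) j
          = distr \<kappa> (borel_of Z) (\<lambda>z. j (\<psi> t (g z)))"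
        using reg[OF k] distr_distr_borel[OF g(1) continuous_translate[OF t] k]
          distr_distr_borel[OF c jc' k]
        by (simp add: push_action_def)
      also have "\<dots> = push_action Z \<theta> t \<kappa>"
        unfolding push_action_def using k
        by (simp, intro distr_cong_borel[OF k]) (simp add: \<theta>_def)
      finally show ?thesis .
    qed
    have tr: "limitin (weak_star Z) (\<lambda>t. push_action Z \<theta> t \<kappa>) (distr \<rho> (borel_of Z) j) F"
      if k: "\<kappa> \<in> regular_probs Z"
        and l: "limitin (weak_star Y) (\<lambda>t. push_action Y \<psi> t (distr \<kappa> (borel_of Y) g)) \<rho> F" for \<kappa>
    proof (rule limitin_transform_eventually)
      show "limitin (weak_star Z)
          ((\<lambda>\<mu>. distr \<mu> (borel_of Z) j) \<circ> (\<lambda>t. push_action Y \<psi> t (distr \<kappa> (borel_of Y) g)))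
          (distr \<rho> (borel_of Z) j) F"
        by (rule continuous_map_limit[OF continuous_map_push[OF jc' Hausdorff_phase Z(2)] l])
      show "\<forall>\<^sub>F t in F. ((\<lambda>\<mu>. distr \<mu> (borel_of Z) j) \<circ>
          (\<lambda>t. push_action Y \<psi> t (distr \<kappa> (borel_of Y) g))) t = push_action Z \<theta> t \<kappa>"
        using F(2) by eventually_elim (simp add: eq k)
    qed
    show "\<exists>F z. F \<noteq> bot \<and> (\<forall>\<^sub>F t in F. t \<in> carrier G) \<and>
        limitin (weak_star Z) (\<lambda>t. push_action Z \<theta> t \<mu>) z F \<and>
        limitin (weak_star Z) (\<lambda>t. push_action Z \<theta> t \<nu>) z F"
      using F tr[OF mn(1) lim(1)] tr[OF mn(2) lim(2)] by blast
  qed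
  then have "\<exists>p. continuous_map X Z p \<and> p ` topspace X = topspace Z \<and>
      (\<forall>t\<in>carrier G. \<forall>x\<in>topspace X. p (\<phi> t x) = \<theta> t (p x))"
    using un[unfolded universal_msp_flow_def, THEN conjunct2, THEN conjunct2,
        THEN spec, of Z, THEN spec, of \<theta>] min
    by simp
  then obtain p where p: "continuous_map X Z p" "p ` topspace X = topspace Z"
    "\<forall>t\<in>carrier G. \<forall>x\<in>topspace X. p (\<phi> t x) = \<theta> t (p x)"
    by (elim exE conjE)
  show ?thesis
  proof (intro exI[of _ "g \<circ> p"] conjI ballI)
    show "continuous_map X Y (g \<circ> p)" by (rule continuous_map_compose[OF p(1) g(1)])
    show "(g \<circ> p) ` topspace X = topspace Y" unfolding image_comp[symmetric] p(2) g(2) by (rule refl)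
    fix t x assume t: "t \<in> carrier G" and x: "x \<in> topspace X"
    have "p x \<in> topspace Z" using p(2) x by blast
    then show "(g \<circ> p) (\<phi> t x) = \<psi> t ((g \<circ> p) x)"
      using bspec[OF bspec[OF p(3) t] x] eqv[OF t] by simp
  qed
qed

end

theory Submission
  imports Defs
begin

text \<open>The kernel \<open>N\<close> of the action on \<open>\<Pi>\<^sub>s(G)\<close> is a closed subgroup, and it is invariant under
  every \<open>a \<in> Aut(G)\<close> since the flow twisted by \<open>a\<close> is again minimal and strongly proximal, hence a
  factor of \<open>\<Pi>\<^sub>s(G)\<close>. So \<open>N \<noteq> {e}\<close> forces \<open>N = G\<close>, and \<open>\<Pi>\<^sub>s(G)\<close> is a point by minimality.

  It remains to see that \<open>G\<close> is then amenable. For a flow \<open>Y\<close> let \<open>Q\<close> be a minimal closed convex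
  invariant set of states on \<open>C(Y)\<close> and \<open>x\<close> an extreme point of \<open>Q\<close>. For \<open>q \<in> Q\<close> the closed convex
  hull of \<open>G q\<close> is \<open>Q\<close>, so \<open>x\<close> is the barycenter of a state on the closure of \<open>G q\<close>; by
  extremality that state is the evaluation at \<open>x\<close>, so \<open>x\<close> lies in the closure of \<open>G q\<close>. It follows
  that the orbit closure of \<open>x\<close> is minimal and strongly proximal (Glasner). As a factor of
  \<open>\<Pi>\<^sub>s(G)\<close> it is a point, so \<open>x\<close> is an invariant state, and its Riesz measure is an
  invariant measure on \<open>Y\<close>.\<close>

section \<open>States on the continuous functions\<close>

text \<open>States carry the convexity argument because they lie in a product of real lines, where
  compactness comes from Tychonoff, and because the construction can be repeated: \<open>Z\<close>
  consists of states on the given flow, and its strong proximality is decided on states on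
  \<open>Z\<close>. Measures appear only at the two ends, where integration turns measures on
  \<open>Z\<close> into states and an outer measure turns the invariant state back into a measure.

  The step to strong proximality rests on the barycenter map from states on \<open>Z\<close> to
  \<open>Q\<close>. It is continuous and commutes with \<open>G\<close>, so the image of an orbit
  closure of states is a closed set that contains the orbit of a point of \<open>Q\<close>, and
  therefore contains \<open>x\<close>. The fibre over \<open>x\<close> is the evaluation at
  \<open>x\<close> alone. For two measures this is applied to their average.

  The points of \<open>Z\<close> live in a function type over the points of the given flow, outside
  the range of the test flows in \<open>universal_msp_flow\<close>. Universality therefore enters
  through \<open>universal_any_type\<close>.\<close>

definition cfun :: "'a topology \<Rightarrow> ('a \<Rightarrow> real) set" where
  "cfun X = {f. continuous_map X euclideanreal f}"

lemma cfunD: "f \<in> cfun X \<Longrightarrow> continuous_map X euclideanreal f"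
  by (simp add: cfun_def)

lemma cfun_const [simp]: "(\<lambda>_. c) \<in> cfun X"
  by (simp add: cfun_def)

lemma cfun_add: "f \<in> cfun X \<Longrightarrow> g \<in> cfun X \<Longrightarrow> (\<lambda>x. f x + g x) \<in> cfun X"
  by (simp add: cfun_def continuous_map_add)

lemma cfun_diff: "f \<in> cfun X \<Longrightarrow> g \<in> cfun X \<Longrightarrow> (\<lambda>x. f x - g x) \<in> cfun X"
  by (simp add: cfun_def continuous_map_diff)

lemma cfun_minus: "f \<in> cfun X \<Longrightarrow> (\<lambda>x. - f x) \<in> cfun X"
  by (simp add: cfun_def)

lemma cfun_mult: "f \<in> cfun X \<Longrightarrow> g \<in> cfun X \<Longrightarrow> (\<lambda>x. f x * g x) \<in> cfun X"
  by (simp add: cfun_def continuous_map_real_mult)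

lemma cfun_max: "f \<in> cfun X \<Longrightarrow> g \<in> cfun X \<Longrightarrow> (\<lambda>x. max (f x) (g x)) \<in> cfun X"
  by (simp add: cfun_def continuous_map_real_max)

lemma cfun_sum:
  "finite I \<Longrightarrow> (\<And>i. i \<in> I \<Longrightarrow> f i \<in> cfun X) \<Longrightarrow> (\<lambda>x. \<Sum>i\<in>I. f i x) \<in> cfun X"
  by (simp add: cfun_def continuous_map_sum)

lemmas cfun_intros = cfun_const cfun_add cfun_diff cfun_minus cfun_mult cfun_max cfun_sum

lemma cfun_compose: "continuous_map X Y p \<Longrightarrow> f \<in> cfun Y \<Longrightarrow> (\<lambda>x. f (p x)) \<in> cfun X"
  unfolding cfun_def using continuous_map_compose[of X Y p euclideanreal f] by (simp add: o_def)

lemma cfun_subtopology: "f \<in> cfun X \<Longrightarrow> f \<in> cfun (subtopology X S)"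
  by (simp add: cfun_def continuous_map_from_subtopology)

lemma cfun_bounded:
  assumes "compact_space X" "f \<in> cfun X"
  obtains B where "B > 0" "\<And>x. x \<in> topspace X \<Longrightarrow> \<bar>f x\<bar> \<le> B"
proof -
  have "compact (f ` topspace X)"
    using image_compactin[OF assms(1)[unfolded compact_space_def] cfunD[OF assms(2)]] by simp
  then obtain B where "B > 0" "\<And>y. y \<in> f ` topspace X \<Longrightarrow> norm y \<le> B"
    using compact_imp_bounded bounded_pos by metis
  then show ?thesis using that by simp
qed

lemma cfun_attains_max:
  assumes "compact_space X" "topspace X \<noteq> {}" "f \<in> cfun X"
  obtains x where "x \<in> topspace X" "\<And>y. y \<in> topspace X \<Longrightarrow> f y \<le> f x"
proof -
  have "compact (f ` topspace X)"
    using image_compactin[OF assms(1)[unfolded compact_space_def] cfunD[OF assms(3)]] by simp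
  then show ?thesis using compact_attains_sup[of "f ` topspace X"] assms(2) that by auto
qed

lemma closedin_cfun_le:
  assumes "f \<in> cfun X" "g \<in> cfun X"
  shows "closedin X {x \<in> topspace X. f x \<le> g x}"
proof -
  have "{x \<in> topspace X. f x \<le> g x} = {x \<in> topspace X. f x - g x \<in> {..0}}" by auto
  then show ?thesis
    using closedin_continuous_map_preimage[OF cfunD[OF cfun_diff[OF assms]], of "{..0}"] by simp
qed

lemma closedin_cfun_eq:
  assumes "f \<in> cfun X" "g \<in> cfun X"
  shows "closedin X {x \<in> topspace X. f x = g x}"
proof -
  have eq: "{x \<in> topspace X. f x = g x} = {x \<in> topspace X. f x \<le> g x} \<inter> {x \<in> topspace X. g x \<le> f x}"
    by auto
  show ?thesis unfolding eq by (intro closedin_Int closedin_cfun_le assms)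
qed

section \<open>The state space, its weak-* topology and its compactness\<close>

definition states :: "'a topology \<Rightarrow> (('a \<Rightarrow> real) \<Rightarrow> real) set" where
  "states X = {L \<in> extensional (cfun X). L (\<lambda>_. 1) = 1 \<and>
     (\<forall>f\<in>cfun X. \<forall>g\<in>cfun X. L (\<lambda>x. f x + g x) = L f + L g) \<and>
     (\<forall>f\<in>cfun X. \<forall>c. L (\<lambda>x. c * f x) = c * L f) \<and>
     (\<forall>f\<in>cfun X. (\<forall>x\<in>topspace X. 0 \<le> f x) \<longrightarrow> 0 \<le> L f)}"

text \<open>This is the topology of pointwise convergence on \<open>cfun X\<close>. The
  \<open>extensional\<close> in \<open>states\<close> is what makes a state a point of this
  product.\<close>

definition state_topology :: "'a topology \<Rightarrow> (('a \<Rightarrow> real) \<Rightarrow> real) topology" where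
  "state_topology X = subtopology (product_topology (\<lambda>_. euclideanreal) (cfun X)) (states X)"

lemma statesI:
  assumes "L \<in> extensional (cfun X)" "L (\<lambda>_. 1) = 1"
    and "\<And>f g. f \<in> cfun X \<Longrightarrow> g \<in> cfun X \<Longrightarrow> L (\<lambda>x. f x + g x) = L f + L g"
    and "\<And>f c. f \<in> cfun X \<Longrightarrow> L (\<lambda>x. c * f x) = c * L f"
    and "\<And>f. f \<in> cfun X \<Longrightarrow> (\<And>x. x \<in> topspace X \<Longrightarrow> 0 \<le> f x) \<Longrightarrow> 0 \<le> L f"
  shows "L \<in> states X"
  using assms by (simp add: states_def)

context
  fixes L :: "('a \<Rightarrow> real) \<Rightarrow> real" and X :: "'a topology"
  assumes L: "L \<in> states X"
begin

lemma state_one: "L (\<lambda>_. 1) = 1"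
  using L by (simp add: states_def)

lemma state_extensional: "L \<in> extensional (cfun X)"
  using L by (simp add: states_def)

lemma state_add: "f \<in> cfun X \<Longrightarrow> g \<in> cfun X \<Longrightarrow> L (\<lambda>x. f x + g x) = L f + L g"
  using L by (simp add: states_def)

lemma state_cmult: "f \<in> cfun X \<Longrightarrow> L (\<lambda>x. c * f x) = c * L f"
  using L by (simp add: states_def)

lemma state_nonneg: "f \<in> cfun X \<Longrightarrow> (\<And>x. x \<in> topspace X \<Longrightarrow> 0 \<le> f x) \<Longrightarrow> 0 \<le> L f"
  using L by (simp add: states_def)

lemma state_const: "L (\<lambda>_. c) = c"
  using state_cmult[of "\<lambda>_. 1" c] state_one by simp

lemma state_minus: "f \<in> cfun X \<Longrightarrow> L (\<lambda>x. - f x) = - L f"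
  using state_cmult[of f "-1"] by simp

lemma state_diff: "f \<in> cfun X \<Longrightarrow> g \<in> cfun X \<Longrightarrow> L (\<lambda>x. f x - g x) = L f - L g"
  using state_add[of f "\<lambda>x. - g x"] state_minus[of g] by (simp add: cfun_minus)

lemma state_mono:
  assumes "f \<in> cfun X" "g \<in> cfun X" "\<And>x. x \<in> topspace X \<Longrightarrow> f x \<le> g x"
  shows "L f \<le> L g"
  using state_nonneg[of "\<lambda>x. g x - f x"] state_diff[of g f] assms by (auto simp: cfun_diff)

text \<open>The members of \<open>cfun X\<close> are total functions with arbitrary values off
  \<open>topspace X\<close>; positivity, used in both directions, makes a state blind to those
  values.\<close>

lemma state_cong:
  assumes "f \<in> cfun X" "g \<in> cfun X" "\<And>x. x \<in> topspace X \<Longrightarrow> f x = g x"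
  shows "L f = L g"
  using state_mono[of f g] state_mono[of g f] assms by (simp add: order_antisym)

lemma state_upper: "f \<in> cfun X \<Longrightarrow> (\<And>x. x \<in> topspace X \<Longrightarrow> f x \<le> c) \<Longrightarrow> L f \<le> c"
  using state_mono[of f "\<lambda>_. c"] state_const[of c] by simp

lemma state_abs:
  assumes "f \<in> cfun X" "\<And>x. x \<in> topspace X \<Longrightarrow> \<bar>f x\<bar> \<le> c"
  shows "\<bar>L f\<bar> \<le> c"
proof -
  have "L f \<le> c" "- L f \<le> c"
    using state_upper[of f c] state_upper[of "\<lambda>x. - f x" c] state_minus[of f] assms
    by (auto simp: cfun_minus abs_le_iff)
  then show ?thesis by simp
qed

lemma state_sum:
  "finite I \<Longrightarrow> (\<And>i. i \<in> I \<Longrightarrow> f i \<in> cfun X) \<Longrightarrow> L (\<lambda>x. \<Sum>i\<in>I. f i x) = (\<Sum>i\<in>I. L (f i))"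
  by (induction I rule: finite_induct) (simp_all add: state_const state_add cfun_sum)

text \<open>On an empty space the constant 1 is vacuously bounded by 0, which would give 1 <=
  0.\<close>

lemma topspace_nonempty_of_state: "topspace X \<noteq> {}"
  using state_upper[of "\<lambda>_. 1" 0] state_one by auto

end

lemma topspace_state_topology [simp]: "topspace (state_topology X) = states X"
  by (auto simp: state_topology_def states_def extensional_def PiE_def)

lemma cfun_eval [simp]: "f \<in> cfun X \<Longrightarrow> (\<lambda>L. L f) \<in> cfun (state_topology X)"
  unfolding state_topology_def
  by (auto simp: cfun_def intro!: continuous_map_from_subtopology continuous_map_product_projection)

lemma state_eqI:
  assumes "L \<in> states X" "M \<in> states X" "\<And>f. f \<in> cfun X \<Longrightarrow> L f = M f"
  shows "L = M"
  by (rule extensionalityI[of L "cfun X" M]) (use assms state_extensional in auto)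

lemma continuous_map_state_topologyI:
  assumes "\<And>x. x \<in> topspace Z \<Longrightarrow> F x \<in> states X"
    and "\<And>f. f \<in> cfun X \<Longrightarrow> continuous_map Z euclideanreal (\<lambda>x. F x f)"
  shows "continuous_map Z (state_topology X) F"
  unfolding state_topology_def continuous_map_in_subtopology continuous_map_componentwise
proof (intro conjI ballI)
  show "F ` topspace Z \<subseteq> extensional (cfun X)"
    using assms(1) state_extensional by blast
qed (use assms in auto)

lemma Hausdorff_state_topology: "Hausdorff_space (state_topology X)"
  by (simp add: state_topology_def Hausdorff_space_subtopology Hausdorff_space_product_topology)

text \<open>The Banach-Alaoglu argument: \<open>state_abs\<close> puts the states into a product of
  compact intervals, and each defining condition compares finitely many coordinates, hence is
  closed.\<close>

lemma compact_state_topology: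
  assumes "compact_space X"
  shows "compact_space (state_topology X)"
proof -
  let ?P = "product_topology (\<lambda>_. euclideanreal) (cfun X)"
  have "\<exists>B. \<forall>x\<in>topspace X. \<bar>f x\<bar> \<le> B" if "f \<in> cfun X" for f
    using cfun_bounded[OF assms that] by metis
  then obtain B where B: "\<And>f x. f \<in> cfun X \<Longrightarrow> x \<in> topspace X \<Longrightarrow> \<bar>f x\<bar> \<le> B f"
    by metis
  have "compactin ?P (PiE (cfun X) (\<lambda>f. {- B f..B f}))"
    by (simp add: compactin_PiE)
  moreover have "states X \<subseteq> PiE (cfun X) (\<lambda>f. {- B f..B f})"
  proof
    fix L assume L: "L \<in> states X"
    have "L f \<in> {- B f..B f}" if "f \<in> cfun X" for f
      using state_abs[OF L that B[OF that]] by (simp add: abs_le_iff)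
    then show "L \<in> PiE (cfun X) (\<lambda>f. {- B f..B f})"
      using state_extensional[OF L] by (simp add: PiE_def)
  qed
  moreover have "closedin ?P (states X)"
  proof -
    have pr: "(\<lambda>L. L f) \<in> cfun ?P" if "f \<in> cfun X" for f
      using that unfolding cfun_def[of ?P] by (auto intro!: continuous_map_product_projection)
    have ts: "topspace ?P = extensional (cfun X)" by (simp add: PiE_def)
    have eq: "states X =
        {L \<in> topspace ?P. L (\<lambda>_. 1) = 1} \<inter>
        (\<Inter>(f, g)\<in>cfun X \<times> cfun X. {L \<in> topspace ?P. L (\<lambda>x. f x + g x) = L f + L g}) \<inter>
        (\<Inter>(f, c)\<in>cfun X \<times> UNIV. {L \<in> topspace ?P. L (\<lambda>x. c * f x) = c * L f}) \<inter>
        (\<Inter>f\<in>{f \<in> cfun X. \<forall>x\<in>topspace X. 0 \<le> f x}. {L \<in> topspace ?P. 0 \<le> L f})"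
      unfolding states_def ts by auto
    have ne: "{f \<in> cfun X. \<forall>x\<in>topspace X. 0 \<le> f x} \<noteq> {}" "cfun X \<noteq> {}"
      using cfun_const[of 0 X] by force+
    have add: "closedin ?P {L \<in> topspace ?P. L (\<lambda>x. f x + g x) = L f + L g}"
      if "f \<in> cfun X" "g \<in> cfun X" for f g
      using that by (intro closedin_cfun_eq cfun_add pr)
    have mult: "closedin ?P {L \<in> topspace ?P. L (\<lambda>x. c * f x) = c * L f}"
      if "f \<in> cfun X" for f c
      using that by (intro closedin_cfun_eq cfun_mult cfun_const pr)
    have pos: "closedin ?P {L \<in> topspace ?P. 0 \<le> L f}" if "f \<in> cfun X" for f
      using that by (intro closedin_cfun_le cfun_const pr)
    have one: "closedin ?P {L \<in> topspace ?P. L (\<lambda>_. 1) = 1}"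
      by (intro closedin_cfun_eq cfun_const pr)
    have "closedin ?P (\<Inter>(f, g)\<in>cfun X \<times> cfun X. {L \<in> topspace ?P. L (\<lambda>x. f x + g x) = L f + L g})"
      by (rule closedin_INT) (use ne(2) add in \<open>auto simp del: topspace_product_topology\<close>)
    moreover have "closedin ?P (\<Inter>(f, c)\<in>cfun X \<times> UNIV. {L \<in> topspace ?P. L (\<lambda>x. c * f x) = c * L f})"
      by (rule closedin_INT) (use ne(2) mult in \<open>auto simp del: topspace_product_topology\<close>)
    moreover have "closedin ?P (\<Inter>f\<in>{f \<in> cfun X. \<forall>x\<in>topspace X. 0 \<le> f x}. {L \<in> topspace ?P. 0 \<le> L f})"
      by (rule closedin_INT) (use ne(1) pos in \<open>auto simp del: topspace_product_topology\<close>)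
    ultimately show ?thesis
      unfolding eq by (intro closedin_Int one)
  qed
  ultimately have "compactin ?P (states X)"
    by (rule closed_compactin)
  then show ?thesis by (simp add: state_topology_def compact_space_subtopology)
qed

section \<open>Extension of positive functionals\<close>

text \<open>One inequality of positive homogeneity is asked; applying it with the inverse scalar
  gives the other one, see \<open>sublinear_cmult\<close>.\<close>

definition sublinear_on :: "('a \<Rightarrow> real) set \<Rightarrow> (('a \<Rightarrow> real) \<Rightarrow> real) \<Rightarrow> bool" where
  "sublinear_on V q \<longleftrightarrow>
     (\<forall>f\<in>V. \<forall>g\<in>V. q (\<lambda>x. f x + g x) \<le> q f + q g) \<and>
     (\<forall>f\<in>V. \<forall>c>0. q (\<lambda>x. c * f x) \<le> c * q f)"

lemma sublinear_onI:
  assumes "\<And>f g. f \<in> V \<Longrightarrow> g \<in> V \<Longrightarrow> q (\<lambda>x. f x + g x) \<le> q f + q g"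
    and "\<And>f c. f \<in> V \<Longrightarrow> 0 < c \<Longrightarrow> q (\<lambda>x. c * f x) \<le> c * q f"
  shows "sublinear_on V q"
  using assms by (simp add: sublinear_on_def)

section \<open>The Hahn-Banach theorem by way of minimal sublinear functionals\<close>

locale function_space =
  fixes V :: "('a \<Rightarrow> real) set"
  assumes nonempty: "V \<noteq> {}"
    and add_closed: "f \<in> V \<Longrightarrow> g \<in> V \<Longrightarrow> (\<lambda>x. f x + g x) \<in> V"
    and cmult_closed: "f \<in> V \<Longrightarrow> (\<lambda>x. c * f x) \<in> V"
begin

lemma zero_closed: "(\<lambda>_. 0) \<in> V"
proof -
  obtain f where "f \<in> V" using nonempty by blast
  from cmult_closed[OF this, of 0] show ?thesis by simp
qed

lemma minus_closed: "f \<in> V \<Longrightarrow> (\<lambda>x. - f x) \<in> V"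
  using cmult_closed[of f "-1"] by simp

context
  fixes q assumes q: "sublinear_on V q"
begin

lemma sublinear_add: "f \<in> V \<Longrightarrow> g \<in> V \<Longrightarrow> q (\<lambda>x. f x + g x) \<le> q f + q g"
  using q by (simp add: sublinear_on_def)

lemma sublinear_cmult:
  assumes f: "f \<in> V" and c: "0 < c"
  shows "q (\<lambda>x. c * f x) = c * q f"
proof (rule antisym)
  have hom: "q (\<lambda>x. c * f x) \<le> c * q f" if "f \<in> V" "0 < c" for f c
    using q that by (simp add: sublinear_on_def)
  show "q (\<lambda>x. c * f x) \<le> c * q f" by (rule hom[OF f c])
  have "q f = q (\<lambda>x. inverse c * (c * f x))" using c by (simp add: mult.assoc[symmetric])
  also have "\<dots> \<le> inverse c * q (\<lambda>x. c * f x)"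
    using c by (intro hom cmult_closed f) simp
  finally show "c * q f \<le> q (\<lambda>x. c * f x)" using c by (simp add: field_simps)
qed

lemma sublinear_zero: "q (\<lambda>_. 0) = 0"
  using sublinear_cmult[OF zero_closed, of 2] by simp

lemma sublinear_minus: "f \<in> V \<Longrightarrow> - q (\<lambda>x. - f x) \<le> q f"
  using sublinear_add[of f "\<lambda>x. - f x"] minus_closed[of f] sublinear_zero by simp

end

text \<open>Zorn's lemma works because the pointwise infimum of a chain of sublinear functionals is
  sublinear. Minimality is what later forces linearity, in place of an extension by one dimension at
  a time.\<close>

lemma minimal_sublinear:
  assumes p: "sublinear_on V p"
  obtains m where "sublinear_on V m" "m \<in> extensional V" "\<And>f. f \<in> V \<Longrightarrow> m f \<le> p f"
    "\<And>q f. sublinear_on V q \<Longrightarrow> (\<And>f. f \<in> V \<Longrightarrow> q f \<le> m f) \<Longrightarrow> f \<in> V \<Longrightarrow> q f = m f"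
proof -
  define A where "A = {q \<in> extensional V. sublinear_on V q \<and> (\<forall>f\<in>V. q f \<le> p f)}"
  \<comment> \<open>The order is reversed, so that the maximal elements of Zorn's lemma are minimal
    functionals.\<close>
  define P where "P = (\<lambda>q q' :: ('a \<Rightarrow> real) \<Rightarrow> real. \<forall>f\<in>V. q' f \<le> q f)"
  have restrict: "sublinear_on V (restrict q V)" if "sublinear_on V q" for q
    using that by (simp add: sublinear_on_def add_closed cmult_closed)
  have "\<exists>m\<in>A. \<forall>q\<in>A. P m q \<longrightarrow> q = m"
  proof (rule predicate_Zorn)
    show "partial_order_on A (relation_of P A)"
    proof (rule partial_order_on_relation_ofI)
      fix q q' assume "q \<in> A" "q' \<in> A" "P q q'" "P q' q"
      then show "q = q'"
        by (intro extensionalityI[of q V q']) (auto simp: A_def P_def order_antisym)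
    qed (force simp: P_def)+
  next
    fix C assume C: "C \<in> Chains (relation_of P A)"
    have CA: "C \<subseteq> A" using C unfolding Chains_def relation_of_def by auto
    have chain: "P q q' \<or> P q' q" if "q \<in> C" "q' \<in> C" for q q'
      using C that unfolding Chains_def relation_of_def by auto
    show "\<exists>u\<in>A. \<forall>q\<in>C. P q u"
    proof (cases "C = {}")
      case True
      have "restrict p V \<in> A" using restrict[OF p] by (simp add: A_def)
      then show ?thesis using True by blast
    next
      case False
      define u where "u = (\<lambda>f. INF q\<in>C. q f)"
      have sub: "sublinear_on V q" if "q \<in> C" for q
        using CA that by (auto simp: A_def)
      have le_p: "q f \<le> p f" if "q \<in> C" "f \<in> V" for q f
        using CA that by (auto simp: A_def)
      \<comment> \<open>The bound comes from - p(-f) <= - q(-f) <= q f, so that the infimum over the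
        chain is finite.\<close>
      have bdd: "bdd_below ((\<lambda>q. q f) ` C)" if f: "f \<in> V" for f
      proof (rule bdd_belowI2)
        fix q assume "q \<in> C"
        then show "- p (\<lambda>x. - f x) \<le> q f"
          using sublinear_minus[OF sub f, of q] le_p[OF _ minus_closed[OF f], of q] by linarith
      qed
      have le: "u f \<le> q f" if "q \<in> C" "f \<in> V" for q f
        unfolding u_def using that bdd by (intro cINF_lower) auto
      have ge: "c \<le> u f" if "\<And>q. q \<in> C \<Longrightarrow> c \<le> q f" for c f
        unfolding u_def using that False by (intro cINF_greatest) auto
      have "sublinear_on V u"
      proof (rule sublinear_onI)
        fix f g assume fg: "f \<in> V" "g \<in> V"
        \<comment> \<open>Two members of the chain are comparable, and the smaller one serves for
          both summands.\<close>
        have *: "u (\<lambda>x. f x + g x) \<le> q f + q' g" if qq: "q \<in> C" "q' \<in> C" for q q'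
        proof -
          obtain r where r: "r \<in> C" "r f \<le> q f" "r g \<le> q' g"
            using chain[OF qq] qq fg unfolding P_def by blast
          have "u (\<lambda>x. f x + g x) \<le> r (\<lambda>x. f x + g x)" by (intro le r add_closed fg)
          also have "\<dots> \<le> r f + r g" by (intro sublinear_add sub[OF r(1)] fg)
          finally show ?thesis using r by simp
        qed
        have "u (\<lambda>x. f x + g x) - q' g \<le> u f" if "q' \<in> C" for q'
          using * that by (intro ge) (simp add: diff_le_eq)
        then have "u (\<lambda>x. f x + g x) - u f \<le> u g"
          by (intro ge) (simp add: algebra_simps)
        then show "u (\<lambda>x. f x + g x) \<le> u f + u g" by simp
      next
        fix f and c :: real assume f: "f \<in> V" and c: "0 < c"
        have "u (\<lambda>x. c * f x) / c \<le> u f"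
        proof (rule ge)
          fix q assume q: "q \<in> C"
          have "u (\<lambda>x. c * f x) \<le> c * q f"
            using le[OF q cmult_closed[OF f], of c] sublinear_cmult[OF sub[OF q] f c] by simp
          then show "u (\<lambda>x. c * f x) / c \<le> q f" using c by (simp add: field_simps)
        qed
        then show "u (\<lambda>x. c * f x) \<le> c * u f" using c by (simp add: field_simps)
      qed
      moreover have "u f \<le> p f" if "f \<in> V" for f
        using False le[OF _ that] le_p[OF _ that] by (meson ex_in_conv order_trans)
      ultimately have "restrict u V \<in> A" using restrict by (simp add: A_def)
      moreover have "P q (restrict u V)" if "q \<in> C" for q
        using le[OF that] by (simp add: P_def)
      ultimately show ?thesis by blast
    qed
  qed
  then obtain m where m: "m \<in> A" "\<And>q. q \<in> A \<Longrightarrow> P m q \<Longrightarrow> q = m" by blast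
  show ?thesis
  proof
    show "sublinear_on V m" "m \<in> extensional V" "\<And>f. f \<in> V \<Longrightarrow> m f \<le> p f"
      using m(1) by (auto simp: A_def)
    fix q f assume q: "sublinear_on V q" and le: "\<And>f. f \<in> V \<Longrightarrow> q f \<le> m f" and f: "f \<in> V"
    have "restrict q V \<in> A"
      using restrict[OF q] m(1) le order_trans by (fastforce simp: A_def)
    then have "restrict q V = m" using m(2) le by (simp add: P_def)
    then show "q f = m f" using f by (metis restrict_apply')
  qed
qed

text \<open>A minimal \<open>m\<close> is linear. It is lowered along a given \<open>g\<close> to a
  sublinear \<open>q\<close>; minimality gives \<open>q f = m f\<close>, and the term
  \<open>s = 1\<close> of the infimum that defines \<open>q\<close> is then the reverse of
  subadditivity.\<close>

lemma hahn_banach: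
  assumes p: "sublinear_on V p"
  obtains L where "L \<in> extensional V" "\<And>f. f \<in> V \<Longrightarrow> L f \<le> p f"
    "\<And>f g. f \<in> V \<Longrightarrow> g \<in> V \<Longrightarrow> L (\<lambda>x. f x + g x) = L f + L g"
    "\<And>f c. f \<in> V \<Longrightarrow> L (\<lambda>x. c * f x) = c * L f"
proof -
  obtain m where m: "sublinear_on V m" "m \<in> extensional V" "\<And>f. f \<in> V \<Longrightarrow> m f \<le> p f"
    and min: "\<And>q f. sublinear_on V q \<Longrightarrow> (\<And>f. f \<in> V \<Longrightarrow> q f \<le> m f) \<Longrightarrow> f \<in> V \<Longrightarrow> q f = m f"
    using minimal_sublinear[OF p] by blast
  note hom = sublinear_cmult[OF m(1)] and sub = sublinear_add[OF m(1)]
  have ge: "m f + m g \<le> m (\<lambda>x. f x + g x)" if f: "f \<in> V" and g: "g \<in> V" for f g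
  proof -
    \<comment> \<open>The largest sublinear functional below \<open>m\<close> that is additive along \<open>g\<close>.\<close>
    define r where "r = (\<lambda>f s. m (\<lambda>x. f x + s * g x) - s * m g)"
    define q where "q = (\<lambda>f. INF s\<in>{0<..}. r f s)"
    have le_r: "- m (\<lambda>x. - f x) \<le> r f s" if "f \<in> V" "0 < s" for f s
    proof -
      have "s * m g = m (\<lambda>x. (f x + s * g x) + - f x)" using hom[OF g that(2)] by simp
      also have "\<dots> \<le> m (\<lambda>x. f x + s * g x) + m (\<lambda>x. - f x)"
        using that g by (intro sub add_closed cmult_closed minus_closed)
      finally show ?thesis by (simp add: r_def)
    qed
    have q_le: "q f \<le> r f s" if "f \<in> V" "0 < s" for f s
      unfolding q_def using that le_r
      by (intro cINF_lower bdd_belowI2[of _ "- m (\<lambda>x. - f x)"]) auto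
    have q_ge: "c \<le> q f" if "\<And>s. 0 < s \<Longrightarrow> c \<le> r f s" for c f
      unfolding q_def using that by (intro cINF_greatest) auto
    have "sublinear_on V q"
    proof (rule sublinear_onI)
      fix f h assume fh: "f \<in> V" "h \<in> V"
      \<comment> \<open>With the parameter \<open>s + t\<close> for the sum, each summand keeps its
        own shift along \<open>g\<close>.\<close>
      have *: "q (\<lambda>x. f x + h x) \<le> r f s + r h t" if st: "0 < s" "0 < t" for s t
      proof -
        have "q (\<lambda>x. f x + h x) \<le> m (\<lambda>x. f x + h x + (s + t) * g x) - (s + t) * m g"
          using q_le[OF add_closed[OF fh], of "s + t"] st by (simp add: r_def)
        also have "m (\<lambda>x. f x + h x + (s + t) * g x)
            = m (\<lambda>x. (f x + s * g x) + (h x + t * g x))"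
          by (simp add: algebra_simps)
        also have "\<dots> \<le> m (\<lambda>x. f x + s * g x) + m (\<lambda>x. h x + t * g x)"
          using fh g by (intro sub add_closed cmult_closed)
        finally show ?thesis by (simp add: r_def distrib_right)
      qed
      have "q (\<lambda>x. f x + h x) - r h t \<le> q f" if "0 < t" for t
        using * that by (intro q_ge) (simp add: algebra_simps)
      then have "q (\<lambda>x. f x + h x) - q f \<le> q h"
        by (intro q_ge) (simp add: algebra_simps)
      then show "q (\<lambda>x. f x + h x) \<le> q f + q h" by simp
    next
      fix f and c :: real assume f: "f \<in> V" and c: "0 < c"
      have "q (\<lambda>x. c * f x) / c \<le> q f"
      proof (rule q_ge)
        fix s :: real assume s: "0 < s"
        have "q (\<lambda>x. c * f x) \<le> r (\<lambda>x. c * f x) (c * s)"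
          using c s f by (intro q_le cmult_closed) auto
        also have "\<dots> = m (\<lambda>x. c * (f x + s * g x)) - c * s * m g"
          by (simp add: r_def algebra_simps)
        also have "\<dots> = c * r f s"
          using f g by (subst hom[OF _ c]) (auto simp: r_def algebra_simps intro: add_closed cmult_closed)
        finally show "q (\<lambda>x. c * f x) / c \<le> r f s" using c by (simp add: field_simps)
      qed
      then show "q (\<lambda>x. c * f x) \<le> c * q f" using c by (simp add: field_simps)
    qed
    moreover have "q f \<le> m f" if "f \<in> V" for f
    proof -
      have "q f \<le> m (\<lambda>x. f x + 1 * g x) - 1 * m g"
        using q_le[OF that, of 1] by (simp add: r_def)
      also have "\<dots> \<le> m f" using sub[OF that g] by simp
      finally show ?thesis .
    qed
    ultimately have "q f = m f" using f by (rule min)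
    then show ?thesis using q_le[OF f, of 1] by (simp add: r_def)
  qed
  have add: "m (\<lambda>x. f x + g x) = m f + m g" if "f \<in> V" "g \<in> V" for f g
    using ge[OF that] sub[OF that] by simp
  have neg: "m (\<lambda>x. - f x) = - m f" if "f \<in> V" for f
    using add[OF that minus_closed[OF that]] sublinear_zero[OF m(1)] by simp
  have cmult: "m (\<lambda>x. c * f x) = c * m f" if f: "f \<in> V" for f c
  proof (cases c "0::real" rule: linorder_cases)
    case less
    then show ?thesis using hom[OF minus_closed[OF f], of "- c"] neg[OF f] by simp
  next
    case equal
    then show ?thesis using sublinear_zero[OF m(1)] by simp
  next
    case greater
    then show ?thesis using hom[OF f] by simp
  qed
  show ?thesis by (rule that[OF m(2,3) add cmult])
qed

end

lemma function_space_cfun: "function_space (cfun X)"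
proof
  show "cfun X \<noteq> {}" using cfun_const by blast
qed (auto intro: cfun_add cfun_mult)

text \<open>\<open>C(Y)\<close> maps to \<open>C(W)\<close> by evaluation, and \<open>\<nu>\<close> is a positive extension of \<open>x\<close> along this map.
  In other words \<open>x\<close> is the barycenter of \<open>\<nu>\<close>.\<close>

lemma state_representation:
  assumes Y: "compact_space Y" and W: "closedin (state_topology Y) W"
    and x: "x \<in> states Y" and dom: "\<And>f. f \<in> cfun Y \<Longrightarrow> \<exists>w\<in>W. x f \<le> w f"
  obtains \<nu> where "\<nu> \<in> states (subtopology (state_topology Y) W)"
    "\<And>f. f \<in> cfun Y \<Longrightarrow> \<nu> (\<lambda>L. L f) = x f"
proof -
  define S where "S = subtopology (state_topology Y) W"
  have WY: "W \<subseteq> states Y" using closedin_subset[OF W] by simp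
  have stW: "w \<in> states Y" if "w \<in> W" for w using WY that by blast
  note W_simps = state_add[OF stW] state_minus[OF stW] state_cmult[OF stW] state_const[OF stW]
  note x_simps = state_add[OF x] state_minus[OF x] state_cmult[OF x] state_const[OF x]
  have tS: "topspace S = W" using WY by (auto simp: S_def)
  have cS: "compact_space S"
    using closedin_compact_space[OF compact_state_topology[OF Y] W]
    by (simp add: S_def compact_space_subtopology)
  have ev: "(\<lambda>L. L f) \<in> cfun S" if "f \<in> cfun Y" for f
    using that by (simp add: S_def cfun_subtopology)
  define A where "A = (\<lambda>h. {f \<in> cfun Y. \<forall>w\<in>W. h w \<le> w f})"
  \<comment> \<open>A linear functional below \<open>p\<close> is the one sought. Tested on the
    evaluations at \<open>f\<close> and at \<open>- f\<close> it agrees with \<open>x\<close>, and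
    it is positive because an \<open>h \<le> 0\<close> on \<open>W\<close> is dominated by the
    evaluation at the zero function, where \<open>x\<close> is 0.\<close>
  define p where "p = (\<lambda>h. INF f\<in>A h. x f)"
  have bdd: "bdd_below (x ` A h)" and ne: "A h \<noteq> {}" if h: "h \<in> cfun S" for h
  proof -
    obtain B where B: "\<And>w. w \<in> W \<Longrightarrow> \<bar>h w\<bar> \<le> B"
      using cfun_bounded[OF cS h] tS by metis
    have "(\<lambda>_. B) \<in> A h"
      using B by (auto simp: A_def W_simps abs_le_iff)
    then show "A h \<noteq> {}" by blast
    show "bdd_below (x ` A h)"
    proof (rule bdd_belowI2)
      fix f assume "f \<in> A h"
      then have f: "f \<in> cfun Y" "\<And>w. w \<in> W \<Longrightarrow> h w \<le> w f" by (auto simp: A_def)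
      \<comment> \<open>Applied to \<open>- f\<close>, the domination hypothesis gives a
        \<open>w\<close> with \<open>w f \<le> x f\<close>; this keeps the infimum finite.\<close>
      obtain w where w: "w \<in> W" "x (\<lambda>y. - f y) \<le> w (\<lambda>y. - f y)"
        using dom[OF cfun_minus[OF f(1)]] by blast
      have "w f \<le> x f" using w f(1) by (simp add: W_simps x_simps)
      then show "- B \<le> x f" using f(2)[OF w(1)] B[OF w(1)] by linarith
    qed
  qed
  have le: "p h \<le> x f" if "h \<in> cfun S" "f \<in> A h" for h f
    unfolding p_def using that bdd by (intro cINF_lower) auto
  have ge: "c \<le> p h" if "h \<in> cfun S" "\<And>f. f \<in> A h \<Longrightarrow> c \<le> x f" for c h
    unfolding p_def using that ne by (intro cINF_greatest) auto
  have "sublinear_on (cfun S) p"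
  proof (rule sublinear_onI)
    fix h k assume hk: "h \<in> cfun S" "k \<in> cfun S"
    have *: "p (\<lambda>w. h w + k w) \<le> x f + x g" if fg: "f \<in> A h" "g \<in> A k" for f g
    proof -
      have "(\<lambda>y. f y + g y) \<in> A (\<lambda>w. h w + k w)"
        using fg by (auto simp: A_def cfun_add W_simps add_mono)
      from le[OF cfun_add[OF hk] this] show ?thesis
        using fg by (simp add: A_def x_simps)
    qed
    have "p (\<lambda>w. h w + k w) - x g \<le> p h" if "g \<in> A k" for g
      using * that by (intro ge hk) (simp add: algebra_simps)
    then have "p (\<lambda>w. h w + k w) - p h \<le> p k"
      by (intro ge hk) (simp add: algebra_simps)
    then show "p (\<lambda>w. h w + k w) \<le> p h + p k" by simp
  next
    fix h and c :: real assume h: "h \<in> cfun S" and c: "0 < c"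
    have "p (\<lambda>w. c * h w) / c \<le> p h"
    proof (rule ge[OF h])
      fix f assume f: "f \<in> A h"
      have "(\<lambda>y. c * f y) \<in> A (\<lambda>w. c * h w)"
        using f c by (auto simp: A_def cfun_mult W_simps)
      from le[OF cfun_mult[OF cfun_const h] this] show "p (\<lambda>w. c * h w) / c \<le> x f"
        using f c by (simp add: A_def x_simps field_simps)
    qed
    then show "p (\<lambda>w. c * h w) \<le> c * p h" using c by (simp add: field_simps)
  qed
  then obtain \<nu> where \<nu>: "\<nu> \<in> extensional (cfun S)" "\<And>h. h \<in> cfun S \<Longrightarrow> \<nu> h \<le> p h"
    and add: "\<And>h k. h \<in> cfun S \<Longrightarrow> k \<in> cfun S \<Longrightarrow> \<nu> (\<lambda>w. h w + k w) = \<nu> h + \<nu> k"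
    and cmult: "\<And>h c. h \<in> cfun S \<Longrightarrow> \<nu> (\<lambda>w. c * h w) = c * \<nu> h"
    using function_space.hahn_banach[OF function_space_cfun] by blast
  have le': "\<nu> h \<le> x f" if "h \<in> cfun S" "f \<in> cfun Y" "\<And>w. w \<in> W \<Longrightarrow> h w \<le> w f" for h f
    using \<nu>(2)[OF that(1)] le[OF that(1), of f] that by (simp add: A_def)
  have bary: "\<nu> (\<lambda>L. L f) = x f" if f: "f \<in> cfun Y" for f
  proof (rule antisym)
    show "\<nu> (\<lambda>L. L f) \<le> x f" by (rule le'[OF ev[OF f] f]) simp
    have "\<nu> (\<lambda>L. - 1 * L f) \<le> x (\<lambda>y. - f y)"
      using f by (intro le' cfun_mult cfun_const ev cfun_minus) (auto simp: W_simps)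
    then show "x f \<le> \<nu> (\<lambda>L. L f)" using cmult[OF ev[OF f], of "-1"] f by (simp add: x_simps)
  qed
  have "\<nu> \<in> states S"
  proof (rule statesI[OF \<nu>(1) _ add cmult])
    have "\<nu> (\<lambda>_. 1) \<le> x (\<lambda>_. 1)" "\<nu> (\<lambda>_. -1 * 1) \<le> x (\<lambda>_. -1)"
      by (rule le'; simp add: W_simps)+
    then show "\<nu> (\<lambda>_. 1) = 1" using cmult[of "\<lambda>_. 1" "-1"] by (simp add: x_simps)
    fix h assume h: "h \<in> cfun S" "\<And>w. w \<in> topspace S \<Longrightarrow> 0 \<le> h w"
    have "\<nu> (\<lambda>w. -1 * h w) \<le> x (\<lambda>_. 0)"
      using h tS by (intro le' cfun_mult cfun_const) (auto simp: W_simps)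
    then show "0 \<le> \<nu> h" using cmult[OF h(1), of "-1"] by (simp add: x_simps)
  qed
  then show ?thesis using bary unfolding S_def by (rule that[of \<nu>])
qed

section \<open>Extreme points of sets of states\<close>

text \<open>The sets that are intersections of half-spaces. This is the closed convex sets, but
  stated so that no separation theorem is needed for barycenters to exist.\<close>

definition half_space_closed :: "'a topology \<Rightarrow> (('a \<Rightarrow> real) \<Rightarrow> real) set \<Rightarrow> bool" where
  "half_space_closed Y Q \<longleftrightarrow>
     Q \<subseteq> states Y \<and> (\<forall>s\<in>states Y. (\<forall>f\<in>cfun Y. \<exists>q\<in>Q. s f \<le> q f) \<longrightarrow> s \<in> Q)"

text \<open>Extremality is tested on midpoints. The condition is symmetric in \<open>a\<close> and
  \<open>b\<close>, so \<open>a = x\<close> also yields \<open>b = x\<close>.\<close>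

definition extreme_state ::
    "'a topology \<Rightarrow> (('a \<Rightarrow> real) \<Rightarrow> real) set \<Rightarrow> (('a \<Rightarrow> real) \<Rightarrow> real) \<Rightarrow> bool" where
  "extreme_state Y Q x \<longleftrightarrow>
     x \<in> Q \<and> (\<forall>a\<in>Q. \<forall>b\<in>Q. (\<forall>f\<in>cfun Y. 2 * x f = a f + b f) \<longrightarrow> a = x)"

text \<open>The setting of Bauer's theorem: the only state representing an extreme point is the
  evaluation at it (\<open>state_eq_eval\<close>), so the point lies in every closed
  \<open>W\<close> that carries such a state (\<open>extreme_mem\<close>).\<close>

locale extreme_barycenter =
  fixes Y :: "'a topology" and Q W :: "(('a \<Rightarrow> real) \<Rightarrow> real) set" and x \<nu>
  assumes compact: "compact_space Y"
    and half_spaces: "half_space_closed Y Q"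
    and extreme: "extreme_state Y Q x"
    and closed: "closedin (state_topology Y) W" and subset: "W \<subseteq> Q"
    and state: "\<nu> \<in> states (subtopology (state_topology Y) W)"
    and barycenter: "f \<in> cfun Y \<Longrightarrow> \<nu> (\<lambda>L. L f) = x f"
begin

definition "S = subtopology (state_topology Y) W"

lemma W_states: "w \<in> W \<Longrightarrow> w \<in> states Y"
  using closedin_subset[OF closed] by auto

lemma topspace_S [simp]: "topspace S = W"
  using W_states by (auto simp: S_def)

lemma compact_S: "compact_space S"
  using closedin_compact_space[OF compact_state_topology[OF compact] closed]
  by (simp add: S_def compact_space_subtopology)

lemma eval_S: "f \<in> cfun Y \<Longrightarrow> (\<lambda>L. L f) \<in> cfun S"
  by (simp add: S_def cfun_subtopology)

lemma state_S: "\<nu> \<in> states S"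
  using state by (simp add: S_def)

lemma x_state: "x \<in> states Y"
  using extreme half_spaces by (auto simp: extreme_state_def half_space_closed_def)

text \<open>This functional is the barycenter of the state with density \<open>2 * h\<close>
  relative to \<nu>. Its value at \<open>f\<close> is at most the largest value of the evaluation at
  \<open>f\<close> on \<open>W\<close>, so it lies in every half-space that contains
  \<open>W\<close>.\<close>

lemma weighted_barycenter:
  assumes h: "h \<in> cfun S" "\<And>w. w \<in> W \<Longrightarrow> 0 \<le> h w" "\<nu> h = 1 / 2"
  shows "(\<lambda>f\<in>cfun Y. 2 * \<nu> (\<lambda>L. h L * L f)) \<in> Q"
proof -
  let ?q = "\<lambda>f\<in>cfun Y. 2 * \<nu> (\<lambda>L. h L * L f)"
  note closed = cfun_mult[OF h(1) eval_S] and cong = state_cong[OF state_S]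
  have "?q \<in> states Y"
  proof (rule statesI)
    have "\<nu> (\<lambda>L. h L * L (\<lambda>_. 1)) = \<nu> h"
      by (rule cong) (use h in \<open>auto intro!: closed simp: state_one[OF W_states]\<close>)
    then show "?q (\<lambda>_. 1) = 1" using h by simp
  next
    fix f g assume fg: "f \<in> cfun Y" "g \<in> cfun Y"
    have "\<nu> (\<lambda>L. h L * L (\<lambda>x. f x + g x)) = \<nu> (\<lambda>L. h L * L f + h L * L g)"
      by (rule cong) (use fg in \<open>auto intro!: closed cfun_add simp: state_add[OF W_states] distrib_left\<close>)
    then show "?q (\<lambda>x. f x + g x) = ?q f + ?q g"
      using fg by (simp add: cfun_add state_add[OF state_S] closed)
  next
    fix f c assume f: "f \<in> cfun Y"
    have "\<nu> (\<lambda>L. h L * L (\<lambda>x. c * f x)) = \<nu> (\<lambda>L. c * (h L * L f))"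
      by (rule cong) (use f in \<open>auto intro!: closed cfun_mult[OF cfun_const] simp: state_cmult[OF W_states]\<close>)
    then show "?q (\<lambda>x. c * f x) = c * ?q f"
      using f by (simp add: cfun_mult state_cmult[OF state_S] closed)
  next
    fix f assume f: "f \<in> cfun Y" "\<And>y. y \<in> topspace Y \<Longrightarrow> 0 \<le> f y"
    have "0 \<le> \<nu> (\<lambda>L. h L * L f)"
      using f h state_nonneg[OF W_states f] by (intro state_nonneg[OF state_S] closed) auto
    then show "0 \<le> ?q f" using f by simp
  qed simp
  moreover have "\<exists>q\<in>Q. ?q f \<le> q f" if f: "f \<in> cfun Y" for f
  proof -
    obtain w where w: "w \<in> W" "\<And>v. v \<in> W \<Longrightarrow> v f \<le> w f"
      using cfun_attains_max[OF compact_S topspace_nonempty_of_state[OF state_S] eval_S[OF f]]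
      by auto
    have "\<nu> (\<lambda>L. h L * L f) \<le> \<nu> (\<lambda>L. w f * h L)"
      using w h f by (intro state_mono[OF state_S] closed)
        (auto intro!: mult_left_mono cfun_mult[OF _ cfun_const] simp: mult.commute[of "w f"])
    also have "\<dots> = w f / 2" using h state_cmult[OF state_S h(1)] by simp
    finally have "?q f \<le> w f" using f by simp
    then show ?thesis using w(1) subset by blast
  qed
  ultimately show ?thesis using half_spaces unfolding half_space_closed_def by blast
qed

text \<open>Tilting \<open>\<nu>\<close> by the weights \<open>1/2 \<plusminus> c (L g - x g)\<close> splits the barycenter
  into two halves, which both equal \<open>x\<close> by extremality.\<close>

lemma variance_zero:
  assumes g: "g \<in> cfun Y"
  shows "\<nu> (\<lambda>L. (L g - x g) * (L g - x g)) = 0"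
proof -
  define d where "d = (\<lambda>L. L g - x g)"
  have d: "d \<in> cfun S" using g unfolding d_def by (intro cfun_intros eval_S)
  have nd: "\<nu> d = 0"
    using state_diff[OF state_S eval_S[OF g], of "\<lambda>_. x g"] g
    by (simp add: d_def barycenter state_const[OF state_S])
  obtain B where B: "B > 0" "\<And>L. L \<in> W \<Longrightarrow> \<bar>d L\<bar> \<le> B"
    using cfun_bounded[OF compact_S d] by auto
  \<comment> \<open>This constant keeps \<open>c * d\<close> between -1/2 and 1/2, so that both
    weights are nonnegative.\<close>
  define c where "c = 1 / (2 * B)"
  have half: "\<bar>c * d L\<bar> \<le> 1 / 2" if "L \<in> W" for L
    using B(1) B(2)[OF that] by (simp add: c_def abs_mult field_simps)
  define h where "h = (\<lambda>L. 1 / 2 + c * d L)"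
  define k where "k = (\<lambda>L. 1 / 2 - c * d L)"
  have hk: "h \<in> cfun S" "k \<in> cfun S" unfolding h_def k_def by (intro cfun_intros d)+
  have hk0: "0 \<le> h L" "0 \<le> k L" if "L \<in> W" for L
    using half[OF that] by (auto simp: h_def k_def abs_le_iff)
  have cd: "(\<lambda>L. c * d L) \<in> cfun S" "\<nu> (\<lambda>L. c * d L) = 0"
    using d nd state_cmult[OF state_S d] by (auto intro!: cfun_mult)
  have nhk: "\<nu> h = 1 / 2" "\<nu> k = 1 / 2"
    using state_add[OF state_S cfun_const cd(1), of "1 / 2"] state_diff[OF state_S cfun_const cd(1), of "1 / 2"]
      cd(2) by (simp_all add: h_def k_def state_const[OF state_S])
  let ?q = "\<lambda>h. \<lambda>f\<in>cfun Y. 2 * \<nu> (\<lambda>L. h L * L f)"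
  have "2 * x f = ?q h f + ?q k f" if f: "f \<in> cfun Y" for f
  proof -
    have "\<nu> (\<lambda>L. h L * L f) + \<nu> (\<lambda>L. k L * L f) = \<nu> (\<lambda>L. h L * L f + k L * L f)"
      using f hk by (intro state_add[OF state_S, symmetric] cfun_mult eval_S)
    also have "(\<lambda>L. h L * L f + k L * L f) = (\<lambda>L. L f)"
      by (simp add: h_def k_def algebra_simps)
    finally show ?thesis using f by (simp add: barycenter)
  qed
  then have "?q h = x"
    using extreme weighted_barycenter[OF hk(1) hk0(1) nhk(1)]
      weighted_barycenter[OF hk(2) hk0(2) nhk(2)]
    unfolding extreme_state_def by blast
  then have "2 * \<nu> (\<lambda>L. h L * L g) = x g" using g by (metis (lifting) restrict_apply')
  moreover have "\<nu> (\<lambda>L. h L * L g) = \<nu> (\<lambda>L. 1 / 2 * L g + c * (d L * L g))"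
    by (simp add: h_def algebra_simps)
  moreover have "\<dots> = 1 / 2 * x g + c * \<nu> (\<lambda>L. d L * L g)"
  proof -
    have "\<dots> = \<nu> (\<lambda>L. 1 / 2 * L g) + \<nu> (\<lambda>L. c * (d L * L g))"
      using d g by (intro state_add[OF state_S] cfun_mult cfun_const eval_S)
    also have "\<nu> (\<lambda>L. 1 / 2 * L g) = 1 / 2 * x g"
      unfolding state_cmult[OF state_S eval_S[OF g]] barycenter[OF g] ..
    also have "\<nu> (\<lambda>L. c * (d L * L g)) = c * \<nu> (\<lambda>L. d L * L g)"
      using d g by (intro state_cmult[OF state_S] cfun_mult eval_S)
    finally show ?thesis .
  qed
  ultimately have "\<nu> (\<lambda>L. d L * L g) = 0" using B(1) by (simp add: c_def)
  \<comment> \<open>As \<open>\<nu> d = 0\<close>, subtracting \<open>x g * d\<close> costs nothing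
    and completes the product to the square of \<open>d\<close>.\<close>
  then have "\<nu> (\<lambda>L. d L * L g - x g * d L) = 0"
    using d g nd by (subst state_diff[OF state_S])
      (auto simp: state_cmult[OF state_S] intro!: cfun_mult eval_S)
  then show ?thesis by (simp add: d_def algebra_simps)
qed

text \<open>The squares of \<open>L f - x f\<close> are null for \<nu> and together separate
  \<open>x\<close> from every other state. By compactness \<open>h\<close> is below \<open>e\<close>
  plus a finite sum of multiples of them. Vanishing at \<open>x\<close> is asked only if
  \<open>x\<close> is in \<open>W\<close>, which leaves room to refute the other case.\<close>

lemma state_eq_zero:
  assumes h: "h \<in> cfun S" "\<And>w. w \<in> W \<Longrightarrow> 0 \<le> h w" and hx: "x \<in> W \<Longrightarrow> h x = 0"
  shows "\<nu> h = 0"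
proof (rule antisym)
  show "0 \<le> \<nu> h" using h by (intro state_nonneg[OF state_S]) auto
  show "\<nu> h \<le> 0"
  proof (rule field_le_epsilon)
    fix e :: real assume e: "0 < e"
    \<comment> \<open>The index is a function \<open>f\<close> together with a multiplicity, chosen
      large enough to exceed \<open>h\<close> at a given state that differs from \<open>x\<close> at
      \<open>f\<close>.\<close>
    define v where "v = (\<lambda>i :: ('a \<Rightarrow> real) \<times> nat. \<lambda>L :: ('a \<Rightarrow> real) \<Rightarrow> real.
        real (snd i) * ((L (fst i) - x (fst i)) * (L (fst i) - x (fst i))))"
    define U where "U = (\<lambda>i. {L \<in> topspace S. h L < e + v i L})"
    have v: "v i \<in> cfun S" "\<nu> (v i) = 0" if "fst i \<in> cfun Y" for i
    proof -
      have "(\<lambda>L. (L (fst i) - x (fst i)) * (L (fst i) - x (fst i))) \<in> cfun S"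
        using that by (intro cfun_intros eval_S)
      then show "v i \<in> cfun S" "\<nu> (v i) = 0"
        using variance_zero[OF that] by (auto simp: v_def state_cmult[OF state_S] intro!: cfun_mult[OF cfun_const])
    qed
    have op: "openin S (U i)" if "i \<in> cfun Y \<times> UNIV" for i
    proof -
      have "closedin S {L \<in> topspace S. e + v i L \<le> h L}"
        using that h v by (intro closedin_cfun_le cfun_add cfun_const) auto
      moreover have "U i = topspace S - {L \<in> topspace S. e + v i L \<le> h L}"
        by (auto simp: U_def)
      ultimately show ?thesis by (simp only: openin_diff openin_topspace)
    qed
    have cover: "topspace S \<subseteq> \<Union>(U ` (cfun Y \<times> UNIV))"
    proof
      fix L assume L: "L \<in> topspace S"
      show "L \<in> \<Union>(U ` (cfun Y \<times> UNIV))"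
      proof (cases "L = x")
        case True
        \<comment> \<open>At \<open>x\<close> all squares vanish, and \<open>h x = 0 < e\<close>
          suffices; any index would do.\<close>
        then have "L \<in> U (\<lambda>_. 0, 0)" using L hx e by (simp add: U_def v_def)
        then show ?thesis using cfun_const by blast
      next
        case False
        then obtain f where f: "f \<in> cfun Y" "L f \<noteq> x f"
          using state_eqI[OF W_states x_state] L by auto
        then have "0 < (L f - x f) * (L f - x f)" by (auto simp: zero_less_mult_iff linorder_neq_iff)
        then obtain n where "h L < real n * ((L f - x f) * (L f - x f))"
          using reals_Archimedean3 by blast
        then have "L \<in> U (f, n)" using L e by (simp add: U_def v_def)
        then show ?thesis using f by blast
      qed
    qed
    obtain \<F> where \<F>: "finite \<F>" "\<F> \<subseteq> U ` (cfun Y \<times> UNIV)" "topspace S \<subseteq> \<Union>\<F>"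
      using compactinD[OF compact_S[unfolded compact_space_def] _ cover] op by blast
    obtain I where I: "finite I" "I \<subseteq> cfun Y \<times> UNIV" "\<F> = U ` I"
      using finite_subset_image[OF \<F>(1,2)] by blast
    have vI: "v i \<in> cfun S" "\<nu> (v i) = 0" if "i \<in> I" for i
      using v[of i] I(2) that by auto
    have "\<nu> h \<le> \<nu> (\<lambda>L. e + (\<Sum>i\<in>I. v i L))"
    proof (rule state_mono[OF state_S h(1)])
      show "(\<lambda>L. e + (\<Sum>i\<in>I. v i L)) \<in> cfun S"
        using I vI by (intro cfun_add cfun_const cfun_sum)
      fix L assume "L \<in> topspace S"
      then obtain i where i: "i \<in> I" "h L < e + v i L" using \<F>(3) I(3) by (auto simp: U_def)
      have "v i L \<le> (\<Sum>i\<in>I. v i L)"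
        using I i by (intro member_le_sum) (auto simp: v_def)
      then show "h L \<le> e + (\<Sum>i\<in>I. v i L)" using i by simp
    qed
    also have "\<dots> = e"
      using I vI by (simp add: state_add[OF state_S] state_sum[OF state_S] state_const[OF state_S] cfun_sum)
    finally show "\<nu> h \<le> 0 + e" by simp
  qed
qed

text \<open>If \<open>x\<close> were outside \<open>W\<close>, then \<open>state_eq_zero\<close>
  would apply to the constant 1, whose value is 1.\<close>

lemma extreme_mem: "x \<in> W"
  using state_eq_zero[of "\<lambda>_. 1"] state_one[OF state_S] by fastforce

text \<open>The distance of \<open>h\<close> from its value at \<open>x\<close>, written as a
  maximum, vanishes at \<open>x\<close> and is therefore null for \<nu>.\<close>

lemma state_eq_eval:
  assumes h: "h \<in> cfun S"
  shows "\<nu> h = h x"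
proof -
  define k where "k = (\<lambda>L. max (h L - h x) (h x - h L))"
  have k: "k \<in> cfun S" unfolding k_def by (intro cfun_intros h)
  have k0: "\<nu> k = 0" using k by (rule state_eq_zero) (auto simp: k_def)
  have "\<nu> h - h x \<le> \<nu> k"
    using state_mono[OF state_S cfun_diff[OF h cfun_const] k, of "h x"]
      state_diff[OF state_S h cfun_const, of "h x"] state_const[OF state_S, of "h x"] by (simp add: k_def)
  moreover have "h x - \<nu> h \<le> \<nu> k"
    using state_mono[OF state_S cfun_diff[OF cfun_const h] k, of "h x"]
      state_diff[OF state_S cfun_const h, of "h x"] state_const[OF state_S, of "h x"] by (simp add: k_def)
  ultimately show ?thesis using k0 by simp
qed

end

section \<open>The regular measure of a state\<close>

text \<open>The Riesz-Markov construction usually takes test functions with compact support inside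
  \<open>U\<close>. Here they merely vanish off \<open>U\<close>, and \<open>cut\<close> restores
  the support condition up to an error \<open>e\<close>.\<close>

definition cfun_below :: "'a topology \<Rightarrow> 'a set \<Rightarrow> ('a \<Rightarrow> real) set" where
  "cfun_below X U =
     {f \<in> cfun X. \<forall>x\<in>topspace X. 0 \<le> f x \<and> f x \<le> 1 \<and> (x \<notin> U \<longrightarrow> f x = 0)}"

definition state_open :: "'a topology \<Rightarrow> (('a \<Rightarrow> real) \<Rightarrow> real) \<Rightarrow> 'a set \<Rightarrow> ennreal" where
  "state_open X L U = (SUP f\<in>cfun_below X U. ennreal (L f))"

definition state_outer :: "'a topology \<Rightarrow> (('a \<Rightarrow> real) \<Rightarrow> real) \<Rightarrow> 'a set \<Rightarrow> ennreal" where
  "state_outer X L A = (INF U\<in>{U. openin X U \<and> A \<subseteq> U}. state_open X L U)"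

locale compact_state =
  fixes X :: "'a topology" and L
  assumes compact: "compact_space X" and Hausdorff: "Hausdorff_space X" and L: "L \<in> states X"
begin

abbreviation "below \<equiv> cfun_below X"
abbreviation "lam \<equiv> state_open X L"
abbreviation "mu \<equiv> state_outer X L"

lemma below_cfun: "f \<in> below U \<Longrightarrow> f \<in> cfun X"
  by (simp add: cfun_below_def)

lemma below_nonneg: "f \<in> below U \<Longrightarrow> x \<in> topspace X \<Longrightarrow> 0 \<le> f x"
  by (simp add: cfun_below_def)

lemma below_le: "f \<in> below U \<Longrightarrow> x \<in> topspace X \<Longrightarrow> f x \<le> 1"
  by (simp add: cfun_below_def)

lemma below_zero: "f \<in> below U \<Longrightarrow> x \<in> topspace X \<Longrightarrow> x \<notin> U \<Longrightarrow> f x = 0"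
  by (simp add: cfun_below_def)

lemma below_pos: "f \<in> below U \<Longrightarrow> x \<in> topspace X \<Longrightarrow> 0 < f x \<Longrightarrow> x \<in> U"
  using below_zero by fastforce

lemma state_below_nonneg: "f \<in> below U \<Longrightarrow> 0 \<le> L f"
  by (intro state_nonneg[OF L]) (auto simp: cfun_below_def)

lemma lam_ge: "f \<in> below U \<Longrightarrow> ennreal (L f) \<le> lam U"
  unfolding state_open_def by (rule SUP_upper)

lemma lam_le: "(\<And>f. f \<in> below U \<Longrightarrow> ennreal (L f) \<le> c) \<Longrightarrow> lam U \<le> c"
  unfolding state_open_def by (rule SUP_least)

lemma lam_le_one: "lam U \<le> 1"
proof (rule lam_le)
  fix f assume f: "f \<in> below U"
  have "L f \<le> 1"
    using f by (intro state_upper[OF L]) (auto simp: below_cfun below_le)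
  then show "ennreal (L f) \<le> 1" by (simp add: ennreal_le_1)
qed

text \<open>The constant is moved across and back by subtraction in \<open>ennreal\<close>, which is
  safe because the test function 0 already gives \<open>c \<le> d\<close>.\<close>

lemma lam_add_le:
  assumes "\<And>f. f \<in> below U \<Longrightarrow> ennreal (L f) + c \<le> d"
  shows "lam U + c \<le> d"
proof -
  have "(\<lambda>_. 0) \<in> below U" by (simp add: cfun_below_def)
  from assms[OF this] have cd: "c \<le> d" by (simp add: state_const[OF L])
  have "lam U \<le> d - c" by (rule lam_le) (simp add: ennreal_le_minus_iff assms)
  then have "lam U + c \<le> d - c + c" by (rule add_right_mono)
  then show ?thesis using cd by (simp add: diff_add_cancel_ennreal)
qed

lemma lam_mono: "U \<subseteq> V \<Longrightarrow> lam U \<le> lam V"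
  by (rule lam_le, rule lam_ge) (auto simp: cfun_below_def)

lemma lam_topspace: "lam (topspace X) = 1"
proof (rule antisym[OF lam_le_one])
  have "(\<lambda>_. 1) \<in> below (topspace X)" by (simp add: cfun_below_def)
  from lam_ge[OF this] show "1 \<le> lam (topspace X)" by (simp add: state_one[OF L])
qed

lemma mu_open: "openin X U \<Longrightarrow> mu U = lam U"
  unfolding state_outer_def by (intro antisym INF_lower INF_greatest lam_mono) auto

lemma mu_le: "openin X U \<Longrightarrow> A \<subseteq> U \<Longrightarrow> mu A \<le> lam U"
  unfolding state_outer_def by (intro INF_lower) auto

lemma mu_ge: "(\<And>U. openin X U \<Longrightarrow> A \<subseteq> U \<Longrightarrow> c \<le> lam U) \<Longrightarrow> c \<le> mu A"
  unfolding state_outer_def by (intro INF_greatest) auto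

lemma mu_mono: "A \<subseteq> B \<Longrightarrow> mu A \<le> mu B"
  by (rule mu_ge) (auto intro: mu_le)

lemma mu_approx:
  assumes "A \<subseteq> topspace X" "0 < e"
  obtains U where "openin X U" "A \<subseteq> U" "lam U \<le> mu A + ennreal e"
proof -
  have "mu A \<le> lam (topspace X)" using assms by (intro mu_le) auto
  \<comment> \<open>The value is at most 1, hence finite, so that adding \<open>e\<close> makes it
    strictly larger.\<close>
  then have "mu A < mu A + ennreal e"
    using assms(2) lam_topspace by (simp add: ennreal_add_left_cancel_less less_top[symmetric]) (auto simp: top_unique)
  then obtain U where "openin X U" "A \<subseteq> U" "lam U < mu A + ennreal e"
    unfolding state_outer_def[of X L A] INF_less_iff by auto
  then show ?thesis using that by (simp add: less_imp_le)
qed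

text \<open>Cutting \<open>f\<close> at height \<open>e\<close> moves its support inside the compact set \<open>f \<ge> e\<close>.\<close>

lemma cut:
  assumes f: "f \<in> below U" and e: "0 < e"
  shows "(\<lambda>x. max (f x - e) 0) \<in> below U" "L f \<le> L (\<lambda>x. max (f x - e) 0) + e"
    "\<And>V. {x \<in> topspace X. e \<le> f x} \<subseteq> V \<Longrightarrow> (\<lambda>x. max (f x - e) 0) \<in> below V"
proof -
  have c: "(\<lambda>x. max (f x - e) 0) \<in> cfun X"
    by (intro cfun_intros below_cfun[OF f])
  show *: "(\<lambda>x. max (f x - e) 0) \<in> below V" if "{x \<in> topspace X. e \<le> f x} \<subseteq> V" for V
  proof -
    have "max (f x - e) 0 \<le> 1" "x \<notin> V \<longrightarrow> max (f x - e) 0 = 0" if x: "x \<in> topspace X" for x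
      using \<open>_ \<subseteq> V\<close> below_le[OF f x] e x by auto
    then show ?thesis using c by (simp add: cfun_below_def)
  qed
  show "(\<lambda>x. max (f x - e) 0) \<in> below U"
  proof (rule *, safe)
    fix x assume "x \<in> topspace X" "e \<le> f x"
    then show "x \<in> U" using below_pos[OF f, of x] e by simp
  qed
  have "L f \<le> L (\<lambda>x. max (f x - e) 0 + e)"
    using c below_cfun[OF f] by (intro state_mono[OF L] cfun_add cfun_const) auto
  also have "\<dots> = L (\<lambda>x. max (f x - e) 0) + e"
    using c by (simp add: state_add[OF L] state_const[OF L])
  finally show "L f \<le> L (\<lambda>x. max (f x - e) 0) + e" .
qed

lemma closedin_level: "f \<in> below U \<Longrightarrow> closedin X {x \<in> topspace X. e \<le> f x}"
  by (rule closedin_cfun_le[OF cfun_const below_cfun])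

text \<open>A two-piece partition of unity. After a cut, \<open>f\<close> lives on the level set
  \<open>e \<le> f\<close>. A Urysohn function \<open>u\<close> that is 0 off \<open>U\<close> and 1
  on the part \<open>K\<close> of the level set outside \<open>V\<close> splits it: the product with
  \<open>u\<close> vanishes off \<open>U\<close>, the product with \<open>1 - u\<close> off
  \<open>V\<close>.\<close>

lemma lam_Un:
  assumes U: "openin X U" and V: "openin X V"
  shows "lam (U \<union> V) \<le> lam U + lam V"
proof (rule lam_le)
  fix f assume f: "f \<in> below (U \<union> V)"
  show "ennreal (L f) \<le> lam U + lam V"
  proof (rule ennreal_le_epsilon)
    fix e :: real assume e: "0 < e"
    let ?f = "\<lambda>x. max (f x - e) 0"
    define K where "K = {x \<in> topspace X. e \<le> f x} - V"
    have K: "closedin X K" unfolding K_def by (rule closedin_diff[OF closedin_level[OF f] V])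
    have KU: "K \<subseteq> U"
    proof
      fix x assume "x \<in> K"
      then show "x \<in> U" using below_pos[OF f, of x] e by (auto simp: K_def)
    qed
    have "normal_space X"
      using compact Hausdorff by (simp add: compact_Hausdorff_or_regular_imp_normal_space)
    then obtain u where u: "continuous_map X (top_of_set {0..1::real}) u"
      "u ` (topspace X - U) \<subseteq> {0}" "u ` K \<subseteq> {1}"
      using Urysohn_lemma[of X "topspace X - U" K 0 1] K U KU by (auto simp: disjnt_def)
    have uc: "u \<in> cfun X" and u01: "\<And>x. x \<in> topspace X \<Longrightarrow> 0 \<le> u x \<and> u x \<le> 1"
      using u(1) by (auto simp: cfun_def continuous_map_in_subtopology)
    note cf = cut(1)[OF f e]
    have fU: "(\<lambda>x. ?f x * u x) \<in> below U"
    proof -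
      have "?f x * u x \<le> 1" "x \<notin> U \<longrightarrow> ?f x * u x = 0" if x: "x \<in> topspace X" for x
        using u(2) x u01[OF x] below_le[OF cf x] by (auto intro: mult_le_one)
      then show ?thesis
        using u01 below_nonneg[OF cf] cfun_mult[OF below_cfun[OF cf] uc] by (simp add: cfun_below_def)
    qed
    have fV: "(\<lambda>x. ?f x * (1 - u x)) \<in> below V"
    proof -
      have "?f x * (1 - u x) \<le> 1" "x \<notin> V \<longrightarrow> ?f x * (1 - u x) = 0" if x: "x \<in> topspace X" for x
      proof -
        show "?f x * (1 - u x) \<le> 1"
          using u01[OF x] below_le[OF cf x] by (intro mult_le_one) auto
        have "?f x = 0 \<or> u x = 1" if "x \<notin> V" using u(3) x that by (force simp: K_def)
        then show "x \<notin> V \<longrightarrow> ?f x * (1 - u x) = 0" by auto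
      qed
      then show ?thesis
        using u01 below_nonneg[OF cf] cfun_mult[OF below_cfun[OF cf] cfun_diff[OF cfun_const uc]]
        by (simp add: cfun_below_def)
    qed
    have "L ?f = L (\<lambda>x. ?f x * u x + ?f x * (1 - u x))" by (simp add: algebra_simps)
    also have "\<dots> = L (\<lambda>x. ?f x * u x) + L (\<lambda>x. ?f x * (1 - u x))"
      using fU fV by (intro state_add[OF L] below_cfun)
    finally have "L f \<le> L (\<lambda>x. ?f x * u x) + L (\<lambda>x. ?f x * (1 - u x)) + e"
      using cut(2)[OF f e] by simp
    then have "ennreal (L f) \<le> ennreal (L (\<lambda>x. ?f x * u x) + L (\<lambda>x. ?f x * (1 - u x)) + e)"
      by (rule ennreal_leI)
    also have "\<dots> = ennreal (L (\<lambda>x. ?f x * u x)) + ennreal (L (\<lambda>x. ?f x * (1 - u x))) + ennreal e"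
      using state_below_nonneg[OF fU] state_below_nonneg[OF fV] e by (simp add: ennreal_plus)
    also have "\<dots> \<le> lam U + lam V + ennreal e"
      by (intro add_mono lam_ge fU fV) simp
    finally show "ennreal (L f) \<le> lam U + lam V + ennreal e" .
  qed
qed

lemma lam_UN_finite:
  fixes U :: "nat \<Rightarrow> 'a set"
  assumes "\<And>i. openin X (U i)"
  shows "lam (\<Union>i<n. U i) \<le> (\<Sum>i<n. lam (U i))"
proof (induction n)
  case 0
  have "lam {} \<le> 0"
  proof (rule lam_le)
    fix f assume "f \<in> below {}"
    then have "L f \<le> 0" by (intro state_upper[OF L]) (auto simp: cfun_below_def)
    then show "ennreal (L f) \<le> 0" by (simp add: ennreal_neg)
  qed
  then show ?case by simp
next
  case (Suc n)
  have "lam (\<Union>i<Suc n. U i) \<le> lam (\<Union>i<n. U i) + lam (U n)"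
    using lam_Un[of "\<Union>i<n. U i" "U n"] assms
    by (auto simp: lessThan_Suc Un_commute intro!: openin_Union)
  also have "\<dots> \<le> (\<Sum>i<n. lam (U i)) + lam (U n)" by (rule add_right_mono[OF Suc])
  finally show ?case by simp
qed

text \<open>The level set that carries a cut function is compact, so finitely many of the open sets
  cover it and the finite case applies.\<close>

lemma lam_UN:
  fixes U :: "nat \<Rightarrow> 'a set"
  assumes U: "\<And>i. openin X (U i)"
  shows "lam (\<Union>i. U i) \<le> (\<Sum>i. lam (U i))"
proof (rule lam_le)
  fix f assume f: "f \<in> below (\<Union>i. U i)"
  show "ennreal (L f) \<le> (\<Sum>i. lam (U i))"
  proof (rule ennreal_le_epsilon)
    fix e :: real assume e: "0 < e"
    let ?K = "{x \<in> topspace X. e \<le> f x}"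
    have "compactin X ?K"
      using closedin_level[OF f] compact by (rule closedin_compact_space[rotated])
    moreover have "?K \<subseteq> \<Union>(range U)"
    proof
      fix x assume "x \<in> ?K"
      then show "x \<in> \<Union>(range U)"
        using below_pos[OF f, of x] e by auto
    qed
    ultimately obtain \<F> where \<F>: "finite \<F>" "\<F> \<subseteq> range U" "?K \<subseteq> \<Union>\<F>"
      using compactinD[of X ?K "range U"] U by blast
    obtain I where I: "finite I" "\<F> = U ` I" using finite_subset_image[OF \<F>(1,2)] by blast
    obtain n where n: "I \<subseteq> {..<n}" using finite_nat_iff_bounded I(1) by blast
    have "?K \<subseteq> (\<Union>i<n. U i)" using \<F>(3) I(2) n by blast
    then have "ennreal (L (\<lambda>x. max (f x - e) 0)) \<le> lam (\<Union>i<n. U i)"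
      by (intro lam_ge cut(3)[OF f e])
    also have "\<dots> \<le> (\<Sum>i<n. lam (U i))" by (rule lam_UN_finite[OF U])
    also have "\<dots> \<le> (\<Sum>i. lam (U i))" by (intro sum_le_suminf) auto
    finally have le: "ennreal (L (\<lambda>x. max (f x - e) 0)) \<le> (\<Sum>i. lam (U i))" .
    have "ennreal (L f) \<le> ennreal (L (\<lambda>x. max (f x - e) 0) + e)"
      by (rule ennreal_leI[OF cut(2)[OF f e]])
    also have "\<dots> = ennreal (L (\<lambda>x. max (f x - e) 0)) + ennreal e"
      using state_below_nonneg[OF cut(1)[OF f e]] e by (simp add: ennreal_plus)
    finally show "ennreal (L f) \<le> (\<Sum>i. lam (U i)) + ennreal e"
      using le add_right_mono order_trans by blast
  qed
qed

lemma mu_UN: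
  fixes A :: "nat \<Rightarrow> 'a set"
  assumes A: "\<And>i. A i \<subseteq> topspace X"
  shows "mu (\<Union>i. A i) \<le> (\<Sum>i. mu (A i))"
proof (rule ennreal_le_epsilon)
  fix e :: real assume e: "0 < e"
  have "\<exists>U. openin X U \<and> A i \<subseteq> U \<and> lam U \<le> mu (A i) + ennreal (e * (1/2)^Suc i)" for i
    using mu_approx[OF A, of "e * (1/2)^Suc i" i] e by (metis half_gt_zero_iff mult_pos_pos zero_less_one zero_less_power)
  then obtain U where U: "\<And>i. openin X (U i)" "\<And>i. A i \<subseteq> U i"
    "\<And>i. lam (U i) \<le> mu (A i) + ennreal (e * (1/2)^Suc i)" by metis
  have "mu (\<Union>i. A i) \<le> lam (\<Union>i. U i)" using U by (intro mu_le) (auto simp: openin_Union)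
  also have "\<dots> \<le> (\<Sum>i. lam (U i))" by (rule lam_UN[OF U(1)])
  also have "\<dots> \<le> (\<Sum>i. mu (A i) + ennreal (e * (1/2)^Suc i))"
    by (intro suminf_le U(3)) auto
  also have "\<dots> = (\<Sum>i. mu (A i)) + (\<Sum>i. ennreal (e * (1/2)^Suc i))"
    by (intro suminf_add[symmetric]) auto
  also have "(\<Sum>i. ennreal (e * (1/2)^Suc i)) = ennreal e"
    using e by (subst suminf_ennreal_eq[where x = e])
      (use sums_mult[OF power_half_series, of e] in auto)
  finally show "mu (\<Union>i. A i) \<le> (\<Sum>i. mu (A i)) + ennreal e" .
qed

text \<open>The nontrivial half of Caratheodory's criterion for open \<open>U\<close>. A function
  below \<open>V \<inter> U\<close>, once cut, lives on the level set \<open>?K\<close>; a function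
  below \<open>V - ?K\<close> vanishes there, so their sum still stays below 1 and below
  \<open>V\<close>.\<close>

lemma mu_split_open:
  assumes U: "openin X U" and A: "A \<subseteq> topspace X"
  shows "mu (A \<inter> U) + mu (A - U) \<le> mu A"
proof (rule mu_ge)
  fix V assume V: "openin X V" "A \<subseteq> V"
  have "lam (V \<inter> U) + mu (V - U) \<le> lam V"
  proof (rule ennreal_le_epsilon, rule lam_add_le)
    fix e :: real and f assume e: "0 < e" and f: "f \<in> below (V \<inter> U)"
    let ?f = "\<lambda>x. max (f x - e) 0" and ?K = "{x \<in> topspace X. e \<le> f x}"
    note cf = cut(1)[OF f e]
    have KU: "?K \<subseteq> V \<inter> U"
    proof
      fix x assume "x \<in> ?K"
      then show "x \<in> V \<inter> U" using below_pos[OF f, of x] e by auto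
    qed
    have "mu (V - U) \<le> lam (V - ?K)"
      using KU V(1) closedin_level[OF f] by (intro mu_le openin_diff) auto
    moreover have "lam (V - ?K) + ennreal (L f) \<le> lam V + ennreal e"
    proof (rule lam_add_le)
      fix g assume g: "g \<in> below (V - ?K)"
      have "(\<lambda>x. ?f x + g x) \<in> below V"
      proof -
        have "?f x + g x \<le> 1" "x \<notin> V \<longrightarrow> ?f x + g x = 0" if x: "x \<in> topspace X" for x
          using below_le[OF g x] below_zero[OF g x] below_le[OF f x] below_zero[OF f x] e x
          by (cases "x \<in> ?K"; auto)+
        then show ?thesis
          using below_nonneg[OF g] cfun_add[OF below_cfun[OF cf] below_cfun[OF g]]
          by (simp add: cfun_below_def)
      qed
      from lam_ge[OF this] have le: "ennreal (L ?f + L g) \<le> lam V"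
        using below_cfun[OF g] below_cfun[OF cf] by (simp add: state_add[OF L])
      have "ennreal (L g) + ennreal (L f) = ennreal (L g + L f)"
        using state_below_nonneg[OF f] state_below_nonneg[OF g] by (simp add: ennreal_plus)
      also have "\<dots> \<le> ennreal (L ?f + L g + e)"
        using cut(2)[OF f e] by (intro ennreal_leI) simp
      also have "\<dots> = ennreal (L ?f + L g) + ennreal e"
        using state_below_nonneg[OF cf] state_below_nonneg[OF g] e by (subst ennreal_plus) auto
      also have "\<dots> \<le> lam V + ennreal e" by (intro add_right_mono le)
      finally show "ennreal (L g) + ennreal (L f) \<le> lam V + ennreal e" .
    qed
    ultimately show "ennreal (L f) + mu (V - U) \<le> lam V + ennreal e"
      by (metis add.commute add_left_mono order_trans)
  qed
  moreover have "mu (A \<inter> U) \<le> lam (V \<inter> U)" using U V by (intro mu_le) auto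
  moreover have "mu (A - U) \<le> mu (V - U)" using V by (intro mu_mono) auto
  ultimately show "mu (A \<inter> U) + mu (A - U) \<le> lam V" by (meson add_mono order_trans)
qed

text \<open>Caratheodory's theorem: the outer measure is countably additive on its measurable sets,
  and these form a sigma-algebra that contains the open sets by
  \<open>mu_split_open\<close>.\<close>

lemma measure_space_mu: "measure_space (topspace X) (sets (borel_of X)) mu"
proof -
  interpret sigma_algebra "topspace X" "Pow (topspace X)" by (rule sigma_algebra_Pow)
  have om: "outer_measure_space (Pow (topspace X)) mu"
    unfolding outer_measure_space_def positive_def increasing_def countably_subadditive_def
  proof (intro conjI allI impI ballI)
    have "mu {} \<le> lam {}" by (rule mu_le) auto
    also have "\<dots> \<le> 0" using lam_UN_finite[of "\<lambda>_. {}" 0] by simp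
    finally show "mu {} = 0" by simp
  qed (auto intro!: mu_mono mu_UN)
  have ms: "measure_space (topspace X) (lambda_system (topspace X) (Pow (topspace X)) mu) mu"
    by (rule caratheodory_lemma[OF om])
  have "subadditive (Pow (topspace X)) mu"
    using om by (intro countably_subadditive_subadditive) (auto simp: outer_measure_space_def)
  note subadd = subadditiveD[OF this]
  have "U \<in> lambda_system (topspace X) (Pow (topspace X)) mu" if U: "openin X U" for U
    unfolding lambda_system_eq
  proof (safe)
    fix A assume A: "A \<subseteq> topspace X"
    have "mu A \<le> mu (A \<inter> U) + mu (A - U)"
      using subadd[of "A \<inter> U" "A - U"] A by (auto simp: Int_Diff_Un)
    then show "mu (A \<inter> U) + mu (A - U) = mu A"
      using mu_split_open[OF U A] by (rule antisym[rotated])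
  qed (use openin_subset[OF U] in auto)
  then have sub: "sets (borel_of X) \<subseteq> lambda_system (topspace X) (Pow (topspace X)) mu"
    using ms unfolding sets_borel_of measure_space_def
    by (intro sigma_algebra.sigma_sets_subset) auto
  show "measure_space (topspace X) (sets (borel_of X)) mu"
    using ms sub sets.sigma_algebra_axioms[of "borel_of X"] unfolding measure_space_def
    by (auto simp: countably_additive_def positive_def)
qed

definition "state_measure = measure_of (topspace X) (sets (borel_of X)) mu"

lemma sets_state_measure: "sets state_measure = sets (borel_of X)"
  unfolding state_measure_def using sets.space_closed[of "borel_of X"]
  by (simp add: sets_measure_of sets.sigma_sets_eq[of "borel_of X", simplified])

lemma emeasure_state_measure: "A \<in> sets (borel_of X) \<Longrightarrow> emeasure state_measure A = mu A"
  unfolding state_measure_def using measure_space_mu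
  by (intro emeasure_measure_of_sigma) (auto simp: measure_space_def)

lemma space_state_measure: "space state_measure = topspace X"
  using sets_eq_imp_space_eq[OF sets_state_measure] by simp

lemma prob_space_state_measure: "prob_space state_measure"
  by (rule prob_spaceI)
    (simp add: space_state_measure emeasure_state_measure openin_borel_of mu_open lam_topspace)

text \<open>Inner approximation of \<open>A\<close> is outer approximation of its complement: the
  complement of an open set around it is closed, hence compact.\<close>

lemma regular_state_measure: "state_measure \<in> regular_probs X"
proof (rule regular_probsI[OF Hausdorff prob_space_state_measure sets_state_measure])
  interpret prob_space state_measure by (rule prob_space_state_measure)
  fix A assume A: "A \<in> sets state_measure"
  show "emeasure state_measure A \<le> (SUP K\<in>{K. compactin X K \<and> K \<subseteq> A}. emeasure state_measure K)"
  proof (rule ennreal_le_epsilon)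
    fix e :: real assume e: "0 < e"
    let ?B = "topspace X - A"
    have B: "?B \<in> sets state_measure" using A by (metis space_state_measure sets.compl_sets)
    obtain U where U: "openin X U" "?B \<subseteq> U" "lam U \<le> mu ?B + ennreal e"
      using mu_approx[of ?B e] e by auto
    let ?K = "topspace X - U"
    have Us: "U \<in> sets state_measure" using U by (simp add: sets_state_measure openin_borel_of)
    have K: "compactin X ?K" "?K \<subseteq> A"
      using U by (auto intro: closedin_compact_space[OF compact])
    have "emeasure state_measure U \<le> emeasure state_measure ?B + ennreal e"
      using U B Us by (simp add: emeasure_state_measure sets_state_measure mu_open)
    then have "measure state_measure U \<le> measure state_measure ?B + e"
      using e by (simp add: emeasure_eq_measure ennreal_plus[symmetric] del: ennreal_plus)
    then have "measure state_measure A \<le> measure state_measure ?K + e"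
      using prob_compl[OF A] prob_compl[OF Us] by (simp add: space_state_measure)
    then have "emeasure state_measure A \<le> emeasure state_measure ?K + ennreal e"
      using e by (simp add: emeasure_eq_measure ennreal_plus[symmetric] del: ennreal_plus)
    also have "emeasure state_measure ?K \<le> (SUP K\<in>{K. compactin X K \<and> K \<subseteq> A}. emeasure state_measure K)"
      using K by (intro SUP_upper) auto
    finally show "emeasure state_measure A
        \<le> (SUP K\<in>{K. compactin X K \<and> K \<subseteq> A}. emeasure state_measure K) + ennreal e"
      by simp
  qed
qed

text \<open>An invariant state need not be represented by its measure for the measure to be invariant:
  both sides agree on the open sets.\<close>

lemma state_measure_invariant:
  assumes p: "continuous_map X X p" and q: "continuous_map X X q"
    and pq: "\<And>x. x \<in> topspace X \<Longrightarrow> p (q x) = x" "\<And>x. x \<in> topspace X \<Longrightarrow> q (p x) = x"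
    and inv: "\<And>f. f \<in> cfun X \<Longrightarrow> L (\<lambda>x. f (p x)) = L f"
  shows "distr state_measure (borel_of X) p = state_measure"
proof -
  have p_top: "p x \<in> topspace X" "q x \<in> topspace X" if "x \<in> topspace X" for x
    using p q that by (auto simp: continuous_map_def)
  have pm: "p \<in> measurable state_measure (borel_of X)"
    using continuous_map_measurable[OF p] by (simp add: regular_probsD(4)[OF regular_state_measure])
  have invq: "L (\<lambda>x. f (q x)) = L f" if f: "f \<in> cfun X" for f
  proof -
    have "L (\<lambda>x. f (q x)) = L (\<lambda>x. f (q (p x)))" using inv[OF cfun_compose[OF q f]] by simp
    also have "\<dots> = L f"
      using f cfun_compose[OF p cfun_compose[OF q f]] by (intro state_cong[OF L]) (auto simp: pq)
    finally show ?thesis .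
  qed
  \<comment> \<open>Composition with \<open>q\<close> and with \<open>p\<close> exchanges the test
    functions of the two open sets and leaves their values under \<open>L\<close> unchanged.\<close>
  have lam_p: "lam {x \<in> topspace X. p x \<in> U} = lam U" if U: "openin X U" for U
  proof (rule antisym; rule lam_le)
    fix f assume f: "f \<in> below {x \<in> topspace X. p x \<in> U}"
    have "(\<lambda>x. f (q x)) \<in> below U"
      using f cfun_compose[OF q below_cfun[OF f]] p_top
      by (auto simp: cfun_below_def pq)
    from lam_ge[OF this] show "ennreal (L f) \<le> lam U" by (simp add: invq below_cfun[OF f])
  next
    fix f assume f: "f \<in> below U"
    have "(\<lambda>x. f (p x)) \<in> below {x \<in> topspace X. p x \<in> U}"
      using f cfun_compose[OF p below_cfun[OF f]] p_top
      by (auto simp: cfun_below_def)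
    from lam_ge[OF this] show "ennreal (L f) \<le> lam {x \<in> topspace X. p x \<in> U}"
      by (simp add: inv below_cfun[OF f])
  qed
  show ?thesis
  proof (rule measure_eqI_generator_eq[where E = "{U. openin X U}" and \<Omega> = "topspace X"
        and A = "\<lambda>_. topspace X"])
    show "Int_stable {U. openin X U}" by (auto simp: Int_stable_def)
    fix U assume "U \<in> {U. openin X U}"
    then have U: "openin X U" by simp
    have pU: "openin X {x \<in> topspace X. p x \<in> U}" using p U by (simp add: continuous_map_def)
    have "emeasure (distr state_measure (borel_of X) p) U = emeasure state_measure {x \<in> topspace X. p x \<in> U}"
      using pm U by (subst emeasure_distr)
        (auto simp: openin_borel_of space_state_measure intro!: arg_cong[of _ _ "emeasure _"])
    also have "\<dots> = lam U" using pU by (simp add: emeasure_state_measure openin_borel_of mu_open lam_p[OF U])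
    also have "\<dots> = emeasure state_measure U"
      using U by (simp add: emeasure_state_measure openin_borel_of mu_open)
    finally show "emeasure (distr state_measure (borel_of X) p) U = emeasure state_measure U" .
  next
    interpret D: prob_space "distr state_measure (borel_of X) p"
      by (rule prob_space.prob_space_distr[OF prob_space_state_measure pm])
    show "emeasure (distr state_measure (borel_of X) p) (topspace X) \<noteq> \<infinity>" for i :: nat by simp
  qed (auto simp: sets_borel_of sets_state_measure dest: openin_subset)
qed

end

section \<open>The flow of states\<close>

text \<open>The inverse element undoes each translation, which makes it bijective;
  \<open>ext\<close> is there because the members of \<open>BijGroup\<close> are
  extensional.\<close>

lemma (in topological_group) flowI:
  assumes X: "compact_space X" "Hausdorff_space X" "topspace X \<noteq> {}"
    and ext: "\<And>t. t \<in> carrier G \<Longrightarrow> \<phi> t \<in> extensional (topspace X)"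
    and cl: "\<And>t x. t \<in> carrier G \<Longrightarrow> x \<in> topspace X \<Longrightarrow> \<phi> t x \<in> topspace X"
    and one: "\<And>x. x \<in> topspace X \<Longrightarrow> \<phi> \<one> x = x"
    and mul: "\<And>s t x. s \<in> carrier G \<Longrightarrow> t \<in> carrier G \<Longrightarrow> x \<in> topspace X \<Longrightarrow>
      \<phi> (s \<otimes> t) x = \<phi> s (\<phi> t x)"
    and cont: "continuous_map (prod_topology T X) X (\<lambda>(t, x). \<phi> t x)"
  shows "flow G T X \<phi>"
proof -
  have bij: "\<phi> t \<in> Bij (topspace X)" if t: "t \<in> carrier G" for t
  proof -
    have "bij_betw (\<phi> t) (topspace X) (topspace X)"
      by (rule bij_betw_byWitness[of _ "\<phi> (inv t)"])
        (use t cl one in \<open>auto simp: mul[symmetric]\<close>)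
    then show ?thesis using ext[OF t] by (simp add: Bij_def)
  qed
  have hom: "\<phi> \<in> hom G (BijGroup (topspace X))"
  proof (rule homI)
    fix t assume "t \<in> carrier G" then show "\<phi> t \<in> carrier (BijGroup (topspace X))"
      by (simp add: BijGroup_def bij)
  next
    fix s t assume st: "s \<in> carrier G" "t \<in> carrier G"
    have "\<phi> (s \<otimes> t) = compose (topspace X) (\<phi> s) (\<phi> t)"
      by (rule extensionalityI[OF ext compose_extensional])
        (use st in \<open>auto simp: compose_def mul\<close>)
    then show "\<phi> (s \<otimes> t) = \<phi> s \<otimes>\<^bsub>BijGroup (topspace X)\<^esub> \<phi> t"
      using st by (simp add: BijGroup_def bij)
  qed
  show ?thesis
    using X hom cont
    by (intro flow.intro flow_axioms.intro topological_group_axioms group_action.intro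
        group_hom.intro group_hom_axioms.intro group_BijGroup is_group) auto
qed

section \<open>Push-forward of states and continuity of the induced action\<close>

definition push_state ::
    "'y topology \<Rightarrow> ('x \<Rightarrow> 'y) \<Rightarrow> (('x \<Rightarrow> real) \<Rightarrow> real) \<Rightarrow> ('y \<Rightarrow> real) \<Rightarrow> real" where
  "push_state Y p L = (\<lambda>f\<in>cfun Y. L (\<lambda>x. f (p x)))"

lemma push_state_apply: "f \<in> cfun Y \<Longrightarrow> push_state Y p L f = L (\<lambda>x. f (p x))"
  by (simp add: push_state_def)

lemma push_state_closed:
  assumes p: "continuous_map X Y p" and L: "L \<in> states X"
  shows "push_state Y p L \<in> states Y"
proof (rule statesI)
  have pY: "p x \<in> topspace Y" if "x \<in> topspace X" for x
    using p that by (auto simp: continuous_map_def)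
  note c = cfun_compose[OF p]
  show "push_state Y p L \<in> extensional (cfun Y)" by (simp add: push_state_def)
  show "push_state Y p L (\<lambda>_. 1) = 1" by (simp add: push_state_apply state_one[OF L])
  show "push_state Y p L (\<lambda>x. f x + g x) = push_state Y p L f + push_state Y p L g"
    if "f \<in> cfun Y" "g \<in> cfun Y" for f g
    using that by (simp add: push_state_apply cfun_add state_add[OF L] c)
  show "push_state Y p L (\<lambda>x. k * f x) = k * push_state Y p L f" if "f \<in> cfun Y" for f k
    using that by (simp add: push_state_apply cfun_mult state_cmult[OF L] c)
  show "0 \<le> push_state Y p L f" if "f \<in> cfun Y" "\<And>y. y \<in> topspace Y \<Longrightarrow> 0 \<le> f y" for f
    using that pY by (simp add: push_state_apply) (intro state_nonneg[OF L] c, auto)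
qed

definition point_state :: "'x topology \<Rightarrow> 'x \<Rightarrow> ('x \<Rightarrow> real) \<Rightarrow> real" where
  "point_state X x = (\<lambda>f\<in>cfun X. f x)"

lemma point_state_closed: "x \<in> topspace X \<Longrightarrow> point_state X x \<in> states X"
  by (rule statesI) (auto simp: point_state_def cfun_add cfun_mult)

definition state_action ::
    "'x topology \<Rightarrow> ('g \<Rightarrow> 'x \<Rightarrow> 'x) \<Rightarrow> 'g \<Rightarrow> (('x \<Rightarrow> real) \<Rightarrow> real) \<Rightarrow> ('x \<Rightarrow> real) \<Rightarrow> real" where
  "state_action X \<phi> t = (\<lambda>L\<in>states X. push_state X (\<phi> t) L)"

lemma state_action_apply:
  "L \<in> states X \<Longrightarrow> f \<in> cfun X \<Longrightarrow> state_action X \<phi> t L f = L (\<lambda>x. f (\<phi> t x))"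
  by (simp add: state_action_def push_state_apply)

context flow
begin

lemma cfun_translate: "f \<in> cfun X \<Longrightarrow> t \<in> carrier G \<Longrightarrow> (\<lambda>x. f (\<phi> t x)) \<in> cfun X"
  by (intro cfun_compose[OF continuous_translate])

lemma state_action_closed:
  "L \<in> states X \<Longrightarrow> t \<in> carrier G \<Longrightarrow> state_action X \<phi> t L \<in> states X"
  by (simp add: state_action_def push_state_closed[OF continuous_translate])

lemma one_action: "x \<in> topspace X \<Longrightarrow> \<phi> \<one> x = x"
  by (simp add: id_eq_one[symmetric])

text \<open>The point is uniformity in the phase space: for \<open>t\<close> near \<open>t0\<close>
  the translates of \<open>f\<close> by \<open>t\<close> and \<open>t0\<close> differ by at most
  \<open>e / 2\<close> everywhere. The pairs where this fails lie in a closed set \<open>D\<close>,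
  and its projection to \<open>T\<close> is closed because \<open>X\<close> is compact. The other
  half of \<open>e\<close> pays for moving the state.\<close>

lemma continuous_state_action:
  "continuous_map (prod_topology T (state_topology X)) (state_topology X)
     (\<lambda>(t, L). state_action X \<phi> t L)"
proof (rule continuous_map_state_topologyI)
  let ?P = "prod_topology T (state_topology X)"
  fix f assume f: "f \<in> cfun X"
  have "continuous_map ?P Met_TC.mtopology (\<lambda>(t, L). state_action X \<phi> t L f)"
    unfolding Met_TC.continuous_map_to_metric
  proof (intro ballI allI impI)
    fix tL and e :: real assume tL: "tL \<in> topspace ?P" and e: "0 < e"
    obtain t0 L0 where eq: "tL = (t0, L0)" by (cases tL)
    have t0: "t0 \<in> carrier G" and L0: "L0 \<in> states X"
      using tL by (auto simp: eq topspace_group)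
    define g where "g = (\<lambda>x. f (\<phi> t0 x))"
    have g: "g \<in> cfun X" using cfun_translate[OF f t0] by (simp add: g_def)
    define D where "D = {z \<in> topspace (prod_topology T X). e / 2 \<le> \<bar>f (\<phi> (fst z) (snd z)) - g (snd z)\<bar>}"
    have c: "(\<lambda>z. \<bar>f (\<phi> (fst z) (snd z)) - g (snd z)\<bar>) \<in> cfun (prod_topology T X)"
    proof -
      have "(\<lambda>z. f (\<phi> (fst z) (snd z))) \<in> cfun (prod_topology T X)"
        using cfun_compose[OF continuous_action f] by (simp add: case_prod_unfold)
      moreover have "(\<lambda>z. g (snd z)) \<in> cfun (prod_topology T X)"
        by (rule cfun_compose[OF continuous_map_snd g])
      ultimately show ?thesis
        by (simp add: cfun_def continuous_map_real_abs continuous_map_diff)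
    qed
    have "closedin (prod_topology T X) D"
      unfolding D_def by (rule closedin_cfun_le[OF cfun_const c])
    then have "closedin T (fst ` D)"
      using closed_map_fst[OF compact_phase, of T] unfolding closed_map_def by blast
    then have U: "openin T (topspace T - fst ` D)" by blast
    have near: "\<bar>f (\<phi> t x) - g x\<bar> \<le> e / 2" if "t \<in> topspace T - fst ` D" "x \<in> topspace X" for t x
    proof (rule ccontr)
      assume "\<not> ?thesis"
      then have "(t, x) \<in> D" using that by (simp add: D_def)
      then have "fst (t, x) \<in> fst ` D" by (rule imageI)
      then show False using that by simp
    qed
    define V where "V = {L \<in> topspace (state_topology X). L g \<in> {L0 g - e / 2<..<L0 g + e / 2}}"
    have V: "openin (state_topology X) V"
      unfolding V_def by (rule openin_continuous_map_preimage[OF cfunD[OF cfun_eval[OF g]]]) simp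
    have "t0 \<in> topspace T - fst ` D"
      using t0 e by (auto simp: topspace_group D_def g_def)
    then have mem: "tL \<in> (topspace T - fst ` D) \<times> V" using e L0 by (simp add: eq V_def)
    have "(case z of (t, L) \<Rightarrow> state_action X \<phi> t L f) \<in>
        Met_TC.mball (case tL of (t, L) \<Rightarrow> state_action X \<phi> t L f) e"
      if z: "z \<in> (topspace T - fst ` D) \<times> V" for z
    proof -
      obtain t L where zt: "z = (t, L)" by (cases z)
      have t: "t \<in> carrier G" "t \<in> topspace T - fst ` D" and L: "L \<in> states X"
        using z by (auto simp: zt topspace_group V_def)
      have Lg: "\<bar>L g - L0 g\<bar> < e / 2"
        using z unfolding zt V_def abs_diff_less_iff by simp
      have "\<bar>L (\<lambda>x. f (\<phi> t x)) - L g\<bar> \<le> e / 2"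
        using state_abs[OF L cfun_diff[OF cfun_translate[OF f t(1)] g] near[OF t(2)]]
          state_diff[OF L cfun_translate[OF f t(1)] g] by simp
      then have "\<bar>L0 g - L (\<lambda>x. f (\<phi> t x))\<bar> < e" using Lg by linarith
      then show ?thesis
        using t t0 f L L0 by (simp add: zt eq state_action_apply g_def dist_real_def)
    qed
    then show "\<exists>U. openin ?P U \<and> tL \<in> U \<and>
        (\<forall>y\<in>U. (case y of (t, L) \<Rightarrow> state_action X \<phi> t L f) \<in>
          Met_TC.mball (case tL of (t, L) \<Rightarrow> state_action X \<phi> t L f) e)"
      using mem U V by (intro exI[of _ "(topspace T - fst ` D) \<times> V"]) (simp add: openin_prod_Times_iff)
  qed
  then show "continuous_map ?P euclideanreal (\<lambda>z. (case z of (t, L) \<Rightarrow> state_action X \<phi> t L) f)"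
    by (simp add: case_prod_unfold)
qed (auto simp: topspace_group state_action_closed)

lemma state_flow: "flow G T (state_topology X) (state_action X \<phi>)"
proof (rule flowI)
  show "topspace (state_topology X) \<noteq> {}"
    using nonempty_phase point_state_closed by fastforce
  fix L assume "L \<in> topspace (state_topology X)"
  then have L: "L \<in> states X" by simp
  show "state_action X \<phi> \<one> L = L"
    by (rule state_eqI[OF state_action_closed L])
      (use L cfun_translate in \<open>auto simp: state_action_apply one_action intro!: state_cong[OF L]\<close>)
  fix s t assume st: "s \<in> carrier G" "t \<in> carrier G"
  show "state_action X \<phi> (s \<otimes> t) L = state_action X \<phi> s (state_action X \<phi> t L)"
  proof (rule state_eqI)
    fix f assume f: "f \<in> cfun X"
    have "L (\<lambda>x. f (\<phi> (s \<otimes> t) x)) = L (\<lambda>x. f (\<phi> s (\<phi> t x)))"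
      using st f cfun_translate[OF cfun_translate[OF f st(1)] st(2)] composition_rule
      by (intro state_cong[OF L] cfun_translate) auto
    then show "state_action X \<phi> (s \<otimes> t) L f = state_action X \<phi> s (state_action X \<phi> t L) f"
      using L f st by (simp add: state_action_apply state_action_closed cfun_translate)
  qed (use L st in \<open>auto intro: state_action_closed\<close>)
qed (auto simp: state_action_closed compact_state_topology[OF compact_phase]
    Hausdorff_state_topology continuous_state_action, auto simp: state_action_def)

lemma subflow:
  assumes W: "closedin X W" "W \<noteq> {}"
    and inv: "\<And>t w. t \<in> carrier G \<Longrightarrow> w \<in> W \<Longrightarrow> \<phi> t w \<in> W"
  shows "flow G T (subtopology X W) (\<lambda>t. \<lambda>w\<in>W. \<phi> t w)"
proof -
  have top: "topspace (subtopology X W) = W" using closedin_subset[OF W(1)] by auto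
  show ?thesis
    using transport_flow(1)[of "subtopology X W" "\<lambda>x. x" "\<lambda>x. x"] W inv
      closedin_compact_space[OF compact_phase W(1)]
    unfolding top by (auto simp: compact_space_subtopology Hausdorff_space_subtopology
        Hausdorff_phase continuous_map_from_subtopology top)
qed

lemma mem_orbit: "x \<in> topspace X \<Longrightarrow> x \<in> orbit G \<phi> x"
  using one_action[of x] one_closed unfolding orbit_def by force

lemma orbit_closure_minimal:
  assumes W: "closedin X W" and inv: "\<And>t w. t \<in> carrier G \<Longrightarrow> w \<in> W \<Longrightarrow> \<phi> t w \<in> W"
    and w: "w \<in> W"
  shows "X closure_of orbit G \<phi> w \<subseteq> W"
  by (rule closure_of_minimal[OF _ W]) (use inv w in \<open>auto simp: orbit_def\<close>)

lemma invariant_measure_of_state: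
  assumes L: "L \<in> states X" and inv: "\<And>t. t \<in> carrier G \<Longrightarrow> state_action X \<phi> t L = L"
  shows "\<exists>\<mu>\<in>regular_probs X. \<forall>t\<in>carrier G. push_action X \<phi> t \<mu> = \<mu>"
proof -
  interpret compact_state X L
    by unfold_locales (use L compact_phase Hausdorff_phase in auto)
  have "distr state_measure (borel_of X) (\<phi> t) = state_measure" if t: "t \<in> carrier G" for t
  proof (rule state_measure_invariant[where q = "\<phi> (inv t)"])
    show "\<phi> t (\<phi> (inv t) x) = x" "\<phi> (inv t) (\<phi> t x) = x" if x: "x \<in> topspace X" for x
      using composition_rule[OF x t inv_closed[OF t]] composition_rule[OF x inv_closed[OF t] t]
        one_action[OF x] t by simp_all
    show "L (\<lambda>x. f (\<phi> t x)) = L f" if "f \<in> cfun X" for f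
      using state_action_apply[OF L that, of \<phi> t] inv[OF t] by simp
  qed (use t in \<open>auto intro: continuous_translate\<close>)
  then show ?thesis
    using regular_state_measure by (intro bexI[of _ state_measure]) (simp_all add: push_action_def)
qed

end

section \<open>Irreducible sets of states\<close>

text \<open>Zorn's lemma for reverse inclusion: a finite nonempty part of a chain contains its own
  intersection, so compactness makes the intersection of the chain nonempty. The form serves both
  closed faces and admissible sets.\<close>

lemma minimal_closed_set:
  assumes S: "compact_space S" and ne: "\<Q> \<noteq> {}"
    and cl: "\<And>Q. Q \<in> \<Q> \<Longrightarrow> closedin S Q" "\<And>Q. Q \<in> \<Q> \<Longrightarrow> Q \<noteq> {}"
    and inter: "\<And>C. C \<subseteq> \<Q> \<Longrightarrow> C \<noteq> {} \<Longrightarrow> \<Inter>C \<noteq> {} \<Longrightarrow> \<Inter>C \<in> \<Q>"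
  obtains M where "M \<in> \<Q>" "\<And>Q. Q \<in> \<Q> \<Longrightarrow> Q \<subseteq> M \<Longrightarrow> Q = M"
proof -
  have "\<exists>M\<in>\<Q>. \<forall>Q\<in>\<Q>. Q \<subseteq> M \<longrightarrow> Q = M"
  proof (rule predicate_Zorn[where P = "\<lambda>A B. B \<subseteq> A"])
    show "partial_order_on \<Q> (relation_of (\<lambda>A B. B \<subseteq> A) \<Q>)"
      by (rule partial_order_on_relation_ofI) auto
    fix C assume C: "C \<in> Chains (relation_of (\<lambda>A B. B \<subseteq> A) \<Q>)"
    have CQ: "C \<subseteq> \<Q>" using C unfolding Chains_def relation_of_def by auto
    have chain: "A \<subseteq> B \<or> B \<subseteq> A" if "A \<in> C" "B \<in> C" for A B
      using C that unfolding Chains_def relation_of_def by auto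
    have fin: "\<Inter>\<F> \<in> \<F>" if "finite \<F>" "\<F> \<noteq> {}" "\<F> \<subseteq> C" for \<F>
      using that
    proof (induction \<F> rule: finite_ne_induct)
      case (insert A \<F>)
      then have "\<Inter>\<F> \<in> \<F>" "A \<in> C" "\<Inter>\<F> \<in> C" by auto
      then show ?case using chain[of A "\<Inter>\<F>"] by (auto simp: Int_absorb1 Int_absorb2)
    qed simp
    show "\<exists>u\<in>\<Q>. \<forall>A\<in>C. u \<subseteq> A"
    proof (cases "C = {}")
      case True
      then show ?thesis using ne by blast
    next
      case False
      have "\<Inter>\<F> \<noteq> {}" if F: "finite \<F>" "\<F> \<subseteq> C" for \<F>
      proof (cases "\<F> = {}")
        case False
        then have "\<Inter>\<F> \<in> \<Q>" using fin[OF F(1) False F(2)] F(2) CQ by blast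
        then show ?thesis by (rule cl(2))
      qed simp
      then have "\<Inter>C \<noteq> {}"
        using cl(1) CQ by (intro S[unfolded compact_space_fip, rule_format]) auto
      then have "\<Inter>C \<in> \<Q>" using inter CQ False by simp
      then show ?thesis by blast
    qed
  qed
  then show ?thesis using that by blast
qed

text \<open>The Krein-Milman argument: on a minimal closed face every evaluation is constant, since
  the points where it is largest form a closed face again. States with the same evaluations are
  equal, so the face is a single point. Faces are tested on midpoints to match
  \<open>extreme_state\<close>.\<close>

lemma extreme_state_exists:
  assumes Y: "compact_space Y" and Q: "closedin (state_topology Y) Q" "Q \<noteq> {}"
  obtains x where "extreme_state Y Q x"
proof -
  define face where "face F \<longleftrightarrow> closedin (state_topology Y) F \<and> F \<noteq> {} \<and> F \<subseteq> Q \<and>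
    (\<forall>x\<in>F. \<forall>a\<in>Q. \<forall>b\<in>Q. (\<forall>f\<in>cfun Y. 2 * x f = a f + b f) \<longrightarrow> a \<in> F)" for F
  have "face Q" using Q by (simp add: face_def)
  then obtain F where F: "face F" and min: "\<And>F'. face F' \<Longrightarrow> F' \<subseteq> F \<Longrightarrow> F' = F"
  proof (rule_tac minimal_closed_set[OF compact_state_topology[OF Y], of "Collect face"])
    fix C assume C: "C \<subseteq> Collect face" "C \<noteq> {}" "\<Inter>C \<noteq> {}"
    then obtain F where F: "F \<in> C" "face F" by blast
    have "closedin (state_topology Y) (\<Inter>C)"
      using C by (intro closedin_Inter) (auto simp: face_def)
    moreover have "\<Inter>C \<subseteq> Q" using F unfolding face_def by blast
    moreover have "a \<in> \<Inter>C" if xab: "x \<in> \<Inter>C" "a \<in> Q" "b \<in> Q" "\<forall>f\<in>cfun Y. 2 * x f = a f + b f" for x a b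
    proof
      fix F assume "F \<in> C"
      then have "face F" "x \<in> F" using C(1) xab(1) by auto
      then show "a \<in> F" using xab(2-4) unfolding face_def by blast
    qed
    ultimately show "\<Inter>C \<in> Collect face"
      using C(3) unfolding face_def by blast
  qed (auto simp: face_def)
  have FQ: "F \<subseteq> Q" "F \<noteq> {}" "closedin (state_topology Y) F"
    and mid: "\<And>x a b. x \<in> F \<Longrightarrow> a \<in> Q \<Longrightarrow> b \<in> Q \<Longrightarrow> (\<And>f. f \<in> cfun Y \<Longrightarrow> 2 * x f = a f + b f) \<Longrightarrow> a \<in> F"
    using F unfolding face_def by blast+
  have FY: "F \<subseteq> states Y" using closedin_subset[OF FQ(3)] by simp
  have const: "p f = q f" if pq: "p \<in> F" "q \<in> F" and f: "f \<in> cfun Y" for p q f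
  proof -
    have "compact_space (subtopology (state_topology Y) F)" "topspace (subtopology (state_topology Y) F) = F"
      using closedin_compact_space[OF compact_state_topology[OF Y] FQ(3)] FY
      by (auto simp: compact_space_subtopology)
    then obtain w where w: "w \<in> F" "\<And>v. v \<in> F \<Longrightarrow> v f \<le> w f"
      using cfun_attains_max[of "subtopology (state_topology Y) F" "\<lambda>L. L f"] f FQ(2)
      by (auto simp: cfun_subtopology)
    define F' where "F' = F \<inter> {v \<in> topspace (state_topology Y). w f \<le> v f}"
    have "face F'"
      unfolding face_def
    proof (intro conjI ballI impI)
      show "closedin (state_topology Y) F'"
        unfolding F'_def using f by (intro closedin_Int FQ closedin_cfun_le cfun_const cfun_eval)
      show "F' \<noteq> {}" "F' \<subseteq> Q" using w FY FQ by (auto simp: F'_def)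
      fix x a b assume x: "x \<in> F'" and ab: "a \<in> Q" "b \<in> Q"
        and eq: "\<forall>f\<in>cfun Y. 2 * x f = a f + b f"
      have "a \<in> F" "b \<in> F"
        using mid[of x a b] mid[of x b a] x ab eq by (auto simp: F'_def)
      moreover have "w f \<le> x f" using x by (simp add: F'_def)
      \<comment> \<open>Here \<open>2 * w f \<le> a f + b f\<close> while
        \<open>b f \<le> w f\<close>, so \<open>a\<close> attains the maximum as well.\<close>
      ultimately have "w f \<le> a f" using w(2)[of b] eq f by fastforce
      then show "a \<in> F'" using \<open>a \<in> F\<close> FY by (auto simp: F'_def)
    qed
    then have "F' = F" by (rule min) (simp add: F'_def)
    then have "w f \<le> p f" "w f \<le> q f" using pq by (auto simp: F'_def)
    then show ?thesis using w(2) pq by (meson order_antisym order_trans)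
  qed
  obtain x where x: "x \<in> F" using FQ by blast
  have "a = x" if "a \<in> F" for a
    using const[OF that x] that x FY by (intro state_eqI[of _ Y]) auto
  then have "extreme_state Y Q x"
    unfolding extreme_state_def using mid[OF x] x FQ by blast
  then show ?thesis by (rule that)
qed

definition (in flow) admissible :: "(('x \<Rightarrow> real) \<Rightarrow> real) set \<Rightarrow> bool" where
  "admissible Q \<longleftrightarrow> closedin (state_topology X) Q \<and> Q \<noteq> {} \<and> half_space_closed X Q \<and>
     (\<forall>t\<in>carrier G. \<forall>q\<in>Q. state_action X \<phi> t q \<in> Q)"

lemma (in flow) minimal_admissible_exists:
  obtains Q where "admissible Q" "\<And>Q'. admissible Q' \<Longrightarrow> Q' \<subseteq> Q \<Longrightarrow> Q' = Q"
proof (rule minimal_closed_set[OF compact_state_topology[OF compact_phase], of "Collect admissible"])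
  have "states X \<noteq> {}" using nonempty_phase point_state_closed by fastforce
  moreover have "closedin (state_topology X) (states X)"
    using closedin_topspace[of "state_topology X"] by simp
  ultimately have "admissible (states X)"
    unfolding admissible_def half_space_closed_def using state_action_closed by blast
  then show "Collect admissible \<noteq> {}" by blast
  fix C assume C: "C \<subseteq> Collect admissible" "C \<noteq> {}" "\<Inter>C \<noteq> {}"
  have adm: "admissible Q" if "Q \<in> C" for Q using C(1) that by blast
  obtain Q where Q: "Q \<in> C" using C(2) by blast
  have "closedin (state_topology X) (\<Inter>C)"
    using C(2) adm by (intro closedin_Inter) (auto simp: admissible_def)
  moreover have "half_space_closed X (\<Inter>C)"
    unfolding half_space_closed_def
  proof (intro conjI ballI impI InterI)
    show "\<Inter>C \<subseteq> states X" using adm[OF Q] Q unfolding admissible_def half_space_closed_def by blast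
    fix s Q assume s: "s \<in> states X" "\<forall>f\<in>cfun X. \<exists>q\<in>\<Inter>C. s f \<le> q f" and Q: "Q \<in> C"
    then have "\<forall>f\<in>cfun X. \<exists>q\<in>Q. s f \<le> q f" by blast
    then show "s \<in> Q" using adm[OF Q] s(1) unfolding admissible_def half_space_closed_def by blast
  qed
  moreover have "state_action X \<phi> t q \<in> \<Inter>C" if "t \<in> carrier G" "q \<in> \<Inter>C" for t q
  proof
    fix Q assume "Q \<in> C"
    then show "state_action X \<phi> t q \<in> Q" using adm that unfolding admissible_def by blast
  qed
  ultimately show "\<Inter>C \<in> Collect admissible" using C(3) unfolding admissible_def by blast
qed (auto simp: admissible_def)

text \<open>The set \<open>Q\<close> is an irreducible affine flow: it has no proper subset that is
  again an affine flow. The strongly proximal flow is found as the orbit closure of its extreme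
  point \<open>x\<close>.\<close>

locale irreducible_flow = flow G T X \<phi>
  for G (structure) and T :: "'g topology" and X :: "'x topology" and \<phi> :: "'g \<Rightarrow> 'x \<Rightarrow> 'x" +
  fixes Q :: "(('x \<Rightarrow> real) \<Rightarrow> real) set" and x
  assumes admissible: "admissible Q"
    and minimal: "admissible Q' \<Longrightarrow> Q' \<subseteq> Q \<Longrightarrow> Q' = Q"
    and extreme: "extreme_state X Q x"
begin

sublocale SF: flow G T "state_topology X" "state_action X \<phi>"
  by (rule state_flow)

lemma Q_closed: "closedin (state_topology X) Q"
  and Q_half_space: "half_space_closed X Q"
  and Q_invariant: "t \<in> carrier G \<Longrightarrow> q \<in> Q \<Longrightarrow> state_action X \<phi> t q \<in> Q"
  using admissible by (auto simp: admissible_def)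

lemma Q_states: "q \<in> Q \<Longrightarrow> q \<in> states X"
  using closedin_subset[OF Q_closed] by auto

lemma x_mem: "x \<in> Q"
  using extreme by (simp add: extreme_state_def)

lemma orbit_closure_subset: "q \<in> Q \<Longrightarrow> state_topology X closure_of orbit G (state_action X \<phi>) q \<subseteq> Q"
  by (rule SF.orbit_closure_minimal[OF Q_closed Q_invariant])

lemma extreme_mem_orbit_closure:
  assumes q: "q \<in> Q"
  shows "x \<in> state_topology X closure_of orbit G (state_action X \<phi>) q"
proof -
  define W where "W = state_topology X closure_of orbit G (state_action X \<phi>) q"
  have W: "closedin (state_topology X) W" and WQ: "W \<subseteq> Q"
    using orbit_closure_subset[OF q] by (simp_all add: W_def)
  have WX: "w \<in> states X" if "w \<in> W" for w using that WQ Q_states by blast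
  have inv: "state_action X \<phi> t w \<in> W" if "t \<in> carrier G" "w \<in> W" for t w
    using SF.orbit_closure_invariant[of q t w] q Q_states that by (simp add: W_def)
  have qW: "q \<in> W"
    using closure_of_subset[OF SF.orbit_subset, of q] SF.mem_orbit[of q] Q_states[OF q] by (auto simp: W_def)
  \<comment> \<open>This is the closed convex hull of \<open>W\<close>, as the intersection of the
    half-spaces that contain \<open>W\<close>.\<close>
  define H where "H = {s \<in> states X. \<forall>f\<in>cfun X. \<exists>w\<in>W. s f \<le> w f}"
  have "admissible H"
    unfolding admissible_def half_space_closed_def
  proof (intro conjI ballI impI)
    have tW: "topspace (subtopology (state_topology X) W) = W"
      using closedin_subset[OF W] by auto
    have cW: "compact_space (subtopology (state_topology X) W)"
      using closedin_compact_space[OF SF.compact_phase W] by (simp add: compact_space_subtopology)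
    have "\<exists>m\<in>W. \<forall>w\<in>W. w f \<le> m f" if "f \<in> cfun X" for f
      using cfun_attains_max[OF cW, of "\<lambda>L. L f"] that qW unfolding tW
      by (metis cfun_eval cfun_subtopology empty_iff)
    \<comment> \<open>Choosing for each \<open>f\<close> a point of \<open>W\<close> where the
      evaluation is largest turns the existential condition in \<open>H\<close> into a closed
      inequality.\<close>
    then obtain m where m: "\<And>f. f \<in> cfun X \<Longrightarrow> m f \<in> W" "\<And>f w. f \<in> cfun X \<Longrightarrow> w \<in> W \<Longrightarrow> w f \<le> m f f"
      by metis
    have "H = (\<Inter>f\<in>cfun X. {s \<in> topspace (state_topology X). s f \<le> m f f})"
    proof (intro equalityI subsetI)
      fix s assume s: "s \<in> (\<Inter>f\<in>cfun X. {s \<in> topspace (state_topology X). s f \<le> m f f})"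
      from INT_D[OF s cfun_const[of 0]] have "s \<in> states X" by simp
      then show "s \<in> H" using s m(1) by (auto simp: H_def)
    next
      fix s assume "s \<in> H"
      then show "s \<in> (\<Inter>f\<in>cfun X. {s \<in> topspace (state_topology X). s f \<le> m f f})"
        using m(2) unfolding H_def by (fastforce intro: order_trans)
    qed
    also have "closedin (state_topology X) \<dots>"
      by (intro closedin_INT closedin_cfun_le cfun_const cfun_eval) (use cfun_const in blast)
    finally show "closedin (state_topology X) H" .
    show "H \<noteq> {}" using qW WX by (auto simp: H_def)
    show "H \<subseteq> states X" by (auto simp: H_def)
    show "s \<in> H" if s: "s \<in> states X" "\<forall>f\<in>cfun X. \<exists>q\<in>H. s f \<le> q f" for s
    proof -
      have "\<exists>w\<in>W. s f \<le> w f" if f: "f \<in> cfun X" for f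
      proof -
        obtain q where q: "q \<in> H" "s f \<le> q f" using s(2) f by blast
        then obtain w where "w \<in> W" "q f \<le> w f" using f by (auto simp: H_def)
        then show ?thesis using q(2) by (intro bexI[of _ w]) auto
      qed
      then show ?thesis using s(1) by (simp add: H_def)
    qed
    fix t s assume t: "t \<in> carrier G" and s: "s \<in> H"
    have sX: "s \<in> states X" using s by (simp add: H_def)
    have "\<exists>w\<in>W. state_action X \<phi> t s f \<le> w f" if f: "f \<in> cfun X" for f
    proof -
      \<comment> \<open>The condition on the translated state at \<open>f\<close> is the condition
        on \<open>s\<close> at the translated function.\<close>
      obtain w where w: "w \<in> W" "s (\<lambda>x. f (\<phi> t x)) \<le> w (\<lambda>x. f (\<phi> t x))"
        using s cfun_translate[OF f t] by (auto simp: H_def)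
      then have "state_action X \<phi> t s f \<le> state_action X \<phi> t w f"
        using f sX WX[OF w(1)] by (simp add: state_action_apply)
      then show ?thesis using inv[OF t w(1)] by blast
    qed
    then show "state_action X \<phi> t s \<in> H" using state_action_closed[OF sX t] by (simp add: H_def)
  qed
  moreover have "H \<subseteq> Q"
    using Q_half_space WQ unfolding H_def half_space_closed_def by blast
  ultimately have "H = Q" by (rule minimal)
  then have "x \<in> H" using x_mem by simp
  then obtain \<nu> where "\<nu> \<in> states (subtopology (state_topology X) W)"
    "\<And>f. f \<in> cfun X \<Longrightarrow> \<nu> (\<lambda>L. L f) = x f"
    using state_representation[OF compact_phase W, of x] unfolding H_def by blast
  then interpret extreme_barycenter X Q W x \<nu>
    by unfold_locales (use compact_phase Q_half_space extreme W WQ in auto)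
  show ?thesis using extreme_mem by (simp add: W_def)
qed

section \<open>The orbit closure of the extreme state as a minimal flow\<close>

definition "Z = state_topology X closure_of orbit G (state_action X \<phi>) x"

definition "ZT = subtopology (state_topology X) Z"

definition "Z_action = (\<lambda>t. \<lambda>z\<in>Z. state_action X \<phi> t z)"

lemma Z_closed: "closedin (state_topology X) Z"
  by (simp add: Z_def)

lemma Z_subset: "Z \<subseteq> Q"
  unfolding Z_def by (rule orbit_closure_subset[OF x_mem])

lemma topspace_ZT [simp]: "topspace ZT = Z"
  using closedin_subset[OF Z_closed] by (auto simp: ZT_def)

lemma x_mem_Z: "x \<in> Z"
  unfolding Z_def by (rule extreme_mem_orbit_closure[OF x_mem])

lemma Z_invariant: "t \<in> carrier G \<Longrightarrow> z \<in> Z \<Longrightarrow> state_action X \<phi> t z \<in> Z"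
  using SF.orbit_closure_invariant[of x t z] Q_states[OF x_mem] by (simp add: Z_def)

sublocale ZF: flow G T ZT Z_action
  unfolding ZT_def Z_action_def
  by (rule SF.subflow[OF Z_closed]) (use x_mem_Z Z_invariant in auto)

text \<open>Each \<open>z\<close> in \<open>Z\<close> lies in \<open>Q\<close>, so its orbit closure
  contains \<open>x\<close> by \<open>extreme_mem_orbit_closure\<close>, and with \<open>x\<close>
  all of \<open>Z\<close>.\<close>

lemma minimal_ZF: "minimal_flow G T ZT Z_action"
  unfolding minimal_flow_def
proof (intro conjI ballI)
  fix z assume "z \<in> topspace ZT"
  then have z: "z \<in> Z" by simp
  let ?O = "orbit G (state_action X \<phi>) z"
  have eq: "orbit G Z_action z = ?O" using z by (auto simp: orbit_def Z_action_def)
  have OZ: "?O \<subseteq> Z" using z Z_invariant by (auto simp: orbit_def)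
  have zX: "z \<in> states X" using z Z_subset Q_states by blast
  have "Z \<subseteq> state_topology X closure_of ?O"
    unfolding Z_def
    by (rule SF.orbit_closure_minimal)
      (use SF.orbit_closure_invariant[of z] zX z Z_subset extreme_mem_orbit_closure in auto)
  then have "state_topology X closure_of ?O = Z"
    using closure_of_minimal[OF OZ Z_closed] by blast
  then have "ZT closure_of ?O = Z"
    unfolding ZT_def closure_of_subtopology Int_absorb1[OF OZ] by simp
  then show "ZT closure_of orbit G Z_action z = topspace ZT" by (simp add: eq)
qed (rule ZF.flow_axioms)

end

section \<open>Strong proximality\<close>

text \<open>Eventual membership passes through finite intersections and unions, so induction over
  the generated topology reduces it to the subbasic sets, which the integrals control.\<close>

lemma weak_star_limitI:
  assumes \<rho>: "\<rho> \<in> regular_probs X" and m: "\<forall>\<^sub>F t in F. m t \<in> regular_probs X"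
    and lim: "\<And>h. h \<in> cfun X \<Longrightarrow> ((\<lambda>t. \<integral>x. h x \<partial>m t) \<longlongrightarrow> (\<integral>x. h x \<partial>\<rho>)) F"
  shows "limitin (weak_star X) m \<rho> F"
  unfolding limitin_def
proof (intro conjI allI impI)
  show "\<rho> \<in> topspace (weak_star X)" using \<rho> by simp
  fix U assume "openin (weak_star X) U \<and> \<rho> \<in> U"
  then have "generate_topology_on {{\<mu> \<in> regular_probs X. (\<integral>x. f x \<partial>\<mu>) \<in> U} | f U.
      continuous_map X euclideanreal f \<and> open U} U" and "\<rho> \<in> U"
    by (simp_all add: weak_star_def openin_topology_generated_by_iff)
  then show "\<forall>\<^sub>F t in F. m t \<in> U"
  proof (induction U rule: generate_topology_on.induct)
    case (Int A B)
    then have "\<forall>\<^sub>F t in F. m t \<in> A" "\<forall>\<^sub>F t in F. m t \<in> B" by auto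
    then show ?case by eventually_elim simp
  next
    case (UN K)
    then obtain A where A: "A \<in> K" "\<rho> \<in> A" by blast
    then have "\<forall>\<^sub>F t in F. m t \<in> A" using UN by blast
    then show ?case by eventually_elim (use A in blast)
  next
    case (Basis V)
    then obtain f and W :: "real set" where V: "V = {\<mu> \<in> regular_probs X. (\<integral>x. f x \<partial>\<mu>) \<in> W}"
      and f: "f \<in> cfun X" and W: "open W" unfolding cfun_def by blast
    have "\<forall>\<^sub>F t in F. (\<integral>x. f x \<partial>m t) \<in> W"
      using topological_tendstoD[OF lim[OF f] W] Basis.prems by (simp add: V)
    then show ?case using m by eventually_elim (simp add: V)
  qed simp
qed

lemma regular_return:
  assumes X: "Hausdorff_space X" and x: "x \<in> topspace X"
  shows "return (borel_of X) x \<in> regular_probs X"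
proof (rule regular_probsI[OF X])
  show "prob_space (return (borel_of X) x)" using x by (simp add: prob_space_return)
  fix A assume "A \<in> sets (return (borel_of X) x)"
  then have A: "A \<in> sets (borel_of X)" by simp
  show "emeasure (return (borel_of X) x) A
      \<le> (SUP K\<in>{K. compactin X K \<and> K \<subseteq> A}. emeasure (return (borel_of X) x) K)"
  proof (cases "x \<in> A")
    case True
    have "compactin X {x}" using x by simp
    then have "{x} \<in> sets (borel_of X)"
      using compactin_imp_closedin[OF X] closedin_borel_of by blast
    then have "emeasure (return (borel_of X) x) A = emeasure (return (borel_of X) x) {x}"
      using A True by simp
    also have "\<dots> \<le> (SUP K\<in>{K. compactin X K \<and> K \<subseteq> A}. emeasure (return (borel_of X) x) K)"
      using \<open>compactin X {x}\<close> True by (intro SUP_upper) auto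
    finally show ?thesis .
  next
    case False
    then show ?thesis using A by simp
  qed
qed simp

text \<open>Strong proximality speaks of measures and the barycenter argument of states; this is the
  passage from the former to the latter.\<close>

definition integral_state :: "'x topology \<Rightarrow> 'x measure \<Rightarrow> ('x \<Rightarrow> real) \<Rightarrow> real" where
  "integral_state X \<mu> = (\<lambda>f\<in>cfun X. \<integral>x. f x \<partial>\<mu>)"

lemma integral_state_closed:
  assumes X: "compact_space X" and \<mu>: "\<mu> \<in> regular_probs X"
  shows "integral_state X \<mu> \<in> states X"
proof -
  interpret prob_space \<mu> using regular_probsD(1)[OF \<mu>] .
  have sp: "space \<mu> = topspace X" by (rule regular_probsD(3)[OF \<mu>])
  have int: "integrable \<mu> f" if f: "f \<in> cfun X" for f
  proof -
    obtain B where "\<And>x. x \<in> topspace X \<Longrightarrow> \<bar>f x\<bar> \<le> B" using cfun_bounded[OF X f] by blast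
    then show ?thesis
      using continuous_map_integral[OF cfunD[OF f] \<mu>]
      by (intro integrable_const_bound[of f B]) (auto simp: sp intro!: AE_I2)
  qed
  show ?thesis
  proof (rule statesI)
    fix f assume f: "f \<in> cfun X" "\<And>x. x \<in> topspace X \<Longrightarrow> 0 \<le> f x"
    have "0 \<le> (\<integral>x. f x \<partial>\<mu>)" using f sp by (intro integral_nonneg_AE AE_I2) auto
    then show "0 \<le> integral_state X \<mu> f" using f by (simp add: integral_state_def)
  qed (auto simp: integral_state_def cfun_add cfun_mult int prob_space)
qed

lemma average_state:
  assumes "L \<in> states X" "M \<in> states X"
  shows "(\<lambda>f\<in>cfun X. (L f + M f) / 2) \<in> states X"
  by (rule statesI)
    (use assms in \<open>auto simp: state_add state_cmult cfun_add cfun_mult state_one state_nonneg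
      add_divide_distrib distrib_left add_nonneg_nonneg\<close>)

context irreducible_flow
begin

lemma eval_ZT: "f \<in> cfun X \<Longrightarrow> (\<lambda>L. L f) \<in> cfun ZT"
  by (simp add: ZT_def cfun_subtopology)

lemma Z_states: "z \<in> Z \<Longrightarrow> z \<in> states X"
  using Z_subset Q_states by blast

section \<open>The barycenter map from the states on \<open>ZT\<close> to \<open>Q\<close>\<close>

definition "barycenter \<nu> = (\<lambda>f\<in>cfun X. \<nu> (\<lambda>L. L f))"

lemma barycenter_apply: "f \<in> cfun X \<Longrightarrow> barycenter \<nu> f = \<nu> (\<lambda>L. L f)"
  by (simp add: barycenter_def)

text \<open>The value at \<open>f\<close> is at most the largest value of the evaluation at
  \<open>f\<close> on the compact \<open>Z\<close>, so the barycenter lies in every half-space that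
  contains \<open>Z\<close>.\<close>

lemma barycenter_mem:
  assumes \<nu>: "\<nu> \<in> states ZT"
  shows "barycenter \<nu> \<in> Q"
proof -
  have "barycenter \<nu> \<in> states X"
  proof (rule statesI)
    show "barycenter \<nu> (\<lambda>_. 1) = 1"
      using state_cong[OF \<nu> eval_ZT[OF cfun_const[of 1]] cfun_const[of 1]] state_one[OF \<nu>]
      by (simp add: barycenter_def state_one[OF Z_states])
    fix f assume f: "f \<in> cfun X"
    show "barycenter \<nu> (\<lambda>x. f x + g x) = barycenter \<nu> f + barycenter \<nu> g" if g: "g \<in> cfun X" for g
    proof -
      have "\<nu> (\<lambda>L. L (\<lambda>x. f x + g x)) = \<nu> (\<lambda>L. L f + L g)"
        using f g by (intro state_cong[OF \<nu>] cfun_add eval_ZT) (auto simp: state_add[OF Z_states])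
      then show ?thesis using f g by (simp add: barycenter_def cfun_add state_add[OF \<nu>] eval_ZT)
    qed
    show "barycenter \<nu> (\<lambda>x. c * f x) = c * barycenter \<nu> f" for c
    proof -
      have "\<nu> (\<lambda>L. L (\<lambda>x. c * f x)) = \<nu> (\<lambda>L. c * L f)"
        using f by (intro state_cong[OF \<nu>] cfun_mult cfun_const eval_ZT) (auto simp: state_cmult[OF Z_states])
      then show ?thesis using f by (simp add: barycenter_def cfun_mult state_cmult[OF \<nu>] eval_ZT)
    qed
    show "0 \<le> barycenter \<nu> f" if "\<And>x. x \<in> topspace X \<Longrightarrow> 0 \<le> f x"
      using f that state_nonneg[OF Z_states f] by (simp add: barycenter_def) (intro state_nonneg[OF \<nu>] eval_ZT, auto)
  qed (simp add: barycenter_def)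
  moreover have "\<exists>q\<in>Q. barycenter \<nu> f \<le> q f" if f: "f \<in> cfun X" for f
  proof -
    obtain w where w: "w \<in> Z" "\<And>v. v \<in> Z \<Longrightarrow> v f \<le> w f"
      using cfun_attains_max[OF ZF.compact_phase ZF.nonempty_phase eval_ZT[OF f]] by auto
    have "barycenter \<nu> f \<le> w f"
      using f w by (simp add: barycenter_def) (intro state_upper[OF \<nu>] eval_ZT, auto)
    then show ?thesis using w(1) Z_subset by blast
  qed
  ultimately show ?thesis using Q_half_space unfolding half_space_closed_def by blast
qed

lemma continuous_barycenter: "continuous_map (state_topology ZT) (state_topology X) barycenter"
proof (rule continuous_map_state_topologyI)
  show "barycenter \<nu> \<in> states X" if "\<nu> \<in> topspace (state_topology ZT)" for \<nu>
    using barycenter_mem that Q_states by simp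
  show "continuous_map (state_topology ZT) euclideanreal (\<lambda>\<nu>. barycenter \<nu> f)" if "f \<in> cfun X" for f
    using cfunD[OF cfun_eval[OF eval_ZT[OF that]]] that by (simp add: barycenter_def)
qed

lemma barycenter_action:
  assumes \<nu>: "\<nu> \<in> states ZT" and t: "t \<in> carrier G"
  shows "barycenter (state_action ZT Z_action t \<nu>) = state_action X \<phi> t (barycenter \<nu>)"
proof (rule state_eqI)
  have b: "barycenter \<nu> \<in> states X" using barycenter_mem[OF \<nu>] Q_states by blast
  show "barycenter (state_action ZT Z_action t \<nu>) \<in> states X"
    using barycenter_mem[OF ZF.state_action_closed[OF \<nu> t]] Q_states by blast
  show "state_action X \<phi> t (barycenter \<nu>) \<in> states X" by (rule state_action_closed[OF b t])
  fix f assume f: "f \<in> cfun X"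
  have "\<nu> (\<lambda>L. Z_action t L f) = \<nu> (\<lambda>L. L (\<lambda>x. f (\<phi> t x)))"
    using f t ZF.cfun_translate[OF eval_ZT[OF f] t]
    by (intro state_cong[OF \<nu>] eval_ZT cfun_translate)
      (auto simp: Z_action_def state_action_apply[OF Z_states])
  then show "barycenter (state_action ZT Z_action t \<nu>) f = state_action X \<phi> t (barycenter \<nu>) f"
    using f t by (simp add: barycenter_apply state_action_apply[OF \<nu>] state_action_apply[OF b] eval_ZT
        cfun_translate)
qed

text \<open>The barycenters of the compact orbit closure of \<open>\<nu>0\<close> form a closed set
  that contains the orbit of a point of \<open>Q\<close>, hence contains \<open>x\<close>. A state
  over \<open>x\<close> is the evaluation at \<open>x\<close>, by extremality.\<close>

lemma extreme_in_state_orbit_closure: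
  assumes \<nu>0: "\<nu>0 \<in> states ZT"
  obtains \<nu> where "\<nu> \<in> state_topology ZT closure_of orbit G (state_action ZT Z_action) \<nu>0"
    "\<And>h. h \<in> cfun ZT \<Longrightarrow> \<nu> h = h x"
proof -
  let ?S = "state_topology ZT" and ?O = "orbit G (state_action ZT Z_action) \<nu>0"
  interpret SZ: flow G T ?S "state_action ZT Z_action" by (rule ZF.state_flow)
  have O: "?O \<subseteq> topspace ?S" using SZ.orbit_subset[of \<nu>0] \<nu>0 by simp
  have "compactin ?S (?S closure_of ?O)"
    by (intro closedin_compact_space SZ.compact_phase closedin_closure_of)
  then have "closedin (state_topology X) (barycenter ` (?S closure_of ?O))"
    by (intro compactin_imp_closedin Hausdorff_state_topology image_compactin[OF _ continuous_barycenter])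
  moreover have "orbit G (state_action X \<phi>) (barycenter \<nu>0) \<subseteq> barycenter ` (?S closure_of ?O)"
  proof
    fix y assume "y \<in> orbit G (state_action X \<phi>) (barycenter \<nu>0)"
    then obtain t where t: "t \<in> carrier G" "y = state_action X \<phi> t (barycenter \<nu>0)"
      by (auto simp: orbit_def)
    then have "y = barycenter (state_action ZT Z_action t \<nu>0)" by (simp add: barycenter_action[OF \<nu>0])
    moreover have "state_action ZT Z_action t \<nu>0 \<in> ?O" using t by (auto simp: orbit_def)
    ultimately show "y \<in> barycenter ` (?S closure_of ?O)" using closure_of_subset[OF O] by blast
  qed
  ultimately have "x \<in> barycenter ` (?S closure_of ?O)"
    using closure_of_minimal extreme_mem_orbit_closure[OF barycenter_mem[OF \<nu>0]] by blast
  then obtain \<nu> where \<nu>: "\<nu> \<in> ?S closure_of ?O" "x = barycenter \<nu>" by blast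
  have \<nu>Z: "\<nu> \<in> states ZT" using \<nu>(1) in_closure_of[of \<nu> ?S ?O] by simp
  have bary: "\<nu> (\<lambda>L. L f) = x f" if "f \<in> cfun X" for f
    using barycenter_apply[OF that, of \<nu>] \<nu>(2)[symmetric] by simp
  interpret B: extreme_barycenter X Q Z x \<nu>
    by unfold_locales
      (use compact_phase Q_half_space extreme Z_closed Z_subset \<nu>Z[unfolded ZT_def] bary in auto)
  have "\<nu> h = h x" if "h \<in> cfun ZT" for h
    using B.state_eq_eval that by (simp add: B.S_def ZT_def)
  then show ?thesis by (rule that[OF \<nu>(1)])
qed

lemma integral_push:
  assumes \<mu>: "\<mu> \<in> regular_probs ZT" and t: "t \<in> carrier G" and h: "h \<in> cfun ZT"
  shows "(\<integral>z. h z \<partial>push_action ZT Z_action t \<mu>) = integral_state ZT \<mu> (\<lambda>z. h (Z_action t z))"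
proof -
  have "(\<integral>z. h z \<partial>distr \<mu> (borel_of ZT) (Z_action t)) = (\<integral>z. h (Z_action t z) \<partial>\<mu>)"
  proof (rule integral_distr)
    show "Z_action t \<in> measurable \<mu> (borel_of ZT)"
      using continuous_map_measurable[OF ZF.continuous_translate[OF t]]
      by (simp add: regular_probsD(4)[OF \<mu>])
    show "h \<in> borel_measurable (borel_of ZT)"
      using continuous_map_measurable[OF cfunD[OF h]]
      by (simp add: borel_of_def[of euclideanreal] borel_def)
  qed
  then show ?thesis
    using \<mu> ZF.cfun_translate[OF h t] by (simp add: push_action_def integral_state_def)
qed

text \<open>Some point mass is a limit of translates of \<open>(\<mu>1 + \<mu>2)/2\<close>; a point mass being extreme,
  the same translates of \<open>\<mu>1\<close> and of \<open>\<mu>2\<close> converge to it.\<close>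

lemma strongly_proximal_ZF: "strongly_proximal G ZT Z_action"
  unfolding strongly_proximal_def proximal_def topspace_weak_star
proof (intro ballI)
  fix \<mu>1 \<mu>2 assume \<mu>: "\<mu>1 \<in> regular_probs ZT" "\<mu>2 \<in> regular_probs ZT"
  define I1 where "I1 = integral_state ZT \<mu>1"
  define I2 where "I2 = integral_state ZT \<mu>2"
  have I: "I1 \<in> states ZT" "I2 \<in> states ZT"
    using integral_state_closed[OF ZF.compact_phase] \<mu> by (simp_all add: I1_def I2_def)
  define \<nu>0 where "\<nu>0 = (\<lambda>h\<in>cfun ZT. (I1 h + I2 h) / 2)"
  have \<nu>0: "\<nu>0 \<in> states ZT" unfolding \<nu>0_def by (rule average_state[OF I])
  obtain \<nu> where \<nu>: "\<nu> \<in> state_topology ZT closure_of orbit G (state_action ZT Z_action) \<nu>0"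
    and \<nu>h: "\<And>h. h \<in> cfun ZT \<Longrightarrow> \<nu> h = h x"
    using extreme_in_state_orbit_closure[OF \<nu>0] by blast
  have \<nu>Z: "\<nu> \<in> states ZT" using \<nu> by (simp add: in_closure_of)
  \<comment> \<open>The filter plays the net of those group elements that move \<open>\<nu>0\<close>
    towards \<nu>; it is proper because \<nu> lies in the closure of the orbit.\<close>
  define F where "F = inf (filtercomap (\<lambda>t. state_action ZT Z_action t \<nu>0)
      (nhdsin (state_topology ZT) \<nu>)) (principal (carrier G))"
  have FG: "\<forall>\<^sub>F t in F. t \<in> carrier G"
    by (simp add: F_def eventually_inf_principal)
  have nbhd: "\<forall>\<^sub>F t in F. state_action ZT Z_action t \<nu>0 \<in> U"
    if "openin (state_topology ZT) U" "\<nu> \<in> U" for U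
  proof -
    have "\<forall>\<^sub>F s in nhdsin (state_topology ZT) \<nu>. s \<in> U"
      using that by (auto simp: eventually_nhdsin)
    then have "\<forall>\<^sub>F t in filtercomap (\<lambda>t. state_action ZT Z_action t \<nu>0) (nhdsin (state_topology ZT) \<nu>).
        state_action ZT Z_action t \<nu>0 \<in> U"
      by (rule eventually_filtercomapI)
    then show ?thesis by (simp add: F_def eventually_inf_principal eventually_mono)
  qed
  have Fbot: "F \<noteq> bot"
  proof
    assume "F = bot"
    then have "\<forall>\<^sub>F t in F. False" by simp
    then obtain U where "openin (state_topology ZT) U" "\<nu> \<in> U"
      "\<And>t. state_action ZT Z_action t \<nu>0 \<in> U \<Longrightarrow> t \<notin> carrier G"
      unfolding F_def eventually_inf_principal eventually_filtercomap eventually_nhdsin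
      using \<nu>Z by auto
    then show False using \<nu> unfolding in_closure_of orbit_def by blast
  qed
  have lim0: "((\<lambda>t. \<nu>0 (\<lambda>z. k (Z_action t z))) \<longlongrightarrow> k x) F" if k: "k \<in> cfun ZT" for k
  proof (rule topological_tendstoI)
    fix U :: "real set" assume U: "open U" "k x \<in> U"
    have "openin (state_topology ZT) {\<kappa> \<in> topspace (state_topology ZT). \<kappa> k \<in> U}"
      using openin_continuous_map_preimage[OF cfunD[OF cfun_eval[OF k]], of U] U by simp
    from nbhd[OF this] have "\<forall>\<^sub>F t in F. state_action ZT Z_action t \<nu>0 k \<in> U"
      using U \<nu>Z \<nu>h[OF k] by (auto elim: eventually_mono)
    then show "\<forall>\<^sub>F t in F. \<nu>0 (\<lambda>z. k (Z_action t z)) \<in> U"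
      by (simp add: state_action_apply[OF \<nu>0 k])
  qed
  define \<rho> where "\<rho> = return (borel_of ZT) x"
  have \<rho>: "\<rho> \<in> regular_probs ZT"
    unfolding \<rho>_def using x_mem_Z by (intro regular_return ZF.Hausdorff_phase) simp
  \<comment> \<open>Each of the two measures is at most twice their average on nonnegative
    functions. The translates of the deviation \<open>k\<close> of \<open>h\<close> from
    \<open>h x\<close> tend to 0 under \<open>\<nu>0\<close>, and so under either measure.\<close>
  have lim: "limitin (weak_star ZT) (\<lambda>t. push_action ZT Z_action t \<mu>) \<rho> F"
    if \<mu>: "\<mu> \<in> regular_probs ZT" and le: "\<And>k. k \<in> cfun ZT \<Longrightarrow> (\<And>z. z \<in> Z \<Longrightarrow> 0 \<le> k z) \<Longrightarrow>
      integral_state ZT \<mu> k \<le> 2 * \<nu>0 k" for \<mu>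
  proof (rule weak_star_limitI[OF \<rho>])
    have "push_action ZT Z_action t \<mu> \<in> regular_probs ZT" if "t \<in> carrier G" for t
      using regular_probs_distr[OF ZF.continuous_translate[OF that] ZF.Hausdorff_phase ZF.Hausdorff_phase \<mu>] \<mu>
      by (simp add: push_action_def)
    then show "\<forall>\<^sub>F t in F. push_action ZT Z_action t \<mu> \<in> regular_probs ZT"
      using FG by (auto elim: eventually_mono)
    fix h assume h: "h \<in> cfun ZT"
    have I: "integral_state ZT \<mu> \<in> states ZT" by (rule integral_state_closed[OF ZF.compact_phase \<mu>])
    define k where "k = (\<lambda>z. max (h z - h x) (h x - h z))"
    have k: "k \<in> cfun ZT" unfolding k_def by (intro cfun_intros h)
    have "\<bar>integral_state ZT \<mu> (\<lambda>z. h (Z_action t z)) - h x\<bar> \<le> 2 * \<nu>0 (\<lambda>z. k (Z_action t z))"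
      if t: "t \<in> carrier G" for t
    proof -
      note ht = ZF.cfun_translate[OF h t] and kt = ZF.cfun_translate[OF k t]
      have "integral_state ZT \<mu> (\<lambda>z. h (Z_action t z) - h x) \<le> integral_state ZT \<mu> (\<lambda>z. k (Z_action t z))"
        "integral_state ZT \<mu> (\<lambda>z. h x - h (Z_action t z)) \<le> integral_state ZT \<mu> (\<lambda>z. k (Z_action t z))"
        by (intro state_mono[OF I] cfun_diff cfun_const ht kt; simp add: k_def)+
      moreover have "integral_state ZT \<mu> (\<lambda>z. k (Z_action t z)) \<le> 2 * \<nu>0 (\<lambda>z. k (Z_action t z))"
        by (rule le[OF kt]) (auto simp: k_def)
      ultimately show ?thesis
        using state_diff[OF I ht cfun_const, of "h x"] state_diff[OF I cfun_const ht, of "h x"]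
          state_const[OF I, of "h x"]
        by (simp add: abs_le_iff)
    qed
    then have bound: "\<forall>\<^sub>F t in F. norm (integral_state ZT \<mu> (\<lambda>z. h (Z_action t z)) - h x)
        \<le> 2 * \<nu>0 (\<lambda>z. k (Z_action t z))"
      using FG by (auto elim: eventually_mono)
    have "((\<lambda>t. 2 * \<nu>0 (\<lambda>z. k (Z_action t z))) \<longlongrightarrow> 0) F"
      using tendsto_mult_left[OF lim0[OF k], of 2] by (simp add: k_def)
    then have "((\<lambda>t. integral_state ZT \<mu> (\<lambda>z. h (Z_action t z)) - h x) \<longlongrightarrow> 0) F"
      by (rule Lim_null_comparison[OF bound])
    then have "((\<lambda>t. integral_state ZT \<mu> (\<lambda>z. h (Z_action t z))) \<longlongrightarrow> h x) F"
      by (rule LIM_zero_cancel)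
    moreover have "\<forall>\<^sub>F t in F. integral_state ZT \<mu> (\<lambda>z. h (Z_action t z))
        = (\<integral>z. h z \<partial>push_action ZT Z_action t \<mu>)"
      using FG integral_push[OF \<mu> _ h] by (auto elim: eventually_mono)
    ultimately have "((\<lambda>t. \<integral>z. h z \<partial>push_action ZT Z_action t \<mu>) \<longlongrightarrow> h x) F"
      by (rule Lim_transform_eventually)
    moreover have "(\<integral>z. h z \<partial>\<rho>) = h x"
      unfolding \<rho>_def
    proof (rule integral_return)
      show "x \<in> space (borel_of ZT)" using x_mem_Z by simp
      show "h \<in> borel_measurable (borel_of ZT)"
        using continuous_map_measurable[OF cfunD[OF h]]
        by (simp add: borel_of_def[of euclideanreal] borel_def)
    qed
    ultimately show "((\<lambda>t. \<integral>z. h z \<partial>push_action ZT Z_action t \<mu>) \<longlongrightarrow> (\<integral>z. h z \<partial>\<rho>)) F" by simp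
  qed
  have "limitin (weak_star ZT) (\<lambda>t. push_action ZT Z_action t \<mu>1) \<rho> F"
  proof (rule lim[OF \<mu>(1)])
    fix k assume k: "k \<in> cfun ZT" "\<And>z. z \<in> Z \<Longrightarrow> 0 \<le> k z"
    then have "0 \<le> I2 k" by (intro state_nonneg[OF I(2)]) auto
    then show "integral_state ZT \<mu>1 k \<le> 2 * \<nu>0 k" using k by (simp add: \<nu>0_def I1_def)
  qed
  moreover have "limitin (weak_star ZT) (\<lambda>t. push_action ZT Z_action t \<mu>2) \<rho> F"
  proof (rule lim[OF \<mu>(2)])
    fix k assume k: "k \<in> cfun ZT" "\<And>z. z \<in> Z \<Longrightarrow> 0 \<le> k z"
    then have "0 \<le> I1 k" by (intro state_nonneg[OF I(1)]) auto
    then show "integral_state ZT \<mu>2 k \<le> 2 * \<nu>0 k" using k by (simp add: \<nu>0_def I2_def)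
  qed
  ultimately show "\<exists>F z. F \<noteq> bot \<and> (\<forall>\<^sub>F t in F. t \<in> carrier G) \<and>
      limitin (weak_star ZT) (\<lambda>t. push_action ZT Z_action t \<mu>1) z F \<and>
      limitin (weak_star ZT) (\<lambda>t. push_action ZT Z_action t \<mu>2) z F"
    using Fbot FG by blast
qed

end

section \<open>The kernel of the action on the universal flow\<close>

text \<open>The points of the new flow are states on \<open>X\<close>. The final implication records
  what is lost once \<open>Z\<close> is abstract: if there is only one point, it is an invariant
  state.\<close>

lemma (in flow) minimal_strongly_proximal_subflow_exists:
  obtains Z :: "(('x \<Rightarrow> real) \<Rightarrow> real) topology" and \<theta> where "minimal_flow G T Z \<theta>" "strongly_proximal G Z \<theta>"
    "(\<exists>z. topspace Z = {z}) \<longrightarrow>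
       (\<exists>\<mu>\<in>regular_probs X. \<forall>t\<in>carrier G. push_action X \<phi> t \<mu> = \<mu>)"
proof -
  obtain Q where Q: "admissible Q" "\<And>Q'. admissible Q' \<Longrightarrow> Q' \<subseteq> Q \<Longrightarrow> Q' = Q"
    using minimal_admissible_exists by blast
  obtain x where x: "extreme_state X Q x"
    using extreme_state_exists[OF compact_phase, of Q] Q(1) unfolding admissible_def by blast
  interpret irreducible_flow G T X \<phi> Q x
    by unfold_locales (use Q x in auto)
  have inv: "\<exists>\<mu>\<in>regular_probs X. \<forall>t\<in>carrier G. push_action X \<phi> t \<mu> = \<mu>" if "topspace ZT = {z}" for z
  proof (rule invariant_measure_of_state[OF Q_states[OF x_mem]])
    fix t assume "t \<in> carrier G"
    from Z_invariant[OF this x_mem_Z] show "state_action X \<phi> t x = x"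
      using that x_mem_Z by simp
  qed
  show ?thesis
    by (rule that[OF minimal_ZF strongly_proximal_ZF]) (use inv in blast)
qed

section \<open>Twisting a flow by an automorphism of the group\<close>

context flow
begin

context
  fixes a assumes a: "a \<in> topological_auto G T"
begin

lemma auto_hom: "a \<in> hom G G" and auto_bij: "bij_betw a (carrier G) (carrier G)"
  and auto_continuous: "continuous_map T T a"
  using a by (auto simp: topological_auto_def auto_def Bij_def homeomorphic_imp_continuous_map)

lemma auto_closed: "t \<in> carrier G \<Longrightarrow> a t \<in> carrier G"
  using auto_bij bij_betwE by blast

lemma twisted_flow: "flow G T X (\<lambda>t. \<phi> (a t))"
proof (rule flowI)
  fix t assume t: "t \<in> carrier G"
  show "\<phi> (a t) \<in> extensional (topspace X)"
    using bij_prop0[OF auto_closed[OF t]] by (simp add: Bij_def)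
next
  fix x assume "x \<in> topspace X"
  then show "\<phi> (a \<one>) x = x" using hom_one[OF auto_hom is_group is_group] one_action by simp
next
  fix s t x assume "s \<in> carrier G" "t \<in> carrier G" "x \<in> topspace X"
  then show "\<phi> (a (s \<otimes> t)) x = \<phi> (a s) (\<phi> (a t) x)"
    using composition_rule[OF _ auto_closed auto_closed] hom_mult[OF auto_hom] by simp
next
  have "continuous_map (prod_topology T X) (prod_topology T X) (\<lambda>z. (a (fst z), snd z))"
    using continuous_map_compose[OF continuous_map_fst auto_continuous]
    by (simp add: continuous_map_paired continuous_map_snd o_def)
  from continuous_map_compose[OF this continuous_action]
  show "continuous_map (prod_topology T X) X (\<lambda>(t, x). \<phi> (a t) x)"
    by (simp add: o_def case_prod_unfold)
qed (intro compact_phase Hausdorff_phase nonempty_phase action_closed auto_closed; assumption)+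

lemma twisted_orbit: "orbit G (\<lambda>t. \<phi> (a t)) x = orbit G \<phi> x"
proof -
  have "orbit G (\<lambda>t. \<phi> (a t)) x = (\<lambda>t. \<phi> t x) ` (a ` carrier G)" by (auto simp: orbit_def)
  also have "\<dots> = orbit G \<phi> x" using auto_bij by (auto simp: orbit_def bij_betw_def)
  finally show ?thesis .
qed

text \<open>A filter that witnesses proximality is pushed forward along the inverse \<open>b\<close>
  of \<open>a\<close>; the twisted translates along the new filter are the original ones along the
  old.\<close>

lemma twisted_strongly_proximal:
  assumes sp: "strongly_proximal G X \<phi>"
  shows "strongly_proximal G X (\<lambda>t. \<phi> (a t))"
  unfolding strongly_proximal_def proximal_def
proof (intro ballI)
  define b where "b = inv_into (carrier G) a"
  have b: "b t \<in> carrier G" "a (b t) = t" if "t \<in> carrier G" for t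
    using auto_bij that by (auto simp: b_def bij_betw_def f_inv_into_f inv_into_into)
  fix \<mu> \<nu> assume "\<mu> \<in> topspace (weak_star X)" "\<nu> \<in> topspace (weak_star X)"
  then obtain F \<rho> where F: "F \<noteq> bot" "\<forall>\<^sub>F t in F. t \<in> carrier G"
    and lim: "limitin (weak_star X) (\<lambda>t. push_action X \<phi> t \<mu>) \<rho> F"
      "limitin (weak_star X) (\<lambda>t. push_action X \<phi> t \<nu>) \<rho> F"
    using sp unfolding strongly_proximal_def proximal_def by meson
  have tr: "limitin (weak_star X) (\<lambda>t. push_action X (\<lambda>t. \<phi> (a t)) t \<kappa>) \<rho> (filtermap b F)"
    if l: "limitin (weak_star X) (\<lambda>t. push_action X \<phi> t \<kappa>) \<rho> F" for \<kappa>
  proof -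
    have "\<forall>\<^sub>F t in F. push_action X \<phi> t \<kappa> = push_action X (\<lambda>t. \<phi> (a t)) (b t) \<kappa>"
      using F(2) by eventually_elim (simp add: push_action_def b)
    from limitin_transform_eventually[OF this l] show ?thesis
      by (simp add: limitin_def eventually_filtermap)
  qed
  show "\<exists>F z. F \<noteq> bot \<and> (\<forall>\<^sub>F t in F. t \<in> carrier G) \<and>
      limitin (weak_star X) (\<lambda>t. push_action X (\<lambda>t. \<phi> (a t)) t \<mu>) z F \<and>
      limitin (weak_star X) (\<lambda>t. push_action X (\<lambda>t. \<phi> (a t)) t \<nu>) z F"
  proof (intro exI conjI)
    show "filtermap b F \<noteq> bot" using F(1) by (simp add: filtermap_bot_iff)
    show "\<forall>\<^sub>F t in filtermap b F. t \<in> carrier G"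
      using F(2) by (auto simp: eventually_filtermap b elim: eventually_mono)
  qed (rule tr[OF lim(1)], rule tr[OF lim(2)])
qed

end

section \<open>The kernel as a closed characteristic subgroup\<close>

definition kernel_action :: "'g set" where
  "kernel_action = {t \<in> carrier G. \<forall>x\<in>topspace X. \<phi> t x = x}"

lemma kernel_subgroup: "subgroup kernel_action G"
proof (rule subgroupI)
  show "kernel_action \<noteq> {}" using one_action by (auto simp: kernel_action_def)
  fix s assume s: "s \<in> kernel_action"
  have "\<phi> (inv s) x = x" if x: "x \<in> topspace X" for x
    using composition_rule[OF x, of "inv s" s] s x one_action[OF x] by (auto simp: kernel_action_def)
  then show "inv s \<in> kernel_action" using s by (simp add: kernel_action_def)
  fix t assume "t \<in> kernel_action"
  then show "s \<otimes> t \<in> kernel_action" using s composition_rule by (simp add: kernel_action_def)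
qed (auto simp: kernel_action_def)

text \<open>The kernel is the intersection of the point stabilisers, each closed because points of
  \<open>X\<close> are closed and orbit maps are continuous.\<close>

lemma kernel_closed: "closedin T kernel_action"
proof -
  have c: "closedin T {t \<in> topspace T. \<phi> t x \<in> {x}}" if x: "x \<in> topspace X" for x
  proof -
    have "continuous_map T (prod_topology T X) (\<lambda>t. (t, x))"
      using x by (simp add: continuous_map_pairedI)
    from continuous_map_compose[OF this continuous_action]
    have "continuous_map T X (\<lambda>t. \<phi> t x)" by (simp add: o_def)
    moreover have "closedin X {x}"
      using x Hausdorff_phase by (simp add: closedin_Hausdorff_singleton)
    ultimately show ?thesis by (rule closedin_continuous_map_preimage)
  qed
  have "kernel_action = (\<Inter>x\<in>topspace X. {t \<in> topspace T. \<phi> t x \<in> {x}})"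
    using nonempty_phase unfolding kernel_action_def topspace_group by blast
  also have "closedin T \<dots>" by (rule closedin_INT[OF nonempty_phase c])
  finally show ?thesis .
qed

end

lemma kernel_characteristic:
  assumes un: "universal_msp_flow G T X \<phi>" and a: "a \<in> topological_auto G T"
    and t: "t \<in> flow.kernel_action G X \<phi>"
  shows "a t \<in> flow.kernel_action G X \<phi>"
proof -
  have mi: "minimal_flow G T X \<phi>" and sp: "strongly_proximal G X \<phi>"
    using un by (simp_all add: universal_msp_flow_def)
  interpret flow G T X \<phi> using mi by (simp add: minimal_flow_def)
  have "minimal_flow G T X (\<lambda>t. \<phi> (a t))"
    using mi by (simp add: minimal_flow_def twisted_flow[OF a] twisted_orbit[OF a])
  from universal_any_type[OF un this twisted_strongly_proximal[OF a sp]]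
  obtain p where p: "p ` topspace X = topspace X"
    "\<forall>t\<in>carrier G. \<forall>x\<in>topspace X. p (\<phi> t x) = \<phi> (a t) (p x)" by blast
  have t': "t \<in> carrier G" "\<And>x. x \<in> topspace X \<Longrightarrow> \<phi> t x = x"
    using t by (auto simp: kernel_action_def)
  \<comment> \<open>An element acting trivially on \<open>X\<close> acts trivially on every factor,
    and in the twisted flow \<open>t\<close> acts as \<open>a t\<close>.\<close>
  have "\<phi> (a t) y = y" if "y \<in> topspace X" for y
  proof -
    obtain x where x: "x \<in> topspace X" "y = p x" using \<open>y \<in> topspace X\<close> p(1) by blast
    then show ?thesis using p(2) t' by metis
  qed
  then show ?thesis using auto_closed[OF a t'(1)] by (simp add: kernel_action_def)
qed

theorem amenable_of_trivial_universal_flow: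
  fixes T :: "'g topology"
  assumes un: "universal_msp_flow G T X \<phi>" and X: "topspace X = {x}"
  shows "amenable G T"
  unfolding amenable_def
proof (intro allI impI)
  fix Y :: "'g set set topology" and \<psi> assume "flow G T Y \<psi>"
  then interpret Y: flow G T Y \<psi> .
  obtain Z and \<theta> :: "'g \<Rightarrow> (('g set set \<Rightarrow> real) \<Rightarrow> real) \<Rightarrow> ('g set set \<Rightarrow> real) \<Rightarrow> real"
    where Z: "minimal_flow G T Z \<theta>" "strongly_proximal G Z \<theta>"
      and inv: "(\<exists>z. topspace Z = {z}) \<longrightarrow>
        (\<exists>\<mu>\<in>regular_probs Y. \<forall>t\<in>carrier G. push_action Y \<psi> t \<mu> = \<mu>)"
    by (rule Y.minimal_strongly_proximal_subflow_exists)
  \<comment> \<open>A factor of a one-point flow is one point, which triggers the implication in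
    \<open>inv\<close>.\<close>
  from universal_any_type[OF un Z] obtain p where "p ` topspace X = topspace Z" by blast
  then have "topspace Z = {p x}" using X by simp
  then show "\<exists>\<mu>\<in>regular_probs Y. \<forall>t\<in>carrier G. push_action Y \<psi> t \<mu> = \<mu>"
    using inv by blast
qed

theorem corollary2p9:
  fixes G :: "('g, 'm) monoid_scheme" and T :: "'g topology"
    and X :: "'x topology" and \<phi> :: "'g \<Rightarrow> 'x \<Rightarrow> 'x"
  assumes "topological_group G T"
    and "characteristically_simple G T"
    and "\<not> amenable G T"
    and "universal_msp_flow G T X \<phi>"
  shows "\<forall>t\<in>carrier G. (\<forall>x\<in>topspace X. \<phi> t x = x) \<longrightarrow> t = \<one>\<^bsub>G\<^esub>"
proof (intro ballI impI, rule ccontr)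
  fix t assume t: "t \<in> carrier G" "\<forall>x\<in>topspace X. \<phi> t x = x" "t \<noteq> \<one>\<^bsub>G\<^esub>"
  have mi: "minimal_flow G T X \<phi>" using assms(4) by (simp add: universal_msp_flow_def)
  interpret flow G T X \<phi> using mi by (simp add: minimal_flow_def)
  have "t \<in> kernel_action" using t by (simp add: kernel_action_def)
  then have "{a t | a. a \<in> topological_auto G T} \<subseteq> kernel_action"
    using kernel_characteristic[OF assms(4)] by blast
  then have "generate G {a t | a. a \<in> topological_auto G T} \<subseteq> kernel_action"
    by (rule generate_subgroup_incl[OF _ kernel_subgroup])
  then have "T closure_of generate G {a t | a. a \<in> topological_auto G T} \<subseteq> kernel_action"
    by (rule closure_of_minimal[OF _ kernel_closed])
  then have triv: "carrier G \<subseteq> kernel_action"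
    using assms(2) t unfolding characteristically_simple_def topspace_group by blast
  obtain x where x: "x \<in> topspace X" using nonempty_phase by blast
  have "orbit G \<phi> x = {x}"
    using mem_orbit[OF x] triv x by (auto simp: orbit_def kernel_action_def)
  moreover have "X closure_of orbit G \<phi> x = topspace X" using mi x by (simp add: minimal_flow_def)
  ultimately have "topspace X = X closure_of {x}" by simp
  also have "\<dots> = {x}"
    using x Hausdorff_phase by (simp add: closedin_Hausdorff_singleton closure_of_closedin)
  finally show False using amenable_of_trivial_universal_flow[OF assms(4)] assms(3) by blast
qed

end
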